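(* Let $r\in(1,2)$. Let $\mu$ be a probability measure on $\mathbb{R}^d$ which satisfies the Latała–Oleszkiewicz inequality with parameter $r$ and constant $C_{LO}$. Then there exists a constant $K>0$, depending only on $C_{LO}$ and $r$, such that for any positive integer $n$, any measurable set $A\subset\mathbb{R}^{dn}$ with $\mu^{\otimes n}(A)\ge1/2$, and any $t>0$, $$\mu^{\otimes n}\left(A+\left\{(x_1,\dots,x_n)\in(\mathbb{R}^d)^n:\ \sum_{i=1}^n\min\{|x_i|^2,|x_i|^r\}\le t\right\}\right)\ge1-e^{-Kt}.$$ In particular, $$\mu^{\otimes n}\left(A+\sqrt t\,B_2^{dn}+t^{1/r}B_{r,2}^{n,d}\right)\ge1-e^{-Kt}.$$ One can take $K=\frac1{32}\min\{1/C,1/C^{r-1}\}$, where $C$ is a constant, depending only on $C_{LO}$ and $r$, such that $\mu$ satisfies the modified log-Sobolev inequality with parameter $r$ and constant $C$ (such a constant exists, for every measure $\mu$ satisfying the Latała–Oleszkiewicz inequality with parameter $r$ and constant $C_{LO}$).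
   Context: $|\cdot|$ is the Euclidean norm. A probability measure $\mu$ on $\mathbb{R}^d$ satisfies the Latała–Oleszkiewicz inequality with parameter $r\in[1,2]$ and constant $C_{LO}<\infty$ if for every smooth $f\colon\mathbb{R}^d\to\mathbb{R}$, $$\sup_{\theta\in(1,2)}\frac{\int_{\mathbb{R}^d} f^2\,d\mu-\left(\int_{\mathbb{R}^d}|f|^\theta d\mu\right)^{2/\theta}}{(2-\theta)^{2(1-1/r)}}\le C_{LO}\int_{\mathbb{R}^d}|\nabla f|^2d\mu.$$ For nonnegative $g$, $\operatorname{Ent}_\mu(g)=\int g\log g\,d\mu-\left(\int g\,d\mu\right)\log\left(\int g\,d\mu\right)$. With $\frac1r+\frac1{r'}=1$ and $H_{r'}(t)=\max\{t^2,|t|^{r'}\}$, $\mu$ satisfies the modified log-Sobolev inequality with parameter $r$ and constant $C$ if $\operatorname{Ent}_\mu(f^2)\le C\int_{\mathbb{R}^d}H_{r'}\left(\frac{|\nabla f|}{f}\right)f^2\,d\mu$ for every smooth $f\colon\mathbb{R}^d\to(0,\infty)$. $B_2^{dn}$ is the Euclidean unit ball of $\mathbb{R}^{dn}$, identified with $(\mathbb{R}^d)^n$, and $B_{r,2}^{n,d}=\left\{(x_1,\dots,x_n)\in(\mathbb{R}^d)^n:\left(\sum_{i=1}^n|x_i|^r\right)^{1/r}\le1\right\}$. Sums of sets are Minkowski sums. *)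

theory Defs
  imports "HOL-Probability.Probability"
begin

text \<open>
  The constants in the theorem must not depend on the dimension \<open>d\<close>, so \<open>d\<close> has to be quantified
  inside formulas and cannot be encoded in a type.  A point of \<open>R\<^sup>d\<close> is therefore an extensional
  function on \<open>{..<d}\<close>, and a point of \<open>(R\<^sup>d)\<^sup>n\<close> an extensional function on \<open>{..<n}\<close> with values in
  \<open>R\<^sup>d\<close>; these are the carriers of the library's product measures \<open>PiM\<close>.  The topology of
  \<^typ>\<open>nat \<Rightarrow> real\<close> (pointwise convergence) induces the Euclidean topology on \<open>R\<^sup>d\<close>.
\<close>

definition Rd :: "nat \<Rightarrow> (nat \<Rightarrow> real) set" where
  "Rd d = (\<Pi>\<^sub>E i\<in>{..<d}. UNIV)"

definition Rdn :: "nat \<Rightarrow> nat \<Rightarrow> (nat \<Rightarrow> nat \<Rightarrow> real) set" where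
  "Rdn d n = (\<Pi>\<^sub>E i\<in>{..<n}. Rd d)"

definition enorm :: "nat \<Rightarrow> (nat \<Rightarrow> real) \<Rightarrow> real" where
  "enorm d x = L2_set x {..<d}"

definition add_Rdn ::
  "nat \<Rightarrow> nat \<Rightarrow> (nat \<Rightarrow> nat \<Rightarrow> real) \<Rightarrow> (nat \<Rightarrow> nat \<Rightarrow> real) \<Rightarrow> nat \<Rightarrow> nat \<Rightarrow> real" where
  "add_Rdn d n x y = (\<lambda>i\<in>{..<n}. \<lambda>j\<in>{..<d}. x i j + y i j)"

definition scale_Rdn ::
  "nat \<Rightarrow> nat \<Rightarrow> real \<Rightarrow> (nat \<Rightarrow> nat \<Rightarrow> real) \<Rightarrow> nat \<Rightarrow> nat \<Rightarrow> real" where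
  "scale_Rdn d n c x = (\<lambda>i\<in>{..<n}. \<lambda>j\<in>{..<d}. c * x i j)"

definition minkowski_sum ::
  "nat \<Rightarrow> nat \<Rightarrow> (nat \<Rightarrow> nat \<Rightarrow> real) set \<Rightarrow> (nat \<Rightarrow> nat \<Rightarrow> real) set \<Rightarrow> (nat \<Rightarrow> nat \<Rightarrow> real) set" where
  "minkowski_sum d n A B = {add_Rdn d n x y | x y. x \<in> A \<and> y \<in> B}"


definition partial_deriv :: "nat \<Rightarrow> ((nat \<Rightarrow> real) \<Rightarrow> real) \<Rightarrow> (nat \<Rightarrow> real) \<Rightarrow> real" where
  "partial_deriv i f x = deriv (\<lambda>s. f (x(i := s))) (x i)"

text \<open>
  \<open>f\<close> is of class \<open>C\<^sup>\<infinity>\<close> on \<open>R\<^sup>d\<close>: the iterated partial derivatives of all orders exist everywhere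
  and are continuous.  The list \<open>is\<close> records the variables differentiated in; values of \<open>f\<close>
  outside \<open>Rd d\<close> are irrelevant.
\<close>

definition smooth_Rd :: "nat \<Rightarrow> ((nat \<Rightarrow> real) \<Rightarrow> real) \<Rightarrow> bool" where
  "smooth_Rd d f \<longleftrightarrow>
     (\<forall>is. set is \<subseteq> {..<d} \<longrightarrow>
        continuous_on (Rd d) (foldr partial_deriv is f) \<and>
        (\<forall>x\<in>Rd d. \<forall>i<d.
           (\<lambda>s. foldr partial_deriv is f (x(i := s))) differentiable (at (x i))))"

definition grad_norm :: "nat \<Rightarrow> ((nat \<Rightarrow> real) \<Rightarrow> real) \<Rightarrow> (nat \<Rightarrow> real) \<Rightarrow> real" where
  "grad_norm d f x = enorm d (\<lambda>i. partial_deriv i f x)"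


definition prob_measure_on :: "nat \<Rightarrow> (nat \<Rightarrow> real) measure \<Rightarrow> bool" where
  "prob_measure_on d \<mu> \<longleftrightarrow> prob_space \<mu> \<and> sets \<mu> = sets (\<Pi>\<^sub>M i\<in>{..<d}. (borel :: real measure))"

text \<open>
  The Bochner integral of a non-integrable function is \<open>0\<close>, so integrability is made explicit.
  For square integrable \<open>f\<close> all integrals on the left are finite, and the inequality is void if the
  integral on the right is infinite.  The supremum is taken in the extended reals.
\<close>

definition Latala_Oleszkiewicz :: "nat \<Rightarrow> real \<Rightarrow> real \<Rightarrow> (nat \<Rightarrow> real) measure \<Rightarrow> bool" where
  "Latala_Oleszkiewicz d r C \<mu> \<longleftrightarrow>
     (\<forall>f. smooth_Rd d f \<longrightarrow>
          integrable \<mu> (\<lambda>x. (f x)\<^sup>2) \<longrightarrow> integrable \<mu> (\<lambda>x. (grad_norm d f x)\<^sup>2) \<longrightarrow>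
          (SUP \<theta>\<in>{1<..<2}.
             ereal (((\<integral>x. (f x)\<^sup>2 \<partial>\<mu>) - (\<integral>x. \<bar>f x\<bar> powr \<theta> \<partial>\<mu>) powr (2 / \<theta>))
                    / (2 - \<theta>) powr (2 * (1 - 1 / r))))
          \<le> ereal (C * (\<integral>x. (grad_norm d f x)\<^sup>2 \<partial>\<mu>)))"

definition Ent :: "'a measure \<Rightarrow> ('a \<Rightarrow> real) \<Rightarrow> real" where
  "Ent \<mu> g = (\<integral>x. g x * ln (g x) \<partial>\<mu>) - (\<integral>x. g x \<partial>\<mu>) * ln (\<integral>x. g x \<partial>\<mu>)"

definition conj_exponent :: "real \<Rightarrow> real" where
  "conj_exponent r = r / (r - 1)"

lemma conj_exponent: "1 < r \<Longrightarrow> 1 / r + 1 / conj_exponent r = 1"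
  by (simp add: conj_exponent_def field_simps)

definition H :: "real \<Rightarrow> real \<Rightarrow> real" where
  "H q t = max (t\<^sup>2) (\<bar>t\<bar> powr q)"

text \<open>
  For integrable \<open>f\<^sup>2\<close>, the entropy of \<open>f\<^sup>2\<close> is well defined in \<open>(-\<infinity>, \<infinity>]\<close>, and it is finite iff
  \<open>f\<^sup>2 log f\<^sup>2\<close> is integrable.  The inequality with a finite right-hand side thus
  includes this integrability.
\<close>

definition modified_log_Sobolev :: "nat \<Rightarrow> real \<Rightarrow> real \<Rightarrow> (nat \<Rightarrow> real) measure \<Rightarrow> bool" where
  "modified_log_Sobolev d r C \<mu> \<longleftrightarrow>
     (\<forall>f. smooth_Rd d f \<longrightarrow> (\<forall>x\<in>Rd d. 0 < f x) \<longrightarrow>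
          integrable \<mu> (\<lambda>x. (f x)\<^sup>2) \<longrightarrow>
          integrable \<mu> (\<lambda>x. H (conj_exponent r) (grad_norm d f x / f x) * (f x)\<^sup>2) \<longrightarrow>
          integrable \<mu> (\<lambda>x. (f x)\<^sup>2 * ln ((f x)\<^sup>2)) \<and>
          Ent \<mu> (\<lambda>x. (f x)\<^sup>2)
            \<le> C * (\<integral>x. H (conj_exponent r) (grad_norm d f x / f x) * (f x)\<^sup>2 \<partial>\<mu>))"


definition power_measure :: "(nat \<Rightarrow> real) measure \<Rightarrow> nat \<Rightarrow> (nat \<Rightarrow> nat \<Rightarrow> real) measure" where
  "power_measure \<mu> n = (\<Pi>\<^sub>M i\<in>{..<n}. \<mu>)"

text \<open>
  The Minkowski sum of a Borel set and a compact set is analytic but need not be Borel, whereas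
  \<^const>\<open>measure\<close> is \<open>0\<close> on sets outside the \<open>\<sigma>\<close>-algebra.  The measure of such a sum is read as the
  inner measure; this is the value of the measure, respectively of its completion,
  on every set on which the latter is defined.
\<close>

definition inner_measure :: "'a measure \<Rightarrow> 'a set \<Rightarrow> real" where
  "inner_measure M S = (SUP T\<in>{T\<in>sets M. T \<subseteq> S}. measure M T)"

lemma (in finite_measure) inner_measure_completion:
  assumes "S \<in> sets (completion M)"
  shows "inner_measure M S = measure (completion M) S"
proof -
  interpret C: finite_measure "completion M"
    by (rule finite_measureI) simp
  have *: "measure M (main_part M S) = measure (completion M) S"
    using assms by (simp add: measure_def emeasure_completion)
  have "measure M T \<le> measure (completion M) S" if "T \<in> sets M" "T \<subseteq> S" for T
    using C.finite_measure_mono[OF that(2) assms] that(1) by (simp add: measure_completion)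
  moreover have "main_part M S \<subseteq> S"
    using main_part_null_part_Un[OF assms] by blast
  moreover have "main_part M S \<in> sets M"
    using assms by simp
  ultimately show ?thesis
    unfolding inner_measure_def * [symmetric]
    by (intro cSup_eq_maximum) auto
qed

lemma (in finite_measure) inner_measure_eq_measure:
  "S \<in> sets M \<Longrightarrow> inner_measure M S = measure M S"
  by (simp add: inner_measure_completion measure_completion)


definition enlargement_set :: "nat \<Rightarrow> nat \<Rightarrow> real \<Rightarrow> real \<Rightarrow> (nat \<Rightarrow> nat \<Rightarrow> real) set" where
  "enlargement_set d n r t =
     {x \<in> Rdn d n. (\<Sum>i<n. min ((enorm d (x i))\<^sup>2) (enorm d (x i) powr r)) \<le> t}"

definition euclidean_unit_ball :: "nat \<Rightarrow> nat \<Rightarrow> (nat \<Rightarrow> nat \<Rightarrow> real) set" where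
  "euclidean_unit_ball d n =
     {x \<in> Rdn d n. L2_set (\<lambda>(i, j). x i j) ({..<n} \<times> {..<d}) \<le> 1}"

definition mixed_unit_ball :: "nat \<Rightarrow> nat \<Rightarrow> real \<Rightarrow> (nat \<Rightarrow> nat \<Rightarrow> real) set" where
  "mixed_unit_ball d n r =
     {x \<in> Rdn d n. (\<Sum>i<n. enorm d (x i) powr r) powr (1 / r) \<le> 1}"

definition two_level_concentration :: "nat \<Rightarrow> real \<Rightarrow> real \<Rightarrow> (nat \<Rightarrow> real) measure \<Rightarrow> bool" where
  "two_level_concentration d r K \<mu> \<longleftrightarrow>
     (\<forall>n A t. 0 < n \<longrightarrow> A \<in> sets (power_measure \<mu> n) \<longrightarrow>
        measure (power_measure \<mu> n) A \<ge> 1 / 2 \<longrightarrow> 0 < t \<longrightarrow>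
        inner_measure (power_measure \<mu> n) (minkowski_sum d n A (enlargement_set d n r t))
          \<ge> 1 - exp (- (K * t)) \<and>
        inner_measure (power_measure \<mu> n)
          (minkowski_sum d n
            (minkowski_sum d n A (scale_Rdn d n (sqrt t) ` euclidean_unit_ball d n))
            (scale_Rdn d n (t powr (1 / r)) ` mixed_unit_ball d n r))
          \<ge> 1 - exp (- (K * t)))"

end

theory Submission
  imports Defs
begin

text \<open>
  Write \<open>q = r / (r - 1)\<close> for the conjugate exponent, so that \<open>q > 2\<close>, and \<open>p = r / 2\<close>.

  \<^bold>\<open>Latala--Oleszkiewicz implies modified log-Sobolev.\<close>
  Applied to a function supported on a set of measure at most \<open>exp (- k)\<close>, with
  \<open>2 - \<theta>\<close> of order \<open>1 / k\<close>, the Latala--Oleszkiewicz inequality and Hoelder's inequality give a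
  Poincare inequality without mean, whose constant is of order \<open>k\<close> to the power \<open>- 2 / q\<close>
  (\<open>small_support_Poincare\<close>).  Let \<open>f\<close> be positive with \<open>\<integral> f\<^sup>2 = 1\<close>; then \<open>f \<ge> 2 ^ k\<close> on a set
  of measure at most \<open>1 / 4 ^ k\<close>, and a smooth truncation of \<open>f\<close> between the levels
  \<open>2 ^ k\<close> and \<open>2 ^ (k + 1)\<close> bounds the measure of the next level set by the energy of \<open>f\<close> on this
  dyadic piece (\<open>superlevel_recursion\<close>).  The entropy carried by large values of \<open>f\<close> is of order
  \<open>\<Sum>k. k 4 ^ k \<mu> {f \<ge> 2 ^ k}\<close>.  In the resulting sum Young's inequality splits
  \<open>(|\<nabla> f| / f)\<^sup>2\<close> times \<open>k\<close> to the power \<open>1 - 2 / q\<close> into \<open>(|\<nabla> f| / f)\<close> to the power \<open>q\<close>, which is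
  dominated by the right-hand side of the modified log-Sobolev inequality, and a small multiple of
  \<open>k\<close>, which is absorbed into the left-hand side (\<open>Young_split\<close>, \<open>absorbed_sum_bound\<close>).
  Where \<open>f \<le> 4\<close> the entropy is controlled by \<open>\<integral> (f - 1)\<^sup>2\<close>, hence by \<open>\<integral> |\<nabla> f|\<^sup>2\<close>
  (\<open>L2_deviation_from_1\<close>).

  \<^bold>\<open>Modified log-Sobolev implies concentration.\<close>
  The function \<open>c z = (1 + |z|\<^sup>2) powr p - 1\<close> is smooth, is comparable with
  \<open>min {|z|\<^sup>2, |z| powr r}\<close>, and satisfies \<open>H q (|\<nabla> c| / 2) \<le> p c\<close> (\<open>cost_lower_bound\<close>,
  \<open>H_cost_slope\<close>).  Instead of the infimal convolution \<open>x \<mapsto> min {s, inf {\<Sum>i. c (x i - a i) | a \<in> A}}\<close>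
  the proof uses its soft version over a finite subset of \<open>A\<close>,
  \<open>G = - ln (exp (- \<beta> s) + \<Sum>a. exp (- \<beta> \<Sum>i. c (x i - a i))) / \<beta>\<close>.
  It is smooth, and its gradient is a weighted mean of the gradients of the costs, so by convexity
  of \<open>H q\<close> the quantity \<open>\<Sum>i. H q (|\<nabla>\<^sub>i G| / 2)\<close> is at most \<open>p\<close> times the weighted mean of the
  costs, which exceeds \<open>s\<close> only by a multiple of \<open>1 / \<beta>\<close> (\<open>sum_weight_total_cost_le\<close>).
  Subadditivity of entropy (\<open>Ent_PiM_le\<close>) transports the modified log-Sobolev
  inequality to the product, and the Herbst argument (\<open>Herbst_argument\<close>) turns it into
  a bound on the exponential moments of \<open>G\<close>.  If the finite set is a fine enough net of \<open>A\<close>, then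
  \<open>G\<close> is almost \<open>0\<close> on nearly half of the space, hence its mean is not much larger than \<open>s / 2\<close>,
  while \<open>G\<close> is almost \<open>s\<close> off the enlargement of \<open>A\<close>; Markov's inequality
  concludes.  The numerical losses (discretisation, comparison of costs) fit into the factor \<open>32\<close>.
\<close>


section \<open>Smooth functions on Euclidean space\<close>

lemma Rd_upd: "x \<in> Rd d \<Longrightarrow> i < d \<Longrightarrow> x(i := s) \<in> Rd d"
  by (auto simp: Rd_def PiE_iff extensional_def)

text \<open>
  Smoothness involves all iterated partial derivatives, so it is established coinductively: it
  suffices to find a family of continuous functions that is closed under partial derivatives.
  Closure is only up to equality on \<open>Rd d\<close>, which is harmless because the lines along which one
  differentiates stay inside \<open>Rd d\<close>.
\<close>
lemma smooth_Rd_coinduct: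
  assumes "f \<in> F"
    and cont: "\<And>f. f \<in> F \<Longrightarrow> continuous_on (Rd d) f"
    and deriv: "\<And>f i. f \<in> F \<Longrightarrow> i < d \<Longrightarrow>
      \<exists>g\<in>F. \<forall>x\<in>Rd d. ((\<lambda>s. f (x(i := s))) has_real_derivative g x) (at (x i))"
  shows "smooth_Rd d f"
proof -
  have pd: "partial_deriv i h x = g' x"
    if "\<forall>x\<in>Rd d. h x = g x" "x \<in> Rd d" "i < d"
      "\<forall>x\<in>Rd d. ((\<lambda>s. g (x(i := s))) has_real_derivative g' x) (at (x i))" for h g g' i x
  proof -
    have "(\<lambda>s. h (x(i := s))) = (\<lambda>s. g (x(i := s)))"
      using that Rd_upd by blast
    then show ?thesis
      using that unfolding partial_deriv_def by (auto intro: DERIV_imp_deriv)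
  qed
  have *: "\<exists>g\<in>F. \<forall>x\<in>Rd d. foldr partial_deriv is f x = g x" if "set is \<subseteq> {..<d}" for "is"
    using that
  proof (induction "is")
    case Nil
    then show ?case using assms(1) by auto
  next
    case (Cons i js)
    then obtain g where g: "g \<in> F" "\<forall>x\<in>Rd d. foldr partial_deriv js f x = g x" by auto
    obtain g' where g': "g' \<in> F"
      "\<forall>x\<in>Rd d. ((\<lambda>s. g (x(i := s))) has_real_derivative g' x) (at (x i))"
      using deriv[OF g(1), of i] Cons by auto
    have "\<forall>x\<in>Rd d. foldr partial_deriv (i # js) f x = g' x"
      using pd[OF g(2) _ _ g'(2)] Cons.prems by simp
    then show ?case using g' by blast
  qed
  show ?thesis
    unfolding smooth_Rd_def
  proof (intro allI impI conjI ballI)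
    fix js assume js: "set js \<subseteq> {..<d}"
    obtain g where g: "g \<in> F" "\<forall>x\<in>Rd d. foldr partial_deriv js f x = g x" using *[OF js] by auto
    show "continuous_on (Rd d) (foldr partial_deriv js f)"
      using cont[OF g(1)] g(2) by (simp cong: continuous_on_cong)
    fix x i assume x: "x \<in> Rd d" "i < d"
    have "(\<lambda>s. foldr partial_deriv js f (x(i := s))) = (\<lambda>s. g (x(i := s)))"
      using g(2) Rd_upd x by blast
    then show "(\<lambda>s. foldr partial_deriv js f (x(i := s))) differentiable at (x i)"
      using deriv[OF g(1) x(2)] x(1) by (auto simp: real_differentiable_def)
  qed
qed

lemma smooth_Rd_continuous: "smooth_Rd d f \<Longrightarrow> continuous_on (Rd d) f"
  unfolding smooth_Rd_def by (drule spec[of _ "[]"]) simp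

lemma smooth_Rd_DERIV:
  assumes "smooth_Rd d f" "x \<in> Rd d" "i < d"
  shows "((\<lambda>s. f (x(i := s))) has_real_derivative partial_deriv i f x) (at (x i))"
  using assms unfolding smooth_Rd_def partial_deriv_def
  by (auto dest!: spec[of _ "[]"] simp: DERIV_deriv_iff_real_differentiable)

lemma smooth_Rd_partial_deriv:
  assumes "smooth_Rd d f" "i < d"
  shows "smooth_Rd d (partial_deriv i f)"
  unfolding smooth_Rd_def
proof (intro allI impI)
  fix js assume "set js \<subseteq> {..<d}"
  then have "set (js @ [i]) \<subseteq> {..<d}" using assms by auto
  then show "continuous_on (Rd d) (foldr partial_deriv js (partial_deriv i f)) \<and>
      (\<forall>x\<in>Rd d. \<forall>ia<d. (\<lambda>s. foldr partial_deriv js (partial_deriv i f) (x(ia := s)))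
        differentiable at (x ia))"
    using spec[OF assms(1)[unfolded smooth_Rd_def], of "js @ [i]"] by simp
qed

text \<open>A function \<open>D 0\<close> of one variable that is \<open>C\<^sup>\<infinity>\<close> on \<open>U\<close>, presented with its derivatives \<open>D k\<close>.\<close>
definition derivative_tower :: "real set \<Rightarrow> (nat \<Rightarrow> real \<Rightarrow> real) \<Rightarrow> bool" where
  "derivative_tower U D \<longleftrightarrow> open U \<and> (\<forall>k. \<forall>u\<in>U. (D k has_real_derivative D (Suc k) u) (at u))"

text \<open>
  The family to which the coinduction is applied. Containing all smooth functions and being closed
  under products and under composition with every derivative of a smooth function of one variable,
  it absorbs the Leibniz and chain rules, so all closure properties of smooth functions follow at
  once.
\<close>
inductive_set smooth_alg :: "nat \<Rightarrow> ((nat \<Rightarrow> real) \<Rightarrow> real) set" for d where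
  base: "smooth_Rd d f \<Longrightarrow> f \<in> smooth_alg d"
| const: "(\<lambda>_. c) \<in> smooth_alg d"
| coord: "j < d \<Longrightarrow> (\<lambda>x. x j) \<in> smooth_alg d"
| add: "f \<in> smooth_alg d \<Longrightarrow> g \<in> smooth_alg d \<Longrightarrow> (\<lambda>x. f x + g x) \<in> smooth_alg d"
| mult: "f \<in> smooth_alg d \<Longrightarrow> g \<in> smooth_alg d \<Longrightarrow> (\<lambda>x. f x * g x) \<in> smooth_alg d"
| comp: "f \<in> smooth_alg d \<Longrightarrow> (\<And>x. x \<in> Rd d \<Longrightarrow> f x \<in> U) \<Longrightarrow> derivative_tower U D
    \<Longrightarrow> (\<lambda>x. D m (f x)) \<in> smooth_alg d"

lemma smooth_alg_smooth:
  assumes "f \<in> smooth_alg d"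
  shows "smooth_Rd d f"
proof (rule smooth_Rd_coinduct[OF assms])
  show "continuous_on (Rd d) f" if "f \<in> smooth_alg d" for f
    using that
  proof induction
    case (base f)
    then show ?case by (rule smooth_Rd_continuous)
  next
    case (coord j)
    show ?case by (rule continuous_on_product_then_coordinatewise[OF continuous_on_id])
  next
    case (comp f U D m)
    have "continuous_on U (D m)"
      using comp.hyps unfolding derivative_tower_def
      by (intro DERIV_continuous_on[where D = "D (Suc m)"]) (auto intro: has_field_derivative_at_within)
    then show ?case
      using comp by (intro continuous_on_compose2[OF _ comp.IH]) auto
  qed (intro continuous_intros; assumption)+
next
  show "\<exists>g\<in>smooth_alg d. \<forall>x\<in>Rd d. ((\<lambda>s. f (x(i := s))) has_real_derivative g x) (at (x i))"
    if "f \<in> smooth_alg d" "i < d" for f i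
    using that
  proof induction
    case (base f)
    then show ?case
      by (intro bexI[of _ "partial_deriv i f"] ballI smooth_Rd_DERIV smooth_alg.base
          smooth_Rd_partial_deriv)
  next
    case (const c)
    show ?case by (intro bexI[of _ "\<lambda>_. 0"] smooth_alg.const) auto
  next
    case (coord j)
    show ?case
      by (intro bexI[of _ "\<lambda>_. if i = j then 1 else 0"] smooth_alg.const) auto
  next
    case (add f g)
    then obtain f' g' where h: "f' \<in> smooth_alg d" "g' \<in> smooth_alg d"
      "\<forall>x\<in>Rd d. ((\<lambda>s. f (x(i := s))) has_real_derivative f' x) (at (x i))"
      "\<forall>x\<in>Rd d. ((\<lambda>s. g (x(i := s))) has_real_derivative g' x) (at (x i))" by blast
    have *: "((\<lambda>s. f (x(i := s)) + g (x(i := s))) has_real_derivative f' x + g' x) (at (x i))"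
      if "x \<in> Rd d" for x
      using DERIV_add[OF h(3)[rule_format, OF that] h(4)[rule_format, OF that]] .
    show ?case
      by (intro bexI[of _ "\<lambda>x. f' x + g' x"] smooth_alg.add h ballI *)
  next
    case (mult f g)
    then obtain f' g' where h: "f' \<in> smooth_alg d" "g' \<in> smooth_alg d"
      "\<forall>x\<in>Rd d. ((\<lambda>s. f (x(i := s))) has_real_derivative f' x) (at (x i))"
      "\<forall>x\<in>Rd d. ((\<lambda>s. g (x(i := s))) has_real_derivative g' x) (at (x i))" by blast
    have *: "((\<lambda>s. f (x(i := s)) * g (x(i := s))) has_real_derivative f' x * g x + g' x * f x)
        (at (x i))" if "x \<in> Rd d" for x
      using DERIV_mult[OF h(3)[rule_format, OF that] h(4)[rule_format, OF that]] by simp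
    show ?case
      by (intro bexI[of _ "\<lambda>x. f' x * g x + g' x * f x"] smooth_alg.add smooth_alg.mult h mult.hyps ballI *)
  next
    case (comp f U D m)
    then obtain f' where h: "f' \<in> smooth_alg d"
      "\<forall>x\<in>Rd d. ((\<lambda>s. f (x(i := s))) has_real_derivative f' x) (at (x i))" by blast
    have *: "((\<lambda>s. D m (f (x(i := s)))) has_real_derivative D (Suc m) (f x) * f' x) (at (x i))"
      if "x \<in> Rd d" for x
    proof (rule DERIV_chain2[where f = "D m" and g = "\<lambda>s. f (x(i := s))"])
      show "(D m has_real_derivative D (Suc m) (f x)) (at (f (x(i := x i))))"
        using comp that unfolding derivative_tower_def by simp
    qed (use h(2) that in blast)
    show ?case
      by (intro bexI[of _ "\<lambda>x. D (Suc m) (f x) * f' x"] smooth_alg.mult h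
          smooth_alg.comp[OF comp.hyps] ballI *)
  qed
qed

lemma smooth_Rd_const: "smooth_Rd d (\<lambda>_. c)"
  by (intro smooth_alg_smooth smooth_alg.const)

lemma smooth_Rd_coord: "j < d \<Longrightarrow> smooth_Rd d (\<lambda>x. x j)"
  by (intro smooth_alg_smooth smooth_alg.coord)

lemma smooth_Rd_add: "smooth_Rd d f \<Longrightarrow> smooth_Rd d g \<Longrightarrow> smooth_Rd d (\<lambda>x. f x + g x)"
  by (rule smooth_alg_smooth[OF smooth_alg.add[OF smooth_alg.base smooth_alg.base]])

lemma smooth_Rd_mult: "smooth_Rd d f \<Longrightarrow> smooth_Rd d g \<Longrightarrow> smooth_Rd d (\<lambda>x. f x * g x)"
  by (rule smooth_alg_smooth[OF smooth_alg.mult[OF smooth_alg.base smooth_alg.base]])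

lemma smooth_Rd_comp:
  "smooth_Rd d f \<Longrightarrow> derivative_tower U D \<Longrightarrow> (\<And>x. x \<in> Rd d \<Longrightarrow> f x \<in> U) \<Longrightarrow> smooth_Rd d (\<lambda>x. D 0 (f x))"
  by (rule smooth_alg_smooth[OF smooth_alg.comp[OF smooth_alg.base]])

lemma smooth_Rd_sum:
  "finite I \<Longrightarrow> (\<And>i. i \<in> I \<Longrightarrow> smooth_Rd d (f i)) \<Longrightarrow> smooth_Rd d (\<lambda>x. \<Sum>i\<in>I. f i x)"
  by (induction I rule: finite_induct) (auto intro: smooth_Rd_add smooth_Rd_const)

lemma smooth_Rd_exp:
  assumes "smooth_Rd d f"
  shows "smooth_Rd d (\<lambda>x. exp (f x))"
  by (rule smooth_Rd_comp[OF assms, of UNIV "\<lambda>_. exp"]) (auto simp: derivative_tower_def DERIV_exp)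

lemma smooth_Rd_powr:
  assumes "smooth_Rd d f" and "\<And>x. x \<in> Rd d \<Longrightarrow> 0 < f x"
  shows "smooth_Rd d (\<lambda>x. f x powr a)"
proof -
  define D where "D = (\<lambda>k u. (\<Prod>j<k. a - real j) * u powr (a - real k))"
  have "(D k has_real_derivative D (Suc k) u) (at u)" if "0 < u" for k u
    using DERIV_cmult[OF has_real_derivative_powr[OF that, of "a - real k"], of "\<Prod>j<k. a - real j"]
    by (simp add: D_def mult.assoc diff_diff_eq add.commute)
  then have "derivative_tower {0<..} D" by (auto simp: derivative_tower_def)
  from smooth_Rd_comp[OF assms(1) this] show ?thesis
    using assms(2) by (simp add: D_def)
qed

section \<open>A smooth step function\<close>

text \<open>
  The polynomial factor makes the family of functions that are flat at \<open>0\<close> closed under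
  differentiation: all derivatives of \<open>exp (- 1 / x)\<close> have this form.
\<close>
definition flat :: "real poly \<Rightarrow> real \<Rightarrow> real" where
  "flat P x = (if 0 < x then poly P (inverse x) * exp (- inverse x) else 0)"

lemma poly_times_exp_neg_tendsto_0:
  "((\<lambda>y::real. poly P y * exp (- y)) \<longlongrightarrow> 0) at_top"
proof -
  have "((\<lambda>y::real. \<Sum>i\<le>degree P. coeff P i * (y ^ i / exp y)) \<longlongrightarrow> (\<Sum>i\<le>degree P. coeff P i * 0)) at_top"
    by (intro tendsto_intros tendsto_power_div_exp_0)
  then show ?thesis
    by (simp add: poly_altdef sum_distrib_right exp_minus divide_inverse mult.assoc)
qed

lemma flat_DERIV:
  "(flat P has_real_derivative flat ([:0, 0, 1:] * (P - pderiv P)) x) (at x)"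
proof -
  consider "x < 0" | "x = 0" | "x > 0" by linarith
  then show ?thesis
  proof cases
    case 1
    have "((\<lambda>_. 0) has_real_derivative 0) (at x)" by simp
    then have "(flat P has_real_derivative 0) (at x)"
      by (rule has_field_derivative_transform_within_open[of _ _ _ "{..<0}"]) (use 1 in \<open>auto simp: flat_def\<close>)
    then show ?thesis using 1 by (simp add: flat_def)
  next
    case 3
    have "((\<lambda>x. poly P (inverse x) * exp (- inverse x)) has_real_derivative
        flat ([:0, 0, 1:] * (P - pderiv P)) x) (at x)"
      using 3 unfolding flat_def
      by (auto intro!: derivative_eq_intros DERIV_chain2[OF poly_DERIV] simp: field_simps power2_eq_square)
    then show ?thesis
      by (rule has_field_derivative_transform_within_open[of _ _ _ "{0<..}"]) (use 3 in \<open>auto simp: flat_def\<close>)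
  next
    case 2
    have "((\<lambda>y. poly (pCons 0 P) y * exp (- y)) \<longlongrightarrow> 0) at_top"
      by (rule poly_times_exp_neg_tendsto_0)
    then have "((\<lambda>y. flat P (inverse y) / inverse y) \<longlongrightarrow> 0) at_top"
      by (rule Lim_transform_eventually)
        (use eventually_gt_at_top[of 0] in eventually_elim, auto simp: flat_def field_simps)
    then have "((\<lambda>h. flat P h / h) \<longlongrightarrow> 0) (at_right 0)"
      by (simp add: filterlim_at_right_to_top)
    moreover have "((\<lambda>h. flat P h / h) \<longlongrightarrow> 0) (at_left 0)"
      by (rule tendsto_eventually) (auto simp: flat_def eventually_at_left_field intro: exI[of _ "-1"])
    ultimately have "((\<lambda>h. flat P h / h) \<longlongrightarrow> 0) (at 0)"
      by (intro filterlim_split_at)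
    then show ?thesis
      using 2 by (simp add: has_field_derivative_iff flat_def)
  qed
qed

lemma flat_tower:
  "derivative_tower UNIV (\<lambda>k. flat (((\<lambda>P. [:0, 0, 1:] * (P - pderiv P)) ^^ k) P))"
  unfolding derivative_tower_def using flat_DERIV by simp

lemma smooth_Rd_flat: "smooth_Rd d f \<Longrightarrow> smooth_Rd d (\<lambda>x. flat P (f x))"
  using smooth_Rd_comp[OF _ flat_tower[of P]] by simp

text \<open>
  Truncations must vanish exactly on a large set, because the measure of the support enters the
  estimates, and must be smooth, because the functional inequalities are available for smooth
  functions only.
\<close>
definition smooth_step :: "real \<Rightarrow> real" where
  "smooth_step v = flat 1 v / (flat 1 v + flat 1 (1 - v))"

lemma flat_1_nonneg: "0 \<le> flat 1 x" and flat_1_pos: "0 < x \<Longrightarrow> 0 < flat 1 x"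
  by (simp_all add: flat_def)

lemma smooth_step_denom_pos: "0 < flat 1 v + flat 1 (1 - v)"
  using flat_1_nonneg[of v] flat_1_nonneg[of "1 - v"] flat_1_pos[of v] flat_1_pos[of "1 - v"]
  by (cases "0 < v") linarith+

lemma smooth_step_0: "v \<le> 0 \<Longrightarrow> smooth_step v = 0"
  and smooth_step_1: "1 \<le> v \<Longrightarrow> smooth_step v = 1"
  by (auto simp: smooth_step_def flat_def)

lemma smooth_step_bounds: "0 \<le> smooth_step v" "smooth_step v \<le> 1"
  using smooth_step_denom_pos[of v] flat_1_nonneg[of v] flat_1_nonneg[of "1 - v"]
  by (auto simp: smooth_step_def divide_simps)

lemma smooth_Rd_smooth_step:
  assumes "smooth_Rd d f" shows "smooth_Rd d (\<lambda>x. smooth_step (f x))"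
proof -
  have 1: "smooth_Rd d (\<lambda>x. 1 - f x)"
    using smooth_Rd_add[OF smooth_Rd_const[of d 1] smooth_Rd_mult[OF smooth_Rd_const[of d "-1"] assms]]
    by simp
  have "smooth_Rd d (\<lambda>x. flat 1 (f x) * (flat 1 (f x) + flat 1 (1 - f x)) powr (-1))"
    by (intro smooth_Rd_mult smooth_Rd_powr smooth_Rd_add smooth_Rd_flat assms 1 smooth_step_denom_pos)
  then show ?thesis
    using smooth_step_denom_pos by (simp add: smooth_step_def powr_minus_divide less_imp_le)
qed

lemma smooth_step_DERIV:
  obtains s' :: "real \<Rightarrow> real" and L where "\<And>v. (smooth_step has_real_derivative s' v) (at v)"
    "\<And>v. v \<le> 0 \<or> 1 \<le> v \<Longrightarrow> s' v = 0" "\<And>v. \<bar>s' v\<bar> \<le> L" "0 < L"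
proof -
  define Q where "Q = [:0, 0, 1:] * (1 - pderiv 1 :: real poly)"
  define s' where "s' v = (flat Q v * flat 1 (1 - v) + flat 1 v * flat Q (1 - v))
      / (flat 1 v + flat 1 (1 - v))\<^sup>2" for v
  have d1: "(flat 1 has_real_derivative flat Q v) (at v)" for v
    unfolding Q_def by (rule flat_DERIV)
  have d2: "((\<lambda>v. flat 1 (1 - v)) has_real_derivative - flat Q (1 - v)) (at v)" for v
  proof -
    have "((\<lambda>v. 1 - v :: real) has_real_derivative -1) (at v)"
      by (auto intro!: derivative_eq_intros)
    from DERIV_chain2[OF d1 this] show ?thesis by simp
  qed
  have der: "(smooth_step has_real_derivative s' v) (at v)" for v
    unfolding smooth_step_def s'_def using smooth_step_denom_pos[of v]
    by (auto intro!: derivative_eq_intros d1 d2 simp: power2_eq_square algebra_simps)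
  have out: "s' v = 0" if "v \<le> 0 \<or> 1 \<le> v" for v
    using that by (auto simp: s'_def flat_def)
  have cf: "continuous_on UNIV (flat P)" for P
    by (rule DERIV_continuous_on) (use flat_DERIV in \<open>auto intro: has_field_derivative_at_within\<close>)
  have "continuous_on {0..1} s'"
    unfolding s'_def using smooth_step_denom_pos
    by (auto intro!: continuous_intros continuous_on_compose2[OF cf] simp: less_imp_neq[symmetric])
  then have "bounded (s' ` {0..1})"
    by (intro compact_imp_bounded compact_continuous_image compact_Icc)
  then obtain B where B: "\<And>v. v \<in> {0..1} \<Longrightarrow> norm (s' v) \<le> B"
    unfolding bounded_iff by blast
  have "\<bar>s' v\<bar> \<le> max B 1" for v
    using B[of v] out[of v] by (cases "v \<in> {0..1}") auto
  then show ?thesis using that[OF der out, of "max B 1"] by auto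
qed

section \<open>Gradient norms and measurability\<close>

lemma enorm_nonneg: "0 \<le> enorm d x"
  by (simp add: enorm_def L2_set_nonneg)

lemma enorm_cmult: "enorm d (\<lambda>i. c * x i) = \<bar>c\<bar> * enorm d x"
  by (simp add: enorm_def L2_set_def power_mult_distrib real_sqrt_mult flip: sum_distrib_left)

lemma grad_norm_nonneg: "0 \<le> grad_norm d f x"
  by (simp add: grad_norm_def enorm_nonneg)

lemma partial_deriv_comp:
  assumes "smooth_Rd d f" "x \<in> Rd d" "i < d" "(\<phi> has_real_derivative c) (at (f x))"
  shows "partial_deriv i (\<lambda>x. \<phi> (f x)) x = c * partial_deriv i f x"
proof -
  have "((\<lambda>s. \<phi> (f (x(i := s)))) has_real_derivative c * partial_deriv i f x) (at (x i))"
    using assms(4) smooth_Rd_DERIV[OF assms(1-3)]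
    by (intro DERIV_chain2[where f = \<phi> and g = "\<lambda>s. f (x(i := s))"]) auto
  then show ?thesis unfolding partial_deriv_def[of i "\<lambda>x. \<phi> (f x)"] by (rule DERIV_imp_deriv)
qed

lemma grad_norm_comp:
  assumes "smooth_Rd d f" "x \<in> Rd d" "(\<phi> has_real_derivative c) (at (f x))"
  shows "grad_norm d (\<lambda>x. \<phi> (f x)) x = \<bar>c\<bar> * grad_norm d f x"
proof -
  have "grad_norm d (\<lambda>x. \<phi> (f x)) x = enorm d (\<lambda>i. c * partial_deriv i f x)"
    unfolding grad_norm_def enorm_def
    by (rule L2_set_cong) (auto intro!: partial_deriv_comp assms)
  then show ?thesis by (simp add: enorm_cmult grad_norm_def)
qed

lemma prob_measure_on_space: "prob_measure_on d \<mu> \<Longrightarrow> space \<mu> = Rd d"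
  unfolding prob_measure_on_def Rd_def by (auto dest!: sets_eq_imp_space_eq simp: space_PiM)

text \<open>
  Extending \<open>f\<close> by composition with the restriction to \<open>{..<d}\<close> gives a continuous function on the
  full product space, whose Borel \<open>\<sigma>\<close>-algebra is the countable product one.
\<close>
lemma borel_measurable_continuous_on_Rd:
  assumes "prob_measure_on d \<mu>" "continuous_on (Rd d) f"
  shows "f \<in> borel_measurable \<mu>"
proof -
  have "continuous_on UNIV (\<lambda>x. restrict x {..<d} i :: real)" for i
    by (cases "i < d") (auto intro!: continuous_on_product_then_coordinatewise[OF continuous_on_id])
  then have "continuous_on UNIV (\<lambda>x. restrict x {..<d} :: nat \<Rightarrow> real)"
    by (rule continuous_on_coordinatewise_then_product)
  then have "continuous_on UNIV (\<lambda>x. f (restrict x {..<d}))"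
    by (rule continuous_on_compose2[OF assms(2)]) (auto simp: Rd_def PiE_iff split: if_splits)
  then have 1: "(\<lambda>x. f (restrict x {..<d})) \<in> borel_measurable (\<Pi>\<^sub>M i\<in>UNIV. borel)"
    unfolding measurable_cong_sets[OF sets_PiM_equal_borel refl] by (rule borel_measurable_continuous_onI)
  have 2: "(\<lambda>x i. x i) \<in> measurable (\<Pi>\<^sub>M i\<in>{..<d}. borel :: real measure) (\<Pi>\<^sub>M i\<in>UNIV. borel)"
  proof (rule measurable_PiM_single')
    show "(\<lambda>x. x i) \<in> borel_measurable (\<Pi>\<^sub>M i\<in>{..<d}. borel :: real measure)" for i
    proof (cases "i < d")
      case False
      then have "(\<lambda>x. x i) \<in> borel_measurable (\<Pi>\<^sub>M i\<in>{..<d}. borel :: real measure)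
          \<longleftrightarrow> (\<lambda>x. undefined :: real) \<in> borel_measurable (\<Pi>\<^sub>M i\<in>{..<d}. borel :: real measure)"
        by (intro measurable_cong) (auto simp: space_PiM PiE_def extensional_def)
      then show ?thesis by simp
    qed measurable
  qed auto
  have "(\<lambda>x. f (restrict x {..<d})) \<in> borel_measurable (\<Pi>\<^sub>M i\<in>{..<d}. borel :: real measure)"
    using measurable_compose[OF 2 1] by simp
  then have "(\<lambda>x. f (restrict x {..<d})) \<in> borel_measurable \<mu>"
    using assms(1) unfolding prob_measure_on_def by (auto cong: measurable_cong_sets)
  then show ?thesis
    by (rule measurable_cong[THEN iffD1, rotated])
      (auto simp: prob_measure_on_space[OF assms(1)] Rd_def PiE_restrict)
qed

lemma borel_measurable_smooth_Rd:
  "prob_measure_on d \<mu> \<Longrightarrow> smooth_Rd d f \<Longrightarrow> f \<in> borel_measurable \<mu>"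
  by (intro borel_measurable_continuous_on_Rd smooth_Rd_continuous)

lemma borel_measurable_grad_norm:
  assumes "prob_measure_on d \<mu>" "smooth_Rd d f"
  shows "grad_norm d f \<in> borel_measurable \<mu>"
proof -
  have "partial_deriv i f \<in> borel_measurable \<mu>" if "i < d" for i
    using that assms by (intro borel_measurable_smooth_Rd smooth_Rd_partial_deriv)
  then have [measurable]: "(\<lambda>x. \<Sum>i<d. (partial_deriv i f x)\<^sup>2) \<in> borel_measurable \<mu>"
    by (intro borel_measurable_sum borel_measurable_power) auto
  show ?thesis
    unfolding grad_norm_def enorm_def L2_set_def by measurable
qed

lemma enorm_sq: "(enorm d x)\<^sup>2 = (\<Sum>j<d. (x j)\<^sup>2)"
  by (simp add: enorm_def L2_set_def sum_nonneg)

lemma grad_norm_const: "grad_norm d (\<lambda>_. c) x = 0"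
  by (simp add: grad_norm_def partial_deriv_def enorm_def L2_set_def)

lemma grad_norm_add_le:
  assumes "smooth_Rd d f" "smooth_Rd d g" "x \<in> Rd d"
  shows "grad_norm d (\<lambda>x. f x + g x) x \<le> grad_norm d f x + grad_norm d g x"
proof -
  have "partial_deriv i (\<lambda>x. f x + g x) x = partial_deriv i f x + partial_deriv i g x" if "i < d" for i
    using DERIV_add[OF smooth_Rd_DERIV[OF assms(1,3) that] smooth_Rd_DERIV[OF assms(2,3) that]]
    unfolding partial_deriv_def[of i "\<lambda>x. f x + g x"] by (rule DERIV_imp_deriv)
  then have "grad_norm d (\<lambda>x. f x + g x) x = L2_set (\<lambda>i. partial_deriv i f x + partial_deriv i g x) {..<d}"
    unfolding grad_norm_def enorm_def by (intro L2_set_cong) auto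
  also have "\<dots> \<le> grad_norm d f x + grad_norm d g x"
    unfolding grad_norm_def enorm_def by (rule L2_set_triangle_ineq)
  finally show ?thesis .
qed

lemma grad_norm_sum_le:
  assumes "finite D" "\<And>a. a \<in> D \<Longrightarrow> smooth_Rd d (f a)" "x \<in> Rd d"
  shows "grad_norm d (\<lambda>x. \<Sum>a\<in>D. f a x) x \<le> (\<Sum>a\<in>D. grad_norm d (f a) x)"
  using assms(1,2)
proof (induction D rule: finite_induct)
  case empty
  then show ?case by (simp add: grad_norm_const)
next
  case (insert a D)
  have "grad_norm d (\<lambda>x. f a x + (\<Sum>a\<in>D. f a x)) x \<le> grad_norm d (f a) x + grad_norm d (\<lambda>x. \<Sum>a\<in>D. f a x) x"
    using insert.prems insert.hyps by (intro grad_norm_add_le smooth_Rd_sum assms(3)) auto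
  then show ?case using insert by simp
qed

lemma smooth_Rd_sq_dist: "smooth_Rd d (\<lambda>y. (enorm d (\<lambda>j. y j - b j))\<^sup>2)"
proof -
  have "smooth_Rd d (\<lambda>y. \<Sum>j<d. (y j + - b j) * (y j + - b j))"
    by (intro smooth_Rd_sum smooth_Rd_mult smooth_Rd_add smooth_Rd_coord smooth_Rd_const) auto
  then show ?thesis unfolding enorm_sq by (simp add: power2_eq_square)
qed

lemma grad_norm_sq_dist:
  assumes "x \<in> Rd d"
  shows "grad_norm d (\<lambda>y. (enorm d (\<lambda>j. y j - b j))\<^sup>2) x = 2 * enorm d (\<lambda>j. x j - b j)"
proof -
  have "partial_deriv i (\<lambda>y. (enorm d (\<lambda>j. y j - b j))\<^sup>2) x = 2 * (x i - b i)" if i: "i < d" for i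
  proof -
    have "((\<lambda>t. \<Sum>j<d. ((x(i := t)) j - b j)\<^sup>2) has_real_derivative (\<Sum>j<d. if j
        = i then 2 * (x i - b i) else 0)) (at (x i))"
      by (intro DERIV_sum) (auto intro!: derivative_eq_intros)
    then show ?thesis unfolding partial_deriv_def enorm_sq using i by (auto dest: DERIV_imp_deriv)
  qed
  then have "grad_norm d (\<lambda>y. (enorm d (\<lambda>j. y j - b j))\<^sup>2) x = enorm d (\<lambda>i. 2 * (x i - b i))"
    unfolding grad_norm_def enorm_def by (intro L2_set_cong) auto
  then show ?thesis using enorm_cmult[of d 2 "\<lambda>j. x j - b j"] by simp
qed

section \<open>Hoelder's inequality\<close>

text \<open>
  Pointwise weighted arithmetic--geometric mean inequality for \<open>U / \<integral> U\<close> and \<open>V / \<integral> V\<close>,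
  integrated.
\<close>
lemma Hoelder_integral:
  fixes U V :: "'a \<Rightarrow> real"
  assumes U: "integrable M U" "\<And>x. x \<in> space M \<Longrightarrow> 0 \<le> U x" and V: "integrable M V" "\<And>x. x \<in> space M \<Longrightarrow> 0 \<le> V x"
    and a: "0 < a" "a < 1"
  shows "integrable M (\<lambda>x. U x powr a * V x powr (1 - a))"
    and "(\<integral>x. U x powr a * V x powr (1 - a) \<partial>M) \<le> (\<integral>x. U x \<partial>M) powr a * (\<integral>x. V x \<partial>M) powr (1 - a)"
proof -
  have young: "u powr a * v powr (1 - a) \<le> a * u + (1 - a) * v" if "0 \<le> u" "0 \<le> v" for u v :: real
    using Youngs_inequality_0[of a "1 - a" u v] a that by (cases "u = 0 \<or> v = 0") auto
  have [measurable]: "U \<in> borel_measurable M" "V \<in> borel_measurable M" using U V by auto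
  have bd: "integrable M (\<lambda>x. a * U x + (1 - a) * V x)" using U V by simp
  show int: "integrable M (\<lambda>x. U x powr a * V x powr (1 - a))"
    by (rule Bochner_Integration.integrable_bound[OF bd])
        (auto intro!: AE_I2 simp: abs_mult intro: order_trans[OF young] U V)
  let ?u = "\<integral>x. U x \<partial>M" and ?v = "\<integral>x. V x \<partial>M"
  have nn: "0 \<le> ?u" "0 \<le> ?v" using U V by (auto intro!: integral_nonneg_AE AE_I2)
  show "(\<integral>x. U x powr a * V x powr (1 - a) \<partial>M) \<le> ?u powr a * ?v powr (1 - a)"
  proof (cases "?u = 0 \<or> ?v = 0")
    case True
    then have "(AE x in M. U x = 0) \<or> (AE x in M. V x = 0)"
      using integral_nonneg_eq_0_iff_AE[OF U(1)] integral_nonneg_eq_0_iff_AE[OF V(1)] U V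
          by (auto intro!: AE_I2)
    then have "AE x in M. U x powr a * V x powr (1 - a) = 0"
      by auto
    then have "(\<integral>x. U x powr a * V x powr (1 - a) \<partial>M) = 0"
      by (rule integral_eq_zero_AE)
    then show ?thesis by simp
  next
    case False
    then have pos: "0 < ?u" "0 < ?v" using nn by auto
    have "(\<integral>x. U x powr a * V x powr (1 - a) \<partial>M)
        \<le> (\<integral>x. ?u powr a * ?v powr (1 - a) * (a * (U x / ?u) + (1 - a) * (V x / ?v)) \<partial>M)"
    proof (rule integral_mono)
      fix x assume x: "x \<in> space M"
      have "U x powr a * V x powr (1 - a)
          = ?u powr a * ?v powr (1 - a) * ((U x / ?u) powr a * (V x / ?v) powr (1 - a))"
        using pos U(2)[OF x] V(2)[OF x] by (simp add: powr_divide)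
      also have "\<dots> \<le> ?u powr a * ?v powr (1 - a) * (a * (U x / ?u) + (1 - a) * (V x / ?v))"
        using pos U(2)[OF x] V(2)[OF x] by (intro mult_left_mono young) auto
      finally show "U x powr a * V x powr (1 - a) \<le> \<dots>" .
    qed (use int U V in auto)
    also have "\<dots> = ?u powr a * ?v powr (1 - a)"
      using pos U V by simp
    finally show ?thesis .
  qed
qed

section \<open>From the Latala--Oleszkiewicz inequality to the modified log-Sobolev inequality\<close>

lemma Latala_OleszkiewiczD:
  assumes LO: "Latala_Oleszkiewicz d r C \<mu>" and f: "smooth_Rd d f"
    "integrable \<mu> (\<lambda>x. (f x)\<^sup>2)" "integrable \<mu> (\<lambda>x. (grad_norm d f x)\<^sup>2)"
    and \<theta>: "1 < \<theta>" "\<theta> < 2"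
  shows "(\<integral>x. (f x)\<^sup>2 \<partial>\<mu>) - (\<integral>x. \<bar>f x\<bar> powr \<theta> \<partial>\<mu>) powr (2 / \<theta>)
    \<le> (2 - \<theta>) powr (2 * (1 - 1 / r)) * (C * (\<integral>x. (grad_norm d f x)\<^sup>2 \<partial>\<mu>))"
proof -
  let ?F = "\<lambda>\<theta>. ereal (((\<integral>x. (f x)\<^sup>2 \<partial>\<mu>) - (\<integral>x. \<bar>f x\<bar> powr \<theta> \<partial>\<mu>) powr (2 / \<theta>))
                    / (2 - \<theta>) powr (2 * (1 - 1 / r)))"
  have "?F \<theta> \<le> (SUP \<theta>\<in>{1<..<2}. ?F \<theta>)"
    using \<theta> by (intro SUP_upper) auto
  also have "\<dots> \<le> ereal (C * (\<integral>x. (grad_norm d f x)\<^sup>2 \<partial>\<mu>))"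
    using LO f unfolding Latala_Oleszkiewicz_def by blast
  finally show ?thesis
    using \<theta> by (simp add: divide_le_eq mult.commute)
qed

lemma Latala_Oleszkiewicz_mono:
  assumes "Latala_Oleszkiewicz d r C \<mu>" "C \<le> C'"
  shows "Latala_Oleszkiewicz d r C' \<mu>"
  unfolding Latala_Oleszkiewicz_def
proof (intro allI impI)
  fix f assume f: "smooth_Rd d f" "integrable \<mu> (\<lambda>x. (f x)\<^sup>2)" "integrable \<mu> (\<lambda>x. (grad_norm d f x)\<^sup>2)"
  let ?S = "SUP \<theta>\<in>{1<..<2}. ereal (((\<integral>x. (f x)\<^sup>2 \<partial>\<mu>) - (\<integral>x. \<bar>f x\<bar> powr \<theta> \<partial>\<mu>) powr (2 / \<theta>))
                    / (2 - \<theta>) powr (2 * (1 - 1 / r)))"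
  have "?S \<le> ereal (C * (\<integral>x. (grad_norm d f x)\<^sup>2 \<partial>\<mu>))"
    using assms(1) f unfolding Latala_Oleszkiewicz_def by blast
  also have "\<dots> \<le> ereal (C' * (\<integral>x. (grad_norm d f x)\<^sup>2 \<partial>\<mu>))"
    using assms(2) by (simp add: mult_right_mono)
  finally show "?S \<le> ereal (C' * (\<integral>x. (grad_norm d f x)\<^sup>2 \<partial>\<mu>))" .
qed

text \<open>
  If \<open>g\<close> lives on a set \<open>A\<close> of measure at most \<open>exp (- k)\<close>, then by Hoelder's inequality the
  square of the \<open>\<theta>\<close>-norm of \<open>g\<close> is at most \<open>\<integral> g\<^sup>2\<close> times \<open>\<mu> A\<close> to the power \<open>(2 - \<theta>) / \<theta>\<close>. For \<open>2
  - \<theta> = 1 / (k + 1)\<close> this power is bounded away from \<open>1\<close>, and the left-hand side of the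
  Latala--Oleszkiewicz inequality is a fixed fraction of \<open>\<integral> g\<^sup>2\<close>.
\<close>
lemma small_support_Poincare:
  assumes LO: "Latala_Oleszkiewicz d r C \<mu>" and r: "1 < r" and C: "0 \<le> C" and \<mu>: "prob_measure_on d \<mu>"
    and g: "smooth_Rd d g" "integrable \<mu> (\<lambda>x. (g x)\<^sup>2)" "integrable \<mu> (\<lambda>x. (grad_norm d g x)\<^sup>2)"
    and A: "A \<in> sets \<mu>" "\<And>x. x \<in> space \<mu> \<Longrightarrow> x \<notin> A \<Longrightarrow> g x = 0" "measure \<mu> A \<le> exp (- real k)" and k: "1 \<le> k"
  shows "(\<integral>x. (g x)\<^sup>2 \<partial>\<mu>) \<le> 5 * C * real k powr (- (2 * (1 - 1 / r))) * (\<integral>x. (grad_norm d g x)\<^sup>2 \<partial>\<mu>)"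
proof -
  interpret prob_space \<mu> using \<mu> by (simp add: prob_measure_on_def)
  define \<theta> where "\<theta> = 2 - 1 / (real k + 1)"
  define e where "e = 2 * (1 - 1 / r)"
  have e: "0 < e" using r by (simp add: e_def field_simps)
  have \<theta>: "1 < \<theta>" "\<theta> < 2" using k by (simp_all add: \<theta>_def)
  let ?u = "\<integral>x. (g x)\<^sup>2 \<partial>\<mu>" and ?D = "\<integral>x. (grad_norm d g x)\<^sup>2 \<partial>\<mu>"
  have u: "0 \<le> ?u" and D: "0 \<le> ?D" by simp_all
  have eq: "\<bar>g x\<bar> powr \<theta> = ((g x)\<^sup>2) powr (\<theta> / 2) * (indicator A x :: real) powr (1 - \<theta> / 2)"
    if "x \<in> space \<mu>" for x
  proof (cases "x \<in> A \<and> g x \<noteq> 0")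
    case True
    have "(g x)\<^sup>2 = \<bar>g x\<bar> powr 2" using True by (simp add: powr_numeral)
    then have "((g x)\<^sup>2) powr (\<theta> / 2) = \<bar>g x\<bar> powr \<theta>" by (simp only: powr_powr) simp
    then show ?thesis using True by simp
  next
    case False
    then show ?thesis using A(2)[OF that] by auto
  qed
  have "(\<integral>x. \<bar>g x\<bar> powr \<theta> \<partial>\<mu>) = (\<integral>x. ((g x)\<^sup>2) powr (\<theta> / 2) * (indicator A x :: real) powr (1 - \<theta> / 2) \<partial>\<mu>)"
    by (intro Bochner_Integration.integral_cong refl eq)
  also have "\<dots> \<le> ?u powr (\<theta> / 2) * (\<integral>x. indicator A x \<partial>\<mu>) powr (1 - \<theta> / 2)"
    using g A(1) \<theta> by (intro Hoelder_integral(2)) (auto simp: emeasure_eq_measure)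
  also have "(\<integral>x. indicator A x \<partial>\<mu>) = measure \<mu> A" using A(1) by simp
  finally have "(\<integral>x. \<bar>g x\<bar> powr \<theta> \<partial>\<mu>) powr (2 / \<theta>)
      \<le> (?u powr (\<theta> / 2) * measure \<mu> A powr (1 - \<theta> / 2)) powr (2 / \<theta>)"
    using \<theta> by (intro powr_mono2) (auto intro!: integral_nonneg_AE)
  also have "\<dots> = ?u * measure \<mu> A powr ((1 - \<theta> / 2) * (2 / \<theta>))"
    using \<theta> u by (simp add: powr_mult powr_powr)
  also have "\<dots> \<le> ?u * (4 / 5)"
  proof (intro mult_left_mono u)
    have "measure \<mu> A powr ((1 - \<theta> / 2) * (2 / \<theta>)) \<le> exp (- real k) powr ((1 - \<theta> / 2) * (2 / \<theta>))"
      using A(3) \<theta> by (intro powr_mono2) auto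
    also have "\<dots> = exp (- (real k * ((1 - \<theta> / 2) * (2 / \<theta>))))" by (simp add: powr_def)
    also have "\<dots> \<le> exp (- (1 / 4))"
    proof -
      have "1 / 4 * (2 * real k + 1) \<le> real k" using k by simp
      then have "1 / 4 \<le> real k / (2 * real k + 1)" by (simp add: field_simps)
      also have "\<dots> = real k * ((1 - \<theta> / 2) * (2 / \<theta>))"
      proof -
        have "\<theta> = (2 * real k + 1) / (real k + 1)" by (simp add: \<theta>_def field_simps)
        then show ?thesis using \<theta> by (simp add: divide_simps) (simp add: algebra_simps)
      qed
      finally show ?thesis by simp
    qed
    also have "\<dots> \<le> 4 / 5" using exp_ge_add_one_self[of "1 / 4 :: real"] by (simp add: exp_minus field_simps)
    finally show "measure \<mu> A powr ((1 - \<theta> / 2) * (2 / \<theta>)) \<le> 4 / 5" .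
  qed
  finally have "?u / 5 \<le> (2 - \<theta>) powr e * (C * ?D)"
    using Latala_OleszkiewiczD[OF LO g \<theta>] by (simp add: e_def)
  also have "\<dots> \<le> real k powr (- e) * (C * ?D)"
  proof (intro mult_right_mono)
    have "(2 - \<theta>) powr e \<le> (1 / real k) powr e" using k e by (intro powr_mono2) (auto simp: \<theta>_def field_simps)
    also have "\<dots> = real k powr (- e)" using k by (simp add: powr_divide powr_minus_divide)
    finally show "(2 - \<theta>) powr e \<le> real k powr (- e)" .
  qed (use C D in simp)
  finally show ?thesis by (simp add: e_def algebra_simps)
qed

text \<open>
  Either \<open>x\<^sup>2 \<le> \<delta> k powr (2 / q)\<close>, and the left-hand side is at most \<open>\<delta> k\<close>, or \<open>k\<close> is bounded by a
  multiple of \<open>x powr q\<close>, and the left-hand side is at most the other term.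
\<close>
lemma Young_split:
  fixes x \<delta> k q :: real
  assumes "0 \<le> x" "0 < \<delta>" "0 < k" "2 < q"
  shows "x\<^sup>2 * k powr (1 - 2 / q) \<le> \<delta> * k + \<delta> powr (1 - q / 2) * x powr q"
proof (cases "x\<^sup>2 \<le> \<delta> * k powr (2 / q)")
  case True
  have "x\<^sup>2 * k powr (1 - 2 / q) \<le> \<delta> * k powr (2 / q) * k powr (1 - 2 / q)"
    using True by (intro mult_right_mono) auto
  also have "\<dots> = \<delta> * k" using assms by (simp add: mult.assoc flip: powr_add)
  finally show ?thesis by (smt (verit) powr_ge_zero mult_nonneg_nonneg)
next
  case False
  then have "\<delta> * k powr (2 / q) \<le> x\<^sup>2" by simp
  moreover have x: "0 < x" using False assms by (cases "x = 0") auto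
  ultimately have "k powr (2 / q) \<le> x powr 2 / \<delta>" using assms by (simp add: powr_numeral field_simps)
  then have "(k powr (2 / q)) powr (q / 2 - 1) \<le> (x powr 2 / \<delta>) powr (q / 2 - 1)"
    using assms by (intro powr_mono2) auto
  also have "(k powr (2 / q)) powr (q / 2 - 1) = k powr (1 - 2 / q)"
  proof -
    have "2 / q * (q / 2 - 1) = 1 - 2 / q" using assms by (simp add: field_simps)
    then show ?thesis by (simp only: powr_powr)
  qed
  also have "(x powr 2 / \<delta>) powr (q / 2 - 1) = x powr (q - 2) * \<delta> powr (1 - q / 2)"
  proof -
    have "1 - q / 2 = - (q / 2 - 1)" "2 * (q / 2 - 1) = q - 2" by simp_all
    then show ?thesis using assms x by (simp only: powr_divide powr_powr powr_minus_divide) simp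
  qed
  finally have "x powr 2 * k powr (1 - 2 / q) \<le> x powr 2 * (x powr (q - 2) * \<delta> powr (1 - q / 2))"
    by (intro mult_left_mono) auto
  also have "\<dots> = \<delta> powr (1 - q / 2) * x powr q"
    by (simp add: powr_diff x)
  finally show ?thesis using assms x by (simp add: powr_numeral add_increasing)
qed

text \<open>
  Summing the recursion, the sum on the right is a quarter of the sum on the left, shifted by one
  index. Since \<open>k + 1 \<le> 2 k\<close>, the shift costs a factor \<open>2\<close>, and half of the left-hand side is left
  over. Working with partial sums avoids assuming convergence: this is how finiteness of the
  entropy is obtained.
\<close>
lemma absorbed_sum_bound:
  fixes a w :: "nat \<Rightarrow> real"
  assumes a: "\<And>k. 0 \<le> a k" and step: "\<And>k. real (Suc k) * a (Suc (Suc k))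
      \<le> real (Suc k) * a (Suc k) / 4 + w (Suc k)"
    and w: "(\<Sum>k<N. w (Suc k)) \<le> W"
  shows "(\<Sum>k<N. real (Suc k) * a (Suc (Suc k))) \<le> a 1 / 2 + 2 * W"
proof -
  have shift: "(\<Sum>k<Suc n. real (Suc k) * a (Suc k)) \<le> a 1 + 2 * (\<Sum>k<n. real (Suc k) * a (Suc (Suc k)))" for n
  proof (induction n)
    case (Suc n)
    have "real (Suc (Suc n)) * a (Suc (Suc n)) \<le> (2 * real (Suc n)) * a (Suc (Suc n))"
      using a by (intro mult_right_mono) auto
    then show ?case using Suc
      unfolding sum.lessThan_Suc[of _ "Suc n"] sum.lessThan_Suc[of "\<lambda>k. real (Suc k) * a (Suc (Suc k))" n]
      by (simp only: distrib_left mult.assoc)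
  qed simp
  have le: "(\<Sum>k<N. real (Suc k) * a (Suc k)) \<le> (\<Sum>k<Suc N. real (Suc k) * a (Suc k))"
    using a by simp
  have "(\<Sum>k<N. real (Suc k) * a (Suc (Suc k))) \<le> (\<Sum>k<N. real (Suc k) * a (Suc k) / 4 + w (Suc k))"
    by (intro sum_mono step)
  also have "\<dots> = (\<Sum>k<N. real (Suc k) * a (Suc k)) / 4 + (\<Sum>k<N. w (Suc k))"
    by (simp only: sum.distrib sum_divide_distrib)
  finally show ?thesis using shift[of N] le w by linarith
qed

definition level_set :: "'a measure \<Rightarrow> ('a \<Rightarrow> real) \<Rightarrow> nat \<Rightarrow> 'a set" where
  "level_set M f k = {x \<in> space M. 2 ^ k \<le> f x \<and> f x < 2 ^ Suc k}"

lemma sets_level_set: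
  assumes [measurable]: "f \<in> borel_measurable M"
  shows "level_set M f k \<in> sets M"
  unfolding level_set_def by measurable

lemma sum_indicator_level_set:
  assumes "x \<in> space M"
  shows "(\<Sum>k<N. indicator (level_set M f (Suc k)) x) = (if 2 \<le> f x \<and> f x < 2 ^ Suc N then 1 else 0 :: real)"
proof (induction N)
  case (Suc N)
  have "(2::real) \<le> 2 ^ Suc N" by simp
  then show ?case
    using assms unfolding sum.lessThan_Suc Suc.IH
    by (auto simp: level_set_def indicator_def simp del: power_Suc)
      (auto intro: less_le_trans[of _ "2 ^ Suc N :: real"])
qed auto

lemma measure_superlevel_le:
  fixes f :: "'a \<Rightarrow> real"
  assumes \<mu>: "prob_space \<mu>" and f: "f \<in> borel_measurable \<mu>" "\<And>x. x \<in> space \<mu> \<Longrightarrow> 0 < f x"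
    and int: "integrable \<mu> (\<lambda>x. (f x)\<^sup>2)" "(\<integral>x. (f x)\<^sup>2 \<partial>\<mu>) = 1"
  shows "4 ^ k * measure \<mu> {x \<in> space \<mu>. 2 ^ k \<le> f x} \<le> (1 :: real)"
proof -
  interpret prob_space \<mu> by fact
  have "{x \<in> space \<mu>. 2 ^ k \<le> f x} = {x \<in> space \<mu>. 4 ^ k \<le> (f x)\<^sup>2}"
  proof -
    have "2 ^ k \<le> f x \<longleftrightarrow> (4::real) ^ k \<le> (f x)\<^sup>2" if "x \<in> space \<mu>" for x
    proof -
      have "(4::real) ^ k = (2 ^ k)\<^sup>2" by (simp add: power_mult[symmetric] mult.commute[of k] power_mult)
      then show ?thesis using f(2)[OF that]
          by (metis abs_le_square_iff abs_of_nonneg less_imp_le zero_le_numeral zero_le_power)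
    qed
    then show ?thesis by blast
  qed
  also have "measure \<mu> \<dots> \<le> (\<integral>x. (f x)\<^sup>2 \<partial>\<mu>) / 4 ^ k"
    using int by (intro integral_Markov_inequality_measure[of _ _ "{}"]) auto
  finally show ?thesis using int by (simp add: field_simps)
qed

text \<open>
  The estimate for small supports, applied to the truncation \<open>smooth_step (f / 2 ^ k - 1)\<close>. It
  vanishes where \<open>f \<le> 2 ^ k\<close>, equals \<open>1\<close> where \<open>f \<ge> 2 ^ (k + 1)\<close>, and its gradient is that of \<open>f\<close>,
  restricted to the dyadic piece and multiplied by at most \<open>L / 2 ^ k\<close>.
\<close>
lemma superlevel_recursion:
  assumes LO: "Latala_Oleszkiewicz d r C \<mu>" and r: "1 < r" and C: "0 \<le> C" and \<mu>: "prob_measure_on d \<mu>"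
    and f: "smooth_Rd d f" "\<And>x. x \<in> Rd d \<Longrightarrow> 0 < f x"
    and int: "integrable \<mu> (\<lambda>x. (f x)\<^sup>2)" "(\<integral>x. (f x)\<^sup>2 \<partial>\<mu>) = 1" "integrable \<mu> (\<lambda>x. (grad_norm d f x)\<^sup>2)"
    and s': "\<And>v. (smooth_step has_real_derivative s' v) (at v)"
      "\<And>v. v \<le> 0 \<or> 1 \<le> v \<Longrightarrow> s' v = 0" "\<And>v. \<bar>s' v\<bar> \<le> L" "0 < L"
    and k: "1 \<le> k"
  shows "4 ^ k * measure \<mu> {x \<in> space \<mu>. 2 ^ Suc k \<le> f x}
    \<le> 5 * C * L\<^sup>2 * real k powr (- (2 * (1 - 1 / r))) * (\<integral>x. indicator (level_set \<mu> f k) x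
        * (grad_norm d f x)\<^sup>2 \<partial>\<mu>)"
proof -
  interpret prob_space \<mu> using \<mu> by (simp add: prob_measure_on_def)
  have sp: "space \<mu> = Rd d" by (rule prob_measure_on_space[OF \<mu>])
  have fm[measurable]: "f \<in> borel_measurable \<mu>" by (rule borel_measurable_smooth_Rd[OF \<mu> f(1)])
  have gm[measurable]: "grad_norm d f \<in> borel_measurable \<mu>" by (rule borel_measurable_grad_norm[OF \<mu> f(1)])
  have lev[measurable]: "level_set \<mu> f k \<in> sets \<mu>" by (rule sets_level_set[OF fm])
  define g where "g x = smooth_step (f x * (1 / 2 ^ k) + - 1)" for x
  have g: "smooth_Rd d g"
    unfolding g_def by (intro smooth_Rd_smooth_step smooth_Rd_add smooth_Rd_mult smooth_Rd_const f)
  have gm'[measurable]: "g \<in> borel_measurable \<mu>" "grad_norm d g \<in> borel_measurable \<mu>"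
    by (auto intro: borel_measurable_smooth_Rd[OF \<mu> g] borel_measurable_grad_norm[OF \<mu> g])
  have g01: "0 \<le> g x" "g x \<le> 1" for x by (simp_all add: g_def smooth_step_bounds)
  have gint: "integrable \<mu> (\<lambda>x. (g x)\<^sup>2)"
    by (rule integrable_const_bound[of _ 1]) (use g01 in \<open>auto simp: power_le_one\<close>)
  have grad: "(grad_norm d g x)\<^sup>2 \<le> L\<^sup>2 / 4 ^ k * (indicator (level_set \<mu> f k) x * (grad_norm d f x)\<^sup>2)"
    if x: "x \<in> space \<mu>" for x
  proof -
    have lin: "((\<lambda>y. y * (1 / 2 ^ k) + - 1) has_real_derivative 1 / 2 ^ k) (at y)" for y :: real
      by (auto intro!: derivative_eq_intros)
    have "((\<lambda>y. smooth_step (y * (1 / 2 ^ k) + - 1)) has_real_derivative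
      s' (f x * (1 / 2 ^ k) + - 1) * (1 / 2 ^ k)) (at (f x))"
      by (rule DERIV_chain2[OF s'(1) lin])
    then have eq: "grad_norm d g x = \<bar>s' (f x * (1 / 2 ^ k) + - 1) * (1 / 2 ^ k)\<bar> * grad_norm d f x"
      unfolding g_def using f(1) x sp by (intro grad_norm_comp) auto
    show ?thesis
    proof (cases "x \<in> level_set \<mu> f k")
      case True
      have "(s' (f x * (1 / 2 ^ k) + - 1))\<^sup>2 \<le> L\<^sup>2"
        using s'(3,4) by (metis abs_le_square_iff abs_of_pos)
      moreover have "((2::real) ^ k)\<^sup>2 = 4 ^ k"
          by (simp add: power_mult[symmetric] mult.commute[of k] power_mult)
      ultimately show ?thesis
        using True by (simp add: eq power_mult_distrib power_divide divide_simps mult_right_mono)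
    next
      case False
      then have "f x * (1 / 2 ^ k) + - 1 \<le> 0 \<or> 1 \<le> f x * (1 / 2 ^ k) + - 1"
        using x by (auto simp: level_set_def field_simps)
      then show ?thesis using s'(2) False by (auto simp: eq)
    qed
  qed
  have li: "integrable \<mu> (\<lambda>x. indicator (level_set \<mu> f k) x * (grad_norm d f x)\<^sup>2)"
    using integrable_mult_indicator[OF lev int(3)] by simp
  have bi: "integrable \<mu> (\<lambda>x. L\<^sup>2 / 4 ^ k * (indicator (level_set \<mu> f k) x * (grad_norm d f x)\<^sup>2))"
    using li by simp
  have ggint: "integrable \<mu> (\<lambda>x. (grad_norm d g x)\<^sup>2)"
    by (rule Bochner_Integration.integrable_bound[OF bi]) (use grad in \<open>auto intro!: AE_I2
        order_trans[OF grad]\<close>)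
  define A where "A = {x \<in> space \<mu>. 2 ^ k \<le> f x}"
  have A: "A \<in> sets \<mu>" unfolding A_def by measurable
  have mA: "measure \<mu> A \<le> exp (- real k)"
  proof -
    have e: "exp (real k) \<le> 4 ^ k"
      using power_mono[of "exp 1 :: real" 4 k] exp_le by (simp add: exp_of_nat_mult[symmetric])
    have "measure \<mu> A \<le> 1 / 4 ^ k"
      using measure_superlevel_le[OF prob_space_axioms fm _ int(1,2), of k] f sp
          by (simp add: A_def field_simps)
    also have "\<dots> \<le> 1 / exp (real k)" using e by (intro divide_left_mono) auto
    finally show ?thesis by (simp add: exp_minus inverse_eq_divide)
  qed
  have g0: "g x = 0" if "x \<in> space \<mu>" "x \<notin> A" for x
    using that unfolding g_def A_def by (intro smooth_step_0) (auto simp: field_simps)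
  have "measure \<mu> {x \<in> space \<mu>. 2 ^ Suc k \<le> f x} = (\<integral>x. indicator {x \<in> space \<mu>. 2 ^ Suc k \<le> f x} x \<partial>\<mu>)"
    by simp
  also have "\<dots> \<le> (\<integral>x. (g x)\<^sup>2 \<partial>\<mu>)"
  proof (rule integral_mono[OF _ gint])
    fix x assume "x \<in> space \<mu>"
    have "g x = 1" if "2 ^ Suc k \<le> f x"
      unfolding g_def using that by (intro smooth_step_1) (auto simp: field_simps)
    then show "indicator {x \<in> space \<mu>. 2 ^ Suc k \<le> f x} x \<le> (g x)\<^sup>2"
      by (auto simp: indicator_def)
  qed (auto simp: emeasure_eq_measure)
  also have "\<dots> \<le> 5 * C * real k powr (- (2 * (1 - 1 / r))) * (\<integral>x. (grad_norm d g x)\<^sup>2 \<partial>\<mu>)"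
    by (rule small_support_Poincare[OF LO r C \<mu> g gint ggint A g0 mA k])
  also have "\<dots> \<le> 5 * C * real k powr (- (2 * (1 - 1 / r))) *
      (\<integral>x. L\<^sup>2 / 4 ^ k * (indicator (level_set \<mu> f k) x * (grad_norm d f x)\<^sup>2) \<partial>\<mu>)"
    using C by (intro mult_left_mono integral_mono[OF ggint bi grad]) auto
  finally show ?thesis by (simp add: field_simps)
qed

text \<open>
  A nonnegative version of \<open>y ln y\<close>: it has the same integral as \<open>y ln y\<close> when \<open>\<integral> y = 1\<close>. Its
  positivity allows one to bound the entropy, and at the same time to prove its finiteness, by
  monotone convergence.
\<close>
definition ent_integrand :: "real \<Rightarrow> real" where
  "ent_integrand y = y * ln y - y + 1"

lemma ent_integrand_nonneg: "0 < y \<Longrightarrow> 0 \<le> ent_integrand y"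
  using ln_le_minus_one[of "1 / y"] by (simp add: ent_integrand_def ln_div field_simps)

lemma ent_integrand_le_square: "0 < y \<Longrightarrow> ent_integrand y \<le> (y - 1)\<^sup>2"
  using mult_left_mono[OF ln_le_minus_one[of y], of y]
  by (simp add: ent_integrand_def power2_eq_square algebra_simps)

text \<open>
  Small values of \<open>f\<close> are charged to \<open>(f - 1)\<^sup>2\<close>; a value in \<open>[2 ^ (j + 2), 2 ^ (j + 3))\<close> is
  charged to the \<open>j\<close>-th term of the series alone.
\<close>
lemma ent_integrand_bound:
  assumes f: "0 < (f::real)"
  shows "ennreal (ent_integrand (f\<^sup>2)) \<le> ennreal (25 * (f - 1)\<^sup>2) +
    (\<Sum>j. ennreal (24 * (real (Suc j) * 4 ^ Suc (Suc j))) * indicator {y. 2 ^ Suc (Suc j) \<le> y} f)"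
proof (cases "f \<le> 4")
  case True
  have "ent_integrand (f\<^sup>2) \<le> (f\<^sup>2 - 1)\<^sup>2" using f by (intro ent_integrand_le_square) simp
  also have "\<dots> = (f + 1)\<^sup>2 * (f - 1)\<^sup>2" by (simp add: power2_eq_square algebra_simps)
  also have "\<dots> \<le> 5\<^sup>2 * (f - 1)\<^sup>2" using f True by (intro mult_right_mono power_mono) auto
  finally have "ennreal (ent_integrand (f\<^sup>2)) \<le> ennreal (25 * (f - 1)\<^sup>2)" by (intro ennreal_leI) simp
  then show ?thesis by (rule order_trans) simp
next
  case False
  (* The dyadic level of f; it is at least 2 because 4 < f. *)
  define m where "m = nat \<lfloor>log 2 f\<rfloor>"
  have l2: "2 \<le> log 2 f" using False by (simp add: le_log_iff)
  then have "2 \<le> m" unfolding m_def by linarith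
  then obtain j where j: "m = Suc (Suc j)" by (metis add_2_eq_Suc le_Suc_ex)
  have "real m \<le> log 2 f" "log 2 f < real m + 1" using l2 unfolding m_def by linarith+
  then have "2 powr real m \<le> f" "f < 2 powr real (Suc m)" using f
      by (auto simp: le_log_iff log_less_iff add.commute)
  then have b: "2 ^ m \<le> f" "f < 2 ^ Suc m" by (simp_all only: powr_realpow zero_less_numeral)
  have f2: "f\<^sup>2 \<le> 4 ^ Suc m"
  proof -
    have "f\<^sup>2 \<le> (2 ^ Suc m)\<^sup>2" using b f by (intro power_mono) auto
    also have "\<dots> = 4 ^ Suc m"
        by (simp add: power_mult_distrib power_mult[symmetric] mult.commute[of m] power_mult)
    finally show ?thesis .
  qed
  have lnf: "ln f \<le> real (Suc m)"
  proof -
    have "ln f \<le> ln (2 ^ Suc m)" using b f by simp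
    also have "\<dots> = real (Suc m) * ln 2" by (rule ln_realpow)
    also have "\<dots> \<le> real (Suc m) * 1" using ln_2_less_1 by (intro mult_left_mono) auto
    finally show ?thesis by simp
  qed
  have "1 \<le> f\<^sup>2" using False by (simp add: one_le_power)
  then have "ent_integrand (f\<^sup>2) \<le> f\<^sup>2 * (2 * ln f)"
    using f by (simp add: ent_integrand_def ln_realpow)
  also have "\<dots> \<le> 4 ^ Suc m * (2 * real (Suc m))"
    using f2 lnf False by (intro mult_mono) auto
  also have "\<dots> \<le> 24 * (real (Suc j) * 4 ^ Suc (Suc j))" by (simp add: j algebra_simps)
  finally have "ennreal (ent_integrand (f\<^sup>2)) \<le>
      ennreal (24 * (real (Suc j) * 4 ^ Suc (Suc j))) * indicator {y. 2 ^ Suc (Suc j) \<le> y} f"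
    using b by (simp add: j ennreal_leI)
  also have "\<dots> \<le> (\<Sum>j. ennreal (24 * (real (Suc j) * 4 ^ Suc (Suc j))) * indicator {y. 2 ^ Suc (Suc j) \<le> y} f)"
    using sum_le_suminf[of
        "\<lambda>j. ennreal (24 * (real (Suc j) * 4 ^ Suc (Suc j))) * indicator {y. 2 ^ Suc (Suc j) \<le> y} f" "{j}"]
    by (simp only: sum.insert sum.empty finite.intros empty_iff summableI zero_le simp_thms add_0_right)
  finally show ?thesis by (rule order_trans) simp
qed

text \<open>
  Since \<open>\<integral> f\<^sup>2 = 1\<close>, the integral is \<open>2 (1 - \<integral> f)\<close>. The inequality with \<open>\<theta> = 3 / 2\<close> controls \<open>1 -
  \<integral> f\<close>, because the Cauchy--Schwarz inequality bounds the integral of \<open>f powr (3 / 2)\<close> by the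
  square root of \<open>\<integral> f\<close>.
\<close>
lemma L2_deviation_from_1:
  assumes LO: "Latala_Oleszkiewicz d r C \<mu>" and r: "1 < r" and C: "0 \<le> C" and \<mu>: "prob_measure_on d \<mu>"
    and f: "smooth_Rd d f" "\<And>x. x \<in> Rd d \<Longrightarrow> 0 < f x"
    and int: "integrable \<mu> (\<lambda>x. (f x)\<^sup>2)" "(\<integral>x. (f x)\<^sup>2 \<partial>\<mu>) = 1" "integrable \<mu> (\<lambda>x. (grad_norm d f x)\<^sup>2)"
  shows "integrable \<mu> (\<lambda>x. (f x - 1)\<^sup>2)"
    and "(\<integral>x. (f x - 1)\<^sup>2 \<partial>\<mu>) \<le> 3 * C * (\<integral>x. (grad_norm d f x)\<^sup>2 \<partial>\<mu>)"
proof -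
  interpret prob_space \<mu> using \<mu> by (simp add: prob_measure_on_def)
  have sp: "space \<mu> = Rd d" by (rule prob_measure_on_space[OF \<mu>])
  have fm[measurable]: "f \<in> borel_measurable \<mu>" by (rule borel_measurable_smooth_Rd[OF \<mu> f(1)])
  have f1: "integrable \<mu> f" by (rule square_integrable_imp_integrable[OF fm int(1)])
  have eq: "(f x - 1)\<^sup>2 = (f x)\<^sup>2 - 2 * f x + 1" for x by (simp add: power2_eq_square algebra_simps)
  show "integrable \<mu> (\<lambda>x. (f x - 1)\<^sup>2)" unfolding eq using f1 int by simp
  let ?m = "\<integral>x. f x \<partial>\<mu>" and ?D = "\<integral>x. (grad_norm d f x)\<^sup>2 \<partial>\<mu>"
  have D: "(\<integral>x. (f x - 1)\<^sup>2 \<partial>\<mu>) = 2 - 2 * ?m" unfolding eq using f1 int by (simp add: prob_space)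
  have fp: "0 < f x" if "x \<in> space \<mu>" for x using f sp that by simp
  have m: "0 \<le> ?m" using fp by (intro integral_nonneg_AE AE_I2) (auto intro: less_imp_le)
  have H: "(\<integral>x. ((f x)\<^sup>2) powr (1/2) * (f x) powr (1 - 1/2) \<partial>\<mu>)
      \<le> (\<integral>x. (f x)\<^sup>2 \<partial>\<mu>) powr (1/2) * ?m powr (1 - 1/2)"
    using int f1 fp by (intro Hoelder_integral(2)) (auto intro: less_imp_le)
  have "(\<integral>x. \<bar>f x\<bar> powr (3/2) \<partial>\<mu>) = (\<integral>x. ((f x)\<^sup>2) powr (1/2) * (f x) powr (1 - 1/2) \<partial>\<mu>)"
  proof (intro Bochner_Integration.integral_cong refl)
    fix x assume "x \<in> space \<mu>"
    then have p: "0 < f x" by (rule fp)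
    then have "((f x)\<^sup>2) powr (1/2) = (f x) powr 1" by (simp add: powr_half_sqrt)
    then have "((f x)\<^sup>2) powr (1/2) * (f x) powr (1 - 1/2) = f x powr (1 + (1 - 1/2))"
        by (simp only: powr_add)
    then show "\<bar>f x\<bar> powr (3/2) = ((f x)\<^sup>2) powr (1/2) * (f x) powr (1 - 1/2)" using p by simp
  qed
  also have "\<dots> \<le> ?m powr (1/2)" using H int by simp
  finally have "(\<integral>x. \<bar>f x\<bar> powr (3/2) \<partial>\<mu>) powr (2 / (3/2)) \<le> (?m powr (1/2)) powr (2 / (3/2))"
    by (intro powr_mono2) (auto intro!: integral_nonneg_AE)
  also have "\<dots> = ?m powr (2/3) * 1 powr (1/3)" by (simp add: powr_powr)
  also have "\<dots> \<le> 2/3 * ?m + 1/3 * 1"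
    using Youngs_inequality_0[of "2/3" "1/3" ?m 1] m by (cases "?m = 0") auto
  finally have "2/3 * (1 - ?m) \<le> 1 - (\<integral>x. \<bar>f x\<bar> powr (3/2) \<partial>\<mu>) powr (2 / (3/2))" by simp
  also have "\<dots> \<le> (2 - 3/2) powr (2 * (1 - 1 / r)) * (C * ?D)"
    using Latala_OleszkiewiczD[OF LO f(1) int(1,3), of "3/2"] int(2) by simp
  also have "\<dots> \<le> 1 * (C * ?D)"
    using C r by (intro mult_right_mono powr_le1) (auto simp: field_simps)
  finally show "(\<integral>x. (f x - 1)\<^sup>2 \<partial>\<mu>) \<le> 3 * C * ?D" unfolding D by simp
qed

text \<open>
  With \<open>a k = 4 ^ k \<mu> {f \<ge> 2 ^ k}\<close> and \<open>w k\<close> the part of the right-hand side carried by the \<open>k\<close>-th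
  dyadic piece, Young's inequality with a suitable \<open>\<delta>\<close> turns the recursion between superlevel sets
  into \<open>k a (k + 1) \<le> k a k / 4 + C2 w k\<close>. Its sum bounds the entropy carried by the set where \<open>f
  > 4\<close>, and \<open>a 1\<close> is bounded by \<open>\<integral> (f - 1)\<^sup>2\<close>.
\<close>
lemma normalized_mLSI:
  assumes LO: "Latala_Oleszkiewicz d r C \<mu>" and r: "1 < r" "r < 2" and C: "0 < C" and \<mu>: "prob_measure_on d \<mu>"
    and f: "smooth_Rd d f" "\<And>x. x \<in> Rd d \<Longrightarrow> 0 < f x"
    and int: "integrable \<mu> (\<lambda>x. (f x)\<^sup>2)" "(\<integral>x. (f x)\<^sup>2 \<partial>\<mu>) = 1"
      "integrable \<mu> (\<lambda>x. H (conj_exponent r) (grad_norm d f x / f x) * (f x)\<^sup>2)"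
    and s': "\<And>v. (smooth_step has_real_derivative s' v) (at v)"
      "\<And>v. v \<le> 0 \<or> 1 \<le> v \<Longrightarrow> s' v = 0" "\<And>v. \<bar>s' v\<bar> \<le> L" "0 < L"
  defines "K \<equiv> 219 * C + 48 * (20 * C * L\<^sup>2 * (1 / (320 * C * L\<^sup>2)) powr (1 - conj_exponent r / 2))"
  shows "integrable \<mu> (\<lambda>x. ent_integrand ((f x)\<^sup>2))"
    and "(\<integral>x. ent_integrand ((f x)\<^sup>2) \<partial>\<mu>)
      \<le> K * (\<integral>x. H (conj_exponent r) (grad_norm d f x / f x) * (f x)\<^sup>2 \<partial>\<mu>)"
proof -
  interpret prob_space \<mu> using \<mu> by (simp add: prob_measure_on_def)
  define q where "q = conj_exponent r"
  define W where "W x = H q (grad_norm d f x / f x) * (f x)\<^sup>2" for x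
  define I where "I = (\<integral>x. W x \<partial>\<mu>)"
  have q: "2 < q" using r by (simp add: q_def conj_exponent_def field_simps)
  have e: "2 * (1 - 1 / r) = 2 / q" using r by (simp add: q_def conj_exponent_def field_simps)
  have sp: "space \<mu> = Rd d" by (rule prob_measure_on_space[OF \<mu>])
  have fm[measurable]: "f \<in> borel_measurable \<mu>" by (rule borel_measurable_smooth_Rd[OF \<mu> f(1)])
  have gm[measurable]: "grad_norm d f \<in> borel_measurable \<mu>" by (rule borel_measurable_grad_norm[OF \<mu> f(1)])
  have lev[measurable]: "level_set \<mu> f k \<in> sets \<mu>" for k by (rule sets_level_set[OF fm])
  have fp: "0 < f x" if "x \<in> space \<mu>" for x using f(2) sp that by simp
  have Wint: "integrable \<mu> W" using int(3) unfolding W_def q_def .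
  have W0: "0 \<le> W x" for x by (simp add: W_def H_def le_max_iff_disj)
  have I0: "0 \<le> I" unfolding I_def using W0 by simp
  have gW: "(grad_norm d f x)\<^sup>2 \<le> W x" if "x \<in> space \<mu>" for x
  proof -
    have "(grad_norm d f x)\<^sup>2 = (grad_norm d f x / f x)\<^sup>2 * (f x)\<^sup>2"
      using fp[OF that] by (simp add: power_divide)
    also have "\<dots> \<le> W x" unfolding W_def by (intro mult_right_mono) (auto simp: H_def)
    finally show ?thesis .
  qed
  have gint: "integrable \<mu> (\<lambda>x. (grad_norm d f x)\<^sup>2)"
    by (rule Bochner_Integration.integrable_bound[OF Wint]) (use gW W0 in \<open>auto intro!: AE_I2\<close>)
  have gI: "(\<integral>x. (grad_norm d f x)\<^sup>2 \<partial>\<mu>) \<le> I"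
    unfolding I_def by (intro integral_mono gint Wint gW)
  note Dint = L2_deviation_from_1(1)[OF LO r(1) less_imp_le[OF C] \<mu> f int(1,2) gint]
  define D where "D = (\<integral>x. (f x - 1)\<^sup>2 \<partial>\<mu>)"
  have D: "D \<le> 3 * C * I"
    using L2_deviation_from_1(2)[OF LO r(1) less_imp_le[OF C] \<mu> f int(1,2) gint] gI C
    unfolding D_def by (smt (verit) mult_left_mono mult_nonneg_nonneg)
  have D0: "0 \<le> D" by (simp add: D_def)
  define a where "a k = 4 ^ k * measure \<mu> {x \<in> space \<mu>. 2 ^ k \<le> f x}" for k :: nat
  have a0: "0 \<le> a k" for k by (simp add: a_def)
  define w where "w k = (\<integral>x. indicator (level_set \<mu> f k) x * W x \<partial>\<mu>)" for k
  have wint: "integrable \<mu> (\<lambda>x. indicator (level_set \<mu> f k) x * W x)" for k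
    using integrable_mult_indicator[OF lev Wint, of k] by simp
  define C1 where "C1 = 5 * C * L\<^sup>2"
  (* Chosen so that the coefficient 16 * C1 * \<delta> of the absorbed term is 1 / 4. *)
  define \<delta> where "\<delta> = 1 / (64 * C1)"
  define C2 where "C2 = 4 * C1 * \<delta> powr (1 - q / 2)"
  have C1: "0 < C1" using C s'(4) by (simp add: C1_def)
  have \<delta>: "0 < \<delta>" using C1 by (simp add: \<delta>_def)
  have C2: "0 \<le> C2" using C1 by (simp add: C2_def)
  have step: "real (Suc k) * a (Suc (Suc k)) \<le> real (Suc k) * a (Suc k) / 4 + C2 * w (Suc k)" for k
  proof -
    define n where "n = Suc k"
    have n: "1 \<le> n" by (simp add: n_def)
    let ?lev = "level_set \<mu> f n"
    let ?E = "\<integral>x. indicator ?lev x * (grad_norm d f x)\<^sup>2 \<partial>\<mu>"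
    have i1: "integrable \<mu> (\<lambda>x. indicator ?lev x * (grad_norm d f x)\<^sup>2)"
      using integrable_mult_indicator[OF lev gint, of n] by simp
    have i2: "integrable \<mu> (\<lambda>x. \<delta> * real n * (4 ^ Suc n * indicator {x \<in> space \<mu>. 2 ^ n \<le> f x} x) +
        \<delta> powr (1 - q / 2) * (indicator ?lev x * W x))"
      using wint[of n] by (intro Bochner_Integration.integrable_add integrable_mult_right)
        (auto simp: emeasure_eq_measure)
    have rec: "a (Suc n) \<le> 4 * (C1 * real n powr (- (2 / q)) * ?E)"
      using superlevel_recursion[OF LO r(1) less_imp_le[OF C] \<mu> f int(1,2) gint s' n, unfolded e]
      by (simp add: a_def C1_def algebra_simps)
    have "real n * a (Suc n) \<le> real n * (4 * (C1 * real n powr (- (2 / q)) * ?E))"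
      by (intro mult_left_mono rec) auto
    also have "\<dots> = 4 * C1 * (real n powr 1 * real n powr (- (2 / q))) * ?E"
      using n by simp
    also have "\<dots> = 4 * C1 * (\<integral>x. real n powr (1 - 2 / q) * (indicator ?lev x * (grad_norm d f x)\<^sup>2) \<partial>\<mu>)"
      by (simp add: powr_diff powr_minus_divide)
    also have "\<dots> \<le> 4 * C1 * (\<integral>x. \<delta> * real n * (4 ^ Suc n * indicator {x \<in> space \<mu>. 2 ^ n \<le> f x} x) +
        \<delta> powr (1 - q / 2) * (indicator ?lev x * W x) \<partial>\<mu>)"
    proof (intro mult_left_mono integral_mono i2)
      fix x assume x: "x \<in> space \<mu>"
      show "real n powr (1 - 2 / q) * (indicator ?lev x * (grad_norm d f x)\<^sup>2)
        \<le> \<delta> * real n * (4 ^ Suc n * indicator {x \<in> space \<mu>. 2 ^ n \<le> f x} x) +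
          \<delta> powr (1 - q / 2) * (indicator ?lev x * W x)"
      proof (cases "x \<in> ?lev")
        case True
        define y where "y = grad_norm d f x / f x"
        have y: "0 \<le> y" using fp[OF x] by (simp add: y_def grad_norm_nonneg)
        have lx: "2 ^ n \<le> f x" "f x < 2 ^ Suc n" using True by (auto simp: level_set_def)
        have f4: "(f x)\<^sup>2 \<le> 4 ^ Suc n"
        proof -
          have "(f x)\<^sup>2 \<le> (2 ^ Suc n)\<^sup>2" using lx fp[OF x] by (intro power_mono) auto
          also have "\<dots> = 4 ^ Suc n"
              by (simp add: power_mult_distrib power_mult[symmetric] mult.commute[of n] power_mult)
          finally show ?thesis .
        qed
        have "real n powr (1 - 2 / q) * (grad_norm d f x)\<^sup>2 = (f x)\<^sup>2 * (y\<^sup>2 * real n powr (1 - 2 / q))"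
          using fp[OF x] by (simp add: y_def power_divide)
        also have "\<dots> \<le> (f x)\<^sup>2 * (\<delta> * real n + \<delta> powr (1 - q / 2) * y powr q)"
          using Young_split[OF y \<delta> _ q, of "real n"] n by (intro mult_left_mono) auto
        also have "\<dots> = \<delta> * real n * (f x)\<^sup>2 + \<delta> powr (1 - q / 2) * (y powr q * (f x)\<^sup>2)"
          by (simp add: algebra_simps)
        also have "\<dots> \<le> \<delta> * real n * 4 ^ Suc n + \<delta> powr (1 - q / 2) * W x"
          using f4 y \<delta> unfolding W_def y_def[symmetric]
          by (intro add_mono mult_left_mono mult_right_mono) (auto simp: H_def)
        finally show ?thesis using True lx x by simp
      next
        case False
        then show ?thesis using \<delta> by simp
      qed
    qed (use i1 C1 in auto)
    also have "\<dots> = 16 * C1 * \<delta> * (real n * a n) + C2 * w n"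
    proof -
      have "(\<integral>x. \<delta> * real n * (4 ^ Suc n * indicator {x \<in> space \<mu>. 2 ^ n \<le> f x} x) +
        \<delta> powr (1 - q / 2) * (indicator ?lev x * W x) \<partial>\<mu>)
        = \<delta> * real n * (4 ^ Suc n * measure \<mu> {x \<in> space \<mu>. 2 ^ n \<le> f x}) + \<delta> powr (1 - q / 2) * w n"
        unfolding w_def using wint[of n]
        by (subst Bochner_Integration.integral_add) (auto simp: emeasure_eq_measure)
      then show ?thesis by (simp add: C2_def a_def algebra_simps)
    qed
    also have "16 * C1 * \<delta> * (real n * a n) = real n * a n / 4" using C1 by (simp add: \<delta>_def)
    finally show ?thesis by (simp add: n_def)
  qed
  have wsum: "(\<Sum>k<N. C2 * w (Suc k)) \<le> C2 * I" for N
  proof -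
    have "(\<Sum>k<N. w (Suc k)) = (\<integral>x. (\<Sum>k<N. indicator (level_set \<mu> f (Suc k)) x * W x) \<partial>\<mu>)"
      unfolding w_def using wint by (subst Bochner_Integration.integral_sum) auto
    also have "\<dots> \<le> I"
      unfolding I_def
    proof (intro integral_mono Wint Bochner_Integration.integrable_sum wint)
      fix x assume "x \<in> space \<mu>"
      then show "(\<Sum>k<N. indicator (level_set \<mu> f (Suc k)) x * W x) \<le> W x"
        unfolding sum_distrib_right[symmetric] using sum_indicator_level_set[of x \<mu> f N] W0[of x] by simp
    qed
    finally show ?thesis using C2 by (simp add: sum_distrib_left[symmetric] mult_left_mono)
  qed
  have tail: "(\<Sum>k<N. real (Suc k) * a (Suc (Suc k))) \<le> a 1 / 2 + 2 * (C2 * I)" for N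
    by (rule absorbed_sum_bound[OF a0 step wsum])
  have a1: "a 1 \<le> 4 * D"
  proof -
    have "measure \<mu> {x \<in> space \<mu>. 2 ^ 1 \<le> f x} = (\<integral>x. indicator {x \<in> space \<mu>. 2 ^ 1 \<le> f x} x \<partial>\<mu>)" by simp
    also have "\<dots> \<le> D" unfolding D_def
      by (rule integral_mono[OF _ Dint], simp add: emeasure_eq_measure, auto simp: indicator_def one_le_power)
    finally show ?thesis by (simp add: a_def)
  qed
  have nn: "0 \<le> ent_integrand ((f x)\<^sup>2)" if "x \<in> space \<mu>" for x
    using fp[OF that] by (intro ent_integrand_nonneg) simp
  have em[measurable]: "(\<lambda>x. ent_integrand ((f x)\<^sup>2)) \<in> borel_measurable \<mu>"
    unfolding ent_integrand_def by measurable
  have Kb: "(\<integral>\<^sup>+ x. ennreal (ent_integrand ((f x)\<^sup>2)) \<partial>\<mu>) \<le> ennreal (K * I)"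
  proof -
    let ?T = "\<lambda>j x. ennreal (24 * (real (Suc j) * 4 ^ Suc (Suc j))) * indicator {y. 2 ^ Suc (Suc j)
        \<le> y} (f x)"
    have "(\<integral>\<^sup>+ x. ennreal (ent_integrand ((f x)\<^sup>2)) \<partial>\<mu>) \<le>
      (\<integral>\<^sup>+ x. ennreal (25 * (f x - 1)\<^sup>2) +
        (\<Sum>j. ?T j x) \<partial>\<mu>)"
      by (intro nn_integral_mono ent_integrand_bound fp)
    also have "\<dots> = (\<integral>\<^sup>+ x. ennreal (25 * (f x - 1)\<^sup>2) \<partial>\<mu>) +
        (\<Sum>j. (\<integral>\<^sup>+ x. ?T j x \<partial>\<mu>))"
      by (subst nn_integral_add) (auto intro!: nn_integral_suminf)
    also have "(\<integral>\<^sup>+ x. ennreal (25 * (f x - 1)\<^sup>2) \<partial>\<mu>) = ennreal (25 * D)"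
      unfolding D_def using Dint by (subst nn_integral_eq_integral) auto
    also have "(\<lambda>j. (\<integral>\<^sup>+ x. ?T j x \<partial>\<mu>))
      = (\<lambda>j. ennreal (24 * (real (Suc j) * a (Suc (Suc j)))))"
    proof
      fix j
      have "(\<integral>\<^sup>+ x. ?T j x \<partial>\<mu>)
        = (\<integral>\<^sup>+ x. ennreal (24 * (real (Suc j) * 4 ^ Suc (Suc j)))
            * indicator {x \<in> space \<mu>. 2 ^ Suc (Suc j) \<le> f x} x \<partial>\<mu>)"
        by (intro nn_integral_cong) (auto simp: indicator_def)
      also have "\<dots> = ennreal (24 * (real (Suc j) * 4 ^ Suc (Suc j)))
          * emeasure \<mu> {x \<in> space \<mu>. 2 ^ Suc (Suc j) \<le> f x}"
        by (intro nn_integral_cmult_indicator) measurable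
      also have "\<dots> = ennreal (24 * (real (Suc j) * a (Suc (Suc j))))"
        by (simp only: emeasure_eq_measure a_def) (simp add: ennreal_mult[symmetric] mult.assoc del:
            power_Suc)
      finally show "(\<integral>\<^sup>+ x. ?T j x \<partial>\<mu>)
        = ennreal (24 * (real (Suc j) * a (Suc (Suc j))))" .
    qed
    also have "(\<Sum>j. ennreal (24 * (real (Suc j) * a (Suc (Suc j)))))
        \<le> ennreal (24 * (a 1 / 2 + 2 * (C2 * I)))"
    proof (rule suminf_le_const[OF summableI])
      fix N
      have "(\<Sum>j<N. ennreal (24 * (real (Suc j) * a (Suc (Suc j)))))
          = ennreal (24 * (\<Sum>j<N. real (Suc j) * a (Suc (Suc j))))"
        unfolding sum_distrib_left by (rule sum_ennreal) (simp add: a0)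
      also have "\<dots> \<le> ennreal (24 * (a 1 / 2 + 2 * (C2 * I)))"
        using tail[of N] by (intro ennreal_leI) simp
      finally show "(\<Sum>j<N. ennreal (24 * (real (Suc j) * a (Suc (Suc j)))))
          \<le> ennreal (24 * (a 1 / 2 + 2 * (C2 * I)))" .
    qed
    also have "ennreal (25 * D) + ennreal (24 * (a 1 / 2 + 2 * (C2 * I)))
        = ennreal (25 * D + 24 * (a 1 / 2 + 2 * (C2 * I)))"
      using D0 a0[of 1] C2 I0 by (intro ennreal_plus[symmetric]) auto
    also have "\<dots> \<le> ennreal (K * I)"
    proof (intro ennreal_leI)
      have "25 * D + 24 * (a 1 / 2 + 2 * (C2 * I)) \<le> 73 * D + 48 * (C2 * I)" using a1 by simp
      also have "\<dots> \<le> 219 * C * I + 48 * C2 * I" using D by simp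
      also have "\<dots> = K * I"
        by (simp add: K_def C2_def \<delta>_def C1_def q_def algebra_simps)
      finally show "25 * D + 24 * (a 1 / 2 + 2 * (C2 * I)) \<le> K * I" .
    qed
    finally show ?thesis by (simp add: add_left_mono)
  qed
  show int_ent: "integrable \<mu> (\<lambda>x. ent_integrand ((f x)\<^sup>2))"
    by (rule integrableI_nonneg) (use nn Kb in \<open>auto intro!: AE_I2 intro: le_less_trans[OF _
        ennreal_less_top]\<close>)
  have K0: "0 \<le> K * I"
    using C I0 by (simp add: K_def)
  have "ennreal (\<integral>x. ent_integrand ((f x)\<^sup>2) \<partial>\<mu>) \<le> ennreal (K * I)"
    using Kb nn_integral_eq_integral[OF int_ent] nn by (simp add: AE_I2)
  then show "(\<integral>x. ent_integrand ((f x)\<^sup>2) \<partial>\<mu>)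
      \<le> K * (\<integral>x. H (conj_exponent r) (grad_norm d f x / f x) * (f x)\<^sup>2 \<partial>\<mu>)"
    using K0 by (simp add: I_def W_def q_def)
qed

text \<open>
  The general case reduces to \<open>\<integral> f\<^sup>2 = 1\<close> by homogeneity. Replacing \<open>C_LO\<close> by \<open>max C_LO 1\<close> makes
  the constant positive.
\<close>
theorem Latala_Oleszkiewicz_imp_mLSI:
  assumes r: "1 < r" "r < 2"
  shows "\<exists>C>0. \<forall>d \<mu>. prob_measure_on d \<mu> \<longrightarrow> Latala_Oleszkiewicz d r C_LO \<mu> \<longrightarrow> modified_log_Sobolev d r C \<mu>"
proof -
  obtain s' L where s': "\<And>v. (smooth_step has_real_derivative s' v) (at v)"
    "\<And>v. v \<le> 0 \<or> 1 \<le> v \<Longrightarrow> s' v = 0" "\<And>v. \<bar>s' v\<bar> \<le> L" "0 < L"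
    using smooth_step_DERIV by metis
  define C where "C = max C_LO 1"
  have C: "0 < C" by (simp add: C_def)
  define K where "K = 219 * C + 48 * (20 * C * L\<^sup>2 * (1 / (320 * C * L\<^sup>2)) powr (1 - conj_exponent r / 2))"
  have K: "0 < K" using C by (simp add: K_def add_pos_nonneg)
  have "modified_log_Sobolev d r K \<mu>" if \<mu>: "prob_measure_on d \<mu>" and LO:
      "Latala_Oleszkiewicz d r C_LO \<mu>" for d \<mu>
    unfolding modified_log_Sobolev_def
  proof (intro allI impI)
    fix f assume f: "smooth_Rd d f" "\<forall>x\<in>Rd d. 0 < f x" and f2: "integrable \<mu> (\<lambda>x. (f x)\<^sup>2)"
      and hint: "integrable \<mu> (\<lambda>x. H (conj_exponent r) (grad_norm d f x / f x) * (f x)\<^sup>2)"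
    let ?W = "\<lambda>f x. H (conj_exponent r) (grad_norm d f x / f x) * (f x)\<^sup>2"
    interpret prob_space \<mu> using \<mu> by (simp add: prob_measure_on_def)
    have LO': "Latala_Oleszkiewicz d r C \<mu>" by (rule Latala_Oleszkiewicz_mono[OF LO]) (simp add: C_def)
    have sp: "space \<mu> = Rd d" by (rule prob_measure_on_space[OF \<mu>])
    define m where "m = (\<integral>x. (f x)\<^sup>2 \<partial>\<mu>)"
    have m: "0 < m"
    proof -
      have "\<not> (AE x in \<mu>. (f x)\<^sup>2 = 0)"
      proof
        assume *: "AE x in \<mu>. (f x)\<^sup>2 = 0"
        have "(f x)\<^sup>2 \<noteq> 0" if "x \<in> space \<mu>" for x
          using f(2) that sp by (metis less_irrefl zero_eq_power2)
        then have "AE x in \<mu>. (f x)\<^sup>2 \<noteq> 0" by (rule AE_I2)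
        with * have "AE x in \<mu>. False" by (rule AE_mp[OF _ AE_mp]) auto
        then show False by simp
      qed
      then have "m \<noteq> 0" unfolding m_def using integral_nonneg_eq_0_iff_AE[OF f2] by auto
      then show ?thesis unfolding m_def by (simp add: order_less_le)
    qed
    define c where "c = 1 / sqrt m"
    have c: "0 < c" "c\<^sup>2 = 1 / m" using m by (auto simp: c_def power_divide)
    define g where "g x = c * f x" for x
    have g: "smooth_Rd d g" "\<And>x. x \<in> Rd d \<Longrightarrow> 0 < g x"
      unfolding g_def using f c by (auto intro: smooth_Rd_mult smooth_Rd_const)
    have g2: "(g x)\<^sup>2 = (f x)\<^sup>2 / m" for x by (simp add: g_def power_mult_distrib c)
    have gg: "grad_norm d g x / g x = grad_norm d f x / f x" if "x \<in> space \<mu>" for x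
    proof -
      have "((\<lambda>y. c * y) has_real_derivative c) (at (f x))" by (auto intro!: derivative_eq_intros)
      from grad_norm_comp[OF f(1) _ this] that sp have "grad_norm d g x = \<bar>c\<bar> * grad_norm d f x"
        unfolding g_def by simp
      then show ?thesis using c by (simp add: g_def)
    qed
    have W: "?W g x = ?W f x / m"
      if "x \<in> space \<mu>" for x by (simp add: gg[OF that] g2)
    have gint: "integrable \<mu> (\<lambda>x. (g x)\<^sup>2)" "(\<integral>x. (g x)\<^sup>2 \<partial>\<mu>) = 1"
      using f2 m by (simp_all add: g2 m_def)
    have ghint: "integrable \<mu> (\<lambda>x. ?W g x)"
      using hint by (subst Bochner_Integration.integrable_cong[OF refl W]) auto
    have Weq: "(\<integral>x. ?W g x \<partial>\<mu>)
      = (\<integral>x. ?W f x \<partial>\<mu>) / m"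
      by (subst Bochner_Integration.integral_cong[OF refl W]) auto
    note main = normalized_mLSI[OF LO' r C \<mu> g gint ghint s', folded K_def]
    have eq: "(f x)\<^sup>2 * ln ((f x)\<^sup>2) = m * ent_integrand ((g x)\<^sup>2) + (f x)\<^sup>2 - m + (f x)\<^sup>2 * ln m"
      if "x \<in> space \<mu>" for x
    proof -
      have "0 < f x" using f that sp by auto
      then show ?thesis using m by (simp add: ent_integrand_def g2 ln_div field_simps)
    qed
    have i: "integrable \<mu> (\<lambda>x. m * ent_integrand ((g x)\<^sup>2) + (f x)\<^sup>2 - m + (f x)\<^sup>2 * ln m)"
      using main(1) f2 by simp
    show "integrable \<mu> (\<lambda>x. (f x)\<^sup>2 * ln ((f x)\<^sup>2)) \<and> Ent \<mu> (\<lambda>x. (f x)\<^sup>2)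
            \<le> K * (\<integral>x. ?W f x \<partial>\<mu>)"
    proof
      show "integrable \<mu> (\<lambda>x. (f x)\<^sup>2 * ln ((f x)\<^sup>2))"
        using i by (subst Bochner_Integration.integrable_cong[OF refl eq]) auto
      have "(\<integral>x. (f x)\<^sup>2 * ln ((f x)\<^sup>2) \<partial>\<mu>)
          = (\<integral>x. m * ent_integrand ((g x)\<^sup>2) + (f x)\<^sup>2 - m + (f x)\<^sup>2 * ln m \<partial>\<mu>)"
        by (rule Bochner_Integration.integral_cong[OF refl eq])
      also have "\<dots> = m * (\<integral>x. ent_integrand ((g x)\<^sup>2) \<partial>\<mu>) + m * ln m"
        using main(1) f2 by (simp add: m_def[symmetric] prob_space)
      finally have "Ent \<mu> (\<lambda>x. (f x)\<^sup>2) = m * (\<integral>x. ent_integrand ((g x)\<^sup>2) \<partial>\<mu>)"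
        by (simp add: Ent_def m_def[symmetric])
      also have "\<dots> \<le> m * (K * ((\<integral>x. ?W f x \<partial>\<mu>) / m))"
        using main(2) m by (intro mult_left_mono) (auto simp: Weq)
      also have "\<dots> = K * (\<integral>x. ?W f x \<partial>\<mu>)"
        using m by simp
      finally show "Ent \<mu> (\<lambda>x. (f x)\<^sup>2) \<le> K * (\<integral>x. ?W f x \<partial>\<mu>)" .
    qed
  qed
  with K show ?thesis by blast
qed

section \<open>Subadditivity of entropy\<close>

text \<open>
  The entropy estimates are used for exponentials of bounded functions only; bounds on both sides
  make all integrals below finite.
\<close>
definition bounded_positive :: "'a measure \<Rightarrow> real \<Rightarrow> real \<Rightarrow> ('a \<Rightarrow> real) \<Rightarrow> bool" where
  "bounded_positive M c b g \<longleftrightarrow> 0 < c \<and> g \<in> borel_measurable M \<and> (\<forall>x\<in>space M. c \<le> g x \<and> g x \<le> b)"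

definition entropy_bound :: "real \<Rightarrow> real \<Rightarrow> real" where
  "entropy_bound c b = b * max \<bar>ln c\<bar> \<bar>ln b\<bar>"

lemma abs_mult_ln_le:
  assumes "0 < c" "c \<le> y" "y \<le> b"
  shows "\<bar>y * ln y\<bar> \<le> entropy_bound c b"
proof -
  have "ln c \<le> ln y" "ln y \<le> ln b" using assms by auto
  then have "\<bar>ln y\<bar> \<le> max \<bar>ln c\<bar> \<bar>ln b\<bar>" by linarith
  then have "\<bar>y\<bar> * \<bar>ln y\<bar> \<le> b * max \<bar>ln c\<bar> \<bar>ln b\<bar>" using assms by (intro mult_mono) auto
  then show ?thesis by (simp add: entropy_bound_def abs_mult)
qed

context prob_space
begin

lemma bounded_positive_integrable:
  assumes "bounded_positive M c b g"
  shows "integrable M g" "integrable M (\<lambda>x. g x * ln (g x))"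
proof -
  have [measurable]: "g \<in> borel_measurable M" using assms by (simp add: bounded_positive_def)
  show "integrable M g"
    by (rule integrable_const_bound[of _ b]) (use assms in \<open>auto simp: bounded_positive_def intro!: AE_I2\<close>)
  show "integrable M (\<lambda>x. g x * ln (g x))"
    by (rule integrable_const_bound[of _ "entropy_bound c b"])
      (use assms in \<open>auto simp: bounded_positive_def intro!: AE_I2 abs_mult_ln_le\<close>)
qed

lemma bounded_positive_expectation:
  assumes "bounded_positive M c b g"
  shows "c \<le> expectation g" "expectation g \<le> b"
proof -
  have "(\<integral>x. c \<partial>M) \<le> expectation g" "expectation g \<le> (\<integral>x. b \<partial>M)"
    using bounded_positive_integrable[OF assms] assms
    by (intro integral_mono; simp add: bounded_positive_def)+
  then show "c \<le> expectation g" "expectation g \<le> b" by (simp_all add: prob_space)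
qed

lemma abs_Ent_le:
  assumes g: "bounded_positive M c b g"
  shows "\<bar>Ent M g\<bar> \<le> 2 * entropy_bound c b"
proof -
  have "\<bar>\<integral>x. g x * ln (g x) \<partial>M\<bar> \<le> (\<integral>x. \<bar>g x * ln (g x)\<bar> \<partial>M)" by (rule integral_abs_bound)
  also have "\<dots> \<le> (\<integral>x. entropy_bound c b \<partial>M)"
    using bounded_positive_integrable[OF g] g
    by (intro integral_mono) (auto simp: bounded_positive_def intro: abs_mult_ln_le)
  finally have "\<bar>\<integral>x. g x * ln (g x) \<partial>M\<bar> \<le> entropy_bound c b" by (simp add: prob_space)
  moreover have "\<bar>expectation g * ln (expectation g)\<bar> \<le> entropy_bound c b"
    using bounded_positive_expectation[OF g] g by (intro abs_mult_ln_le) (auto simp: bounded_positive_def)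
  ultimately show ?thesis unfolding Ent_def by linarith
qed

text \<open>
  One half of the variational formula for the entropy: with \<open>m = \<integral> g\<close> and \<open>n = \<integral> u\<close>, it is the
  pointwise inequality \<open>ln t \<le> t - 1\<close> at \<open>t = m u / (n g)\<close>, multiplied by \<open>g\<close> and integrated.
\<close>
lemma Ent_variational:
  assumes g: "bounded_positive M c b g" and u: "bounded_positive M c' b' u"
  shows "(\<integral>x. g x * ln (u x) \<partial>M) - expectation g * ln (expectation u) \<le> Ent M g"
    and "integrable M (\<lambda>x. g x * ln (u x))"
proof -
  have [measurable]: "g \<in> borel_measurable M" "u \<in> borel_measurable M"
    using g u by (auto simp: bounded_positive_def)
  define m n where "m = expectation g" and "n = expectation u"
  have m: "0 < m" "0 < n"
    using bounded_positive_expectation[OF g] bounded_positive_expectation[OF u] g u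
    by (auto simp: m_def n_def bounded_positive_def)
  show i: "integrable M (\<lambda>x. g x * ln (u x))"
  proof (rule integrable_const_bound[of _ "b * max \<bar>ln c'\<bar> \<bar>ln b'\<bar>"])
    show "AE x in M. norm (g x * ln (u x)) \<le> b * max \<bar>ln c'\<bar> \<bar>ln b'\<bar>"
    proof (rule AE_I2)
      fix x assume x: "x \<in> space M"
      then have "0 < c'" "c' \<le> u x" "u x \<le> b'" "0 < c" "c \<le> g x" "g x \<le> b" using g u
          by (auto simp: bounded_positive_def)
      then have "ln c' \<le> ln (u x)" "ln (u x) \<le> ln b'" by auto
      then have "\<bar>ln (u x)\<bar> \<le> max \<bar>ln c'\<bar> \<bar>ln b'\<bar>" by linarith
      then have "\<bar>g x\<bar> * \<bar>ln (u x)\<bar> \<le> b * max \<bar>ln c'\<bar> \<bar>ln b'\<bar>"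
        using \<open>0 < c\<close> \<open>c \<le> g x\<close> \<open>g x \<le> b\<close> by (intro mult_mono) auto
      then show "norm (g x * ln (u x)) \<le> b * max \<bar>ln c'\<bar> \<bar>ln b'\<bar>" by (simp add: abs_mult)
    qed
  qed measurable
  note gi = bounded_positive_integrable[OF g] and ui = bounded_positive_integrable[OF u]
  have "(\<integral>x. g x * ln (u x) \<partial>M) + m * (ln m - ln n) + (m - m / n * n)
      = (\<integral>x. g x * ln (u x) + (g x * (ln m - ln n) + (g x - m / n * u x)) \<partial>M)"
    using gi(1) i ui(1) by (simp add: m_def n_def)
  also have "\<dots> \<le> (\<integral>x. g x * ln (g x) \<partial>M)"
  proof (rule integral_mono)
    fix x assume x: "x \<in> space M"
    then have p: "0 < u x" "0 < g x" using g u unfolding bounded_positive_def by (meson less_le_trans)+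
    have "ln (m * u x / (n * g x)) \<le> m * u x / (n * g x) - 1"
      using p m by (intro ln_le_minus_one) simp
    then have "g x * ln (m * u x / (n * g x)) \<le> g x * (m * u x / (n * g x) - 1)"
      using p by (intro mult_left_mono) auto
    also have "\<dots> = m / n * u x - g x" using p m by (simp add: field_simps)
    finally show "g x * ln (u x) + (g x * (ln m - ln n) + (g x - m / n * u x)) \<le> g x * ln (g x)"
      using p m by (simp add: ln_mult ln_div algebra_simps)
  qed (use gi i ui in auto)
  finally show "(\<integral>x. g x * ln (u x) \<partial>M) - expectation g * ln (expectation u) \<le> Ent M g"
    using m by (simp add: Ent_def m_def[symmetric] n_def[symmetric] algebra_simps)
qed

end

text \<open>
  Let \<open>p\<close> be the marginal \<open>y \<mapsto> \<integral> f x y dx\<close>. The entropy of \<open>f\<close> is the mean entropy in \<open>x\<close> plus the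
  entropy of \<open>p\<close>. The latter is at most the mean entropy in \<open>y\<close>, as one sees by testing each \<open>f x\<close>
  against the same function \<open>p\<close> in the variational formula.
\<close>
lemma Ent_pair_le:
  assumes "prob_space M1" "prob_space M2" and c: "0 < c"
    and f[measurable]: "(\<lambda>(x, y). f x y) \<in> borel_measurable (M1 \<Otimes>\<^sub>M M2)"
    and b: "\<And>x y. x \<in> space M1 \<Longrightarrow> y \<in> space M2 \<Longrightarrow> c \<le> f x y \<and> f x y \<le> b"
  shows "(\<integral>x. \<integral>y. f x y * ln (f x y) \<partial>M2 \<partial>M1) - (\<integral>x. \<integral>y. f x y \<partial>M2 \<partial>M1) * ln (\<integral>x. \<integral>y. f x y \<partial>M2 \<partial>M1)
    \<le> (\<integral>y. Ent M1 (\<lambda>x. f x y) \<partial>M2) + (\<integral>x. Ent M2 (f x) \<partial>M1)"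
proof -
  interpret M1: prob_space M1 by fact
  interpret M2: prob_space M2 by fact
  interpret P: pair_prob_space M1 M2 ..
  define p where "p y = (\<integral>x. f x y \<partial>M1)" for y
  have f2[measurable]: "(\<lambda>(y, x). f x y) \<in> borel_measurable (M2 \<Otimes>\<^sub>M M1)"
    using measurable_pair_swap[OF f] by (simp add: case_prod_unfold)
  have pm[measurable]: "p \<in> borel_measurable M2" unfolding p_def by measurable
  have bp1: "bounded_positive M1 c b (\<lambda>x. f x y)" if "y \<in> space M2" for y
    using that b c by (auto simp: bounded_positive_def intro!: measurable_compose[OF _ f2, of
        "\<lambda>x. (y, x)", simplified])
  have bp2: "bounded_positive M2 c b (f x)" if "x \<in> space M1" for x
    using that b c by (auto simp: bounded_positive_def intro!: measurable_compose[OF _ f, of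
        "\<lambda>y. (x, y)", simplified])
  have bpp: "bounded_positive M2 c b p"
    using M1.bounded_positive_expectation[OF bp1] c by (auto simp: bounded_positive_def p_def)
  have bf: "bounded_positive (M1 \<Otimes>\<^sub>M M2) c b (\<lambda>(x, y). f x y)"
    using b c by (auto simp: bounded_positive_def space_pair_measure)
  note pint = P.bounded_positive_integrable[OF bf]
  have i1: "integrable (M1 \<Otimes>\<^sub>M M2) (\<lambda>(x, y). f x y)" and i2:
      "integrable (M1 \<Otimes>\<^sub>M M2) (\<lambda>(x, y). f x y * ln (f x y))"
    using pint by (simp_all add: case_prod_unfold)
  have bfp: "bounded_positive (M1 \<Otimes>\<^sub>M M2) c b (\<lambda>(x, y). p y)"
    using bpp by (auto simp: bounded_positive_def space_pair_measure)
  have i3: "integrable (M1 \<Otimes>\<^sub>M M2) (\<lambda>(x, y). f x y * ln (p y))"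
    using P.Ent_variational(2)[OF bf bfp] by (simp add: case_prod_unfold)
  define m where "m = (\<integral>y. p y \<partial>M2)"
  have m: "(\<integral>x. \<integral>y. f x y \<partial>M2 \<partial>M1) = m"
    unfolding m_def p_def by (rule P.Fubini_integral[OF i1, symmetric])
  have L: "(\<integral>x. \<integral>y. f x y * ln (f x y) \<partial>M2 \<partial>M1) = (\<integral>y. \<integral>x. f x y * ln (f x y) \<partial>M1 \<partial>M2)"
    by (rule P.Fubini_integral[OF i2, symmetric])
  have ii2: "integrable M2 (\<lambda>y. \<integral>x. f x y * ln (f x y) \<partial>M1)"
    by (rule P.integrable_snd[OF i2])
  note pi = M2.bounded_positive_integrable[OF bpp]
  (* Chain rule for the entropy. *)
  have E1: "(\<integral>y. Ent M1 (\<lambda>x. f x y) \<partial>M2) = (\<integral>y. \<integral>x. f x y * ln (f x y) \<partial>M1 \<partial>M2) - (\<integral>y. p y * ln (p y) \<partial>M2)"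
    unfolding Ent_def p_def[symmetric] using ii2 pi by simp
  have "(\<integral>x. (\<integral>y. f x y * ln (p y) \<partial>M2) - (\<integral>y. f x y \<partial>M2) * ln m \<partial>M1) \<le> (\<integral>x. Ent M2 (f x) \<partial>M1)"
  proof (rule integral_mono)
    show "integrable M1 (\<lambda>x. (\<integral>y. f x y * ln (p y) \<partial>M2) - (\<integral>y. f x y \<partial>M2) * ln m)"
      using P.integrable_fst[OF i3] P.integrable_fst[OF i1] by simp
    show "integrable M1 (\<lambda>x. Ent M2 (f x))"
    proof (rule M1.integrable_const_bound[of _ "2 * entropy_bound c b"])
      show "AE x in M1. norm (Ent M2 (f x)) \<le> 2 * entropy_bound c b"
        using M2.abs_Ent_le[OF bp2] by (auto intro!: AE_I2)
    qed (unfold Ent_def, measurable)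
    show "(\<integral>y. f x y * ln (p y) \<partial>M2) - (\<integral>y. f x y \<partial>M2) * ln m \<le> Ent M2 (f x)" if "x \<in> space M1" for x
      using M2.Ent_variational(1)[OF bp2[OF that] bpp] by (simp add: m_def)
  qed
  also have "(\<integral>x. (\<integral>y. f x y * ln (p y) \<partial>M2) - (\<integral>y. f x y \<partial>M2) * ln m \<partial>M1)
     = (\<integral>x. \<integral>y. f x y * ln (p y) \<partial>M2 \<partial>M1) - m * ln m"
    using P.integrable_fst[OF i3] P.integrable_fst[OF i1] by (simp add: m)
  also have "(\<integral>x. \<integral>y. f x y * ln (p y) \<partial>M2 \<partial>M1) = (\<integral>y. \<integral>x. f x y * ln (p y) \<partial>M1 \<partial>M2)"
    by (rule P.Fubini_integral[OF i3, symmetric])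
  also have "\<dots> = (\<integral>y. p y * ln (p y) \<partial>M2)"
    unfolding p_def by simp
  finally show ?thesis unfolding m L E1 by simp
qed

theorem Ent_PiM_le:
  assumes \<mu>: "prob_space \<mu>" and "finite I" and g: "bounded_positive (PiM I (\<lambda>_. \<mu>)) c b g"
  shows "Ent (PiM I (\<lambda>_. \<mu>)) g \<le> (\<integral>x. (\<Sum>i\<in>I. Ent \<mu> (\<lambda>y. g (x(i := y)))) \<partial>PiM I (\<lambda>_. \<mu>))"
  using assms(2,3)
proof (induction I arbitrary: g rule: finite_induct)
  case empty
  interpret product_prob_space "\<lambda>_. \<mu>" by (rule product_prob_spaceI) (rule \<mu>)
  show ?case by (simp add: Ent_def PiM_empty lebesgue_integral_count_space_finite)
next
  case (insert i I)
  interpret U: prob_space \<mu> by fact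
  interpret product_prob_space "\<lambda>_. \<mu>" by (rule product_prob_spaceI) (rule \<mu>)
  let ?P = "PiM I (\<lambda>_. \<mu>)" and ?Q = "PiM (insert i I) (\<lambda>_. \<mu>)"
  interpret R: prob_space ?P by (rule prob_space_PiM[OF \<mu>])
  interpret Q: prob_space ?Q by (rule prob_space_PiM[OF \<mu>])
  interpret PP: pair_prob_space ?P \<mu> ..
  have c: "0 < c" and gm[measurable]: "g \<in> borel_measurable ?Q"
    and gb: "\<And>x. x \<in> space ?Q \<Longrightarrow> c \<le> g x \<and> g x \<le> b" using insert.prems by (auto simp: bounded_positive_def)
  define f where "f x y = g (x(i := y))" for x y
  have fm[measurable]: "(\<lambda>(x, y). f x y) \<in> borel_measurable (?P \<Otimes>\<^sub>M \<mu>)"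
    unfolding f_def using measurable_compose[OF measurable_add_dim gm] by (simp add: case_prod_unfold)
  have upd: "x(i := y) \<in> space ?Q" if "x \<in> space ?P" "y \<in> space \<mu>" for x y
    using that by (auto simp: space_PiM PiE_iff extensional_def)
  have fb: "c \<le> f x y \<and> f x y \<le> b" if "x \<in> space ?P" "y \<in> space \<mu>" for x y
    unfolding f_def by (intro gb upd that)
  define h where "h j x = Ent \<mu> (\<lambda>z. g (x(j := z)))" for j x
  have bj: "bounded_positive \<mu> c b (\<lambda>z. g (x(j := z)))" if "j \<in> insert i I" "x \<in> space ?Q" for j x
  proof -
    have "(\<lambda>z. x(j := z)) \<in> measurable \<mu> (PiM (insert j (insert i I)) (\<lambda>_. \<mu>))"
      using measurable_compose[OF measurable_Pair1'[OF that(2)] measurable_add_dim[where i = j and I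
          = "insert i I" and M = "\<lambda>_. \<mu>"]]
      by (simp only: prod.case)
    moreover have "insert j (insert i I) = insert i I" using that(1) by auto
    ultimately have m: "(\<lambda>z. x(j := z)) \<in> measurable \<mu> ?Q" by (simp only:)
    show ?thesis
      using c measurable_compose[OF m gm] gb measurable_space[OF m] by (auto simp: bounded_positive_def)
  qed
  have hb: "\<bar>h j x\<bar> \<le> 2 * entropy_bound c b" if "j \<in> insert i I" "x \<in> space ?Q" for j x
    unfolding h_def by (rule U.abs_Ent_le[OF bj[OF that]])
  have hm[measurable]: "h j \<in> borel_measurable ?Q" if "j \<in> insert i I" for j
  proof -
    have "(\<lambda>(x, z). x(j := z)) \<in> measurable (?Q \<Otimes>\<^sub>M \<mu>) (PiM (insert j (insert i I)) (\<lambda>_. \<mu>))"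
      by (rule measurable_add_dim)
    moreover have "insert j (insert i I) = insert i I" using that by auto
    ultimately have "(\<lambda>(x, z). x(j := z)) \<in> measurable (?Q \<Otimes>\<^sub>M \<mu>) ?Q" by (simp only:)
    from measurable_compose[OF this gm]
    have [measurable]: "(\<lambda>(x, z). g (x(j := z))) \<in> borel_measurable (?Q \<Otimes>\<^sub>M \<mu>)"
        by (simp add: case_prod_unfold)
    show ?thesis unfolding h_def Ent_def by measurable
  qed
  have hi: "integrable ?Q (h j)" if "j \<in> insert i I" for j
    by (rule Q.integrable_const_bound[of _ "2 * entropy_bound c b"]) (use hb hm that in \<open>auto intro!: AE_I2\<close>)
  have gi: "integrable ?Q g" "integrable ?Q (\<lambda>x. g x * ln (g x))"
    by (rule Q.bounded_positive_integrable[OF insert.prems])+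
  have hpm[measurable]: "(\<lambda>(x, y). h j (x(i := y))) \<in> borel_measurable (?P \<Otimes>\<^sub>M \<mu>)" if "j \<in> insert i I" for j
    using measurable_compose[OF measurable_add_dim hm[OF that]] by (simp add: case_prod_unfold)
  have hpi: "integrable (?P \<Otimes>\<^sub>M \<mu>) (\<lambda>(x, y). \<Sum>j\<in>I. h j (x(i := y)))"
  proof (rule PP.P.integrable_const_bound[of _ "\<Sum>j\<in>I. 2 * entropy_bound c b"])
    show "AE z in ?P \<Otimes>\<^sub>M \<mu>. norm (case z of (x, y) \<Rightarrow> \<Sum>j\<in>I. h j (x(i := y))) \<le> (\<Sum>j\<in>I. 2 * entropy_bound c b)"
      using hb upd by (auto intro!: AE_I2 order_trans[OF sum_abs] sum_mono simp: space_pair_measure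
          simp del: sum_constant)
    show "(\<lambda>(x, y). \<Sum>j\<in>I. h j (x(i := y))) \<in> borel_measurable (?P \<Otimes>\<^sub>M \<mu>)"
      using hpm by (simp add: case_prod_unfold)
  qed
  have "Ent ?Q g = (\<integral>x. \<integral>y. f x y * ln (f x y) \<partial>\<mu> \<partial>?P) - (\<integral>x. \<integral>y. f x y \<partial>\<mu> \<partial>?P) * ln (\<integral>x. \<integral>y. f x y \<partial>\<mu> \<partial>?P)"
    unfolding Ent_def f_def
    using product_integral_insert[OF insert.hyps(1,2) gi(1)] product_integral_insert[OF
        insert.hyps(1,2) gi(2)] by simp
  also have "\<dots> \<le> (\<integral>y. Ent ?P (\<lambda>x. f x y) \<partial>\<mu>) + (\<integral>x. Ent \<mu> (f x) \<partial>?P)"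
    by (rule Ent_pair_le[OF R.prob_space_axioms \<mu> c fm fb])
  finally have split: "Ent ?Q g \<le> (\<integral>y. Ent ?P (\<lambda>x. f x y) \<partial>\<mu>) + (\<integral>x. Ent \<mu> (f x) \<partial>?P)" .
  have "(\<integral>y. Ent ?P (\<lambda>x. f x y) \<partial>\<mu>) \<le> (\<integral>y. \<integral>x. (\<Sum>j\<in>I. h j (x(i := y))) \<partial>?P \<partial>\<mu>)"
  proof (rule integral_mono)
    have bp1: "bounded_positive ?P c b (\<lambda>x. f x y)" if "y \<in> space \<mu>" for y
      using that fb c measurable_compose[OF measurable_Pair2'[OF that] fm]
          by (auto simp: bounded_positive_def)
    have f2[measurable]: "(\<lambda>(y, x). f x y) \<in> borel_measurable (\<mu> \<Otimes>\<^sub>M ?P)"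
      using measurable_pair_swap[OF fm] by (simp add: case_prod_unfold)
    show "integrable \<mu> (\<lambda>y. Ent ?P (\<lambda>x. f x y))"
    proof (rule U.integrable_const_bound[of _ "2 * entropy_bound c b"])
      show "AE y in \<mu>. norm (Ent ?P (\<lambda>x. f x y)) \<le> 2 * entropy_bound c b"
        using R.abs_Ent_le[OF bp1] by (auto intro!: AE_I2)
    qed (unfold Ent_def, measurable)
    show "integrable \<mu> (\<lambda>y. \<integral>x. (\<Sum>j\<in>I. h j (x(i := y))) \<partial>?P)"
      by (rule PP.integrable_snd[OF hpi])
    fix y assume y: "y \<in> space \<mu>"
    have "Ent ?P (\<lambda>x. f x y) \<le> (\<integral>x. (\<Sum>j\<in>I. Ent \<mu> (\<lambda>z. f (x(j := z)) y)) \<partial>?P)"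
      by (rule insert.IH[OF bp1[OF y]])
    also have "\<dots> = (\<integral>x. (\<Sum>j\<in>I. h j (x(i := y))) \<partial>?P)"
    proof -
      have "x(j := z, i := y) = x(i := y, j := z)" if "j \<in> I" for x j z
        using that insert.hyps(2) by (intro fun_upd_twist) auto
      then show ?thesis unfolding f_def h_def by (intro Bochner_Integration.integral_cong sum.cong refl) simp
    qed
    finally show "Ent ?P (\<lambda>x. f x y) \<le> (\<integral>x. (\<Sum>j\<in>I. h j (x(i := y))) \<partial>?P)" .
  qed
  also have "(\<integral>y. \<integral>x. (\<Sum>j\<in>I. h j (x(i := y))) \<partial>?P \<partial>\<mu>) = (\<integral>x. \<integral>y. (\<Sum>j\<in>I. h j (x(i := y))) \<partial>\<mu> \<partial>?P)"
    by (rule PP.Fubini_integral[OF hpi])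
  also have "\<dots> = (\<integral>x. (\<Sum>j\<in>I. h j x) \<partial>?Q)"
    by (intro product_integral_insert[symmetric] insert.hyps Bochner_Integration.integrable_sum hi) auto
  finally have first: "(\<integral>y. Ent ?P (\<lambda>x. f x y) \<partial>\<mu>) \<le> (\<integral>x. (\<Sum>j\<in>I. h j x) \<partial>?Q)" .
  have second: "(\<integral>x. Ent \<mu> (f x) \<partial>?P) = (\<integral>x. h i x \<partial>?Q)"
  proof -
    have "(\<integral>x. h i x \<partial>?Q) = (\<integral>x. \<integral>y. h i (x(i := y)) \<partial>\<mu> \<partial>?P)"
      by (intro product_integral_insert insert.hyps hi) auto
    also have "\<dots> = (\<integral>x. Ent \<mu> (f x) \<partial>?P)" by (simp add: h_def f_def[abs_def] U.prob_space)
    finally show ?thesis by simp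
  qed
  have "(\<integral>x. (\<Sum>j\<in>I. h j x) \<partial>?Q) + (\<integral>x. h i x \<partial>?Q) = (\<integral>x. (\<Sum>j\<in>insert i I. h j x) \<partial>?Q)"
    using insert.hyps hi by (simp add: Bochner_Integration.integrable_sum)
  with split first second have "Ent ?Q g \<le> (\<integral>x. (\<Sum>j\<in>insert i I. h j x) \<partial>?Q)" by linarith
  then show ?case unfolding h_def .
qed

text \<open>Replacing one coordinate by an independent copy does not change the law of the vector.\<close>
lemma integral_PiM_resample:
  fixes h :: "('i \<Rightarrow> 'a) \<Rightarrow> real"
  assumes \<mu>: "prob_space \<mu>" and I: "finite I" "i \<in> I"
    and h[measurable]: "h \<in> borel_measurable (PiM I (\<lambda>_. \<mu>))" and B: "\<And>x. x \<in> space (PiM I (\<lambda>_. \<mu>))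
        \<Longrightarrow> \<bar>h x\<bar> \<le> B"
  shows "integrable (PiM I (\<lambda>_. \<mu>)) (\<lambda>x. \<integral>y. h (x(i := y)) \<partial>\<mu>)"
    and "(\<integral>x. (\<integral>y. h (x(i := y)) \<partial>\<mu>) \<partial>PiM I (\<lambda>_. \<mu>)) = (\<integral>x. h x \<partial>PiM I (\<lambda>_. \<mu>))"
proof -
  interpret U: prob_space \<mu> by fact
  interpret PS: product_prob_space "\<lambda>_. \<mu>" by (rule product_prob_spaceI) (rule \<mu>)
  let ?Q = "PiM I (\<lambda>_. \<mu>)"
  have Q: "prob_space ?Q" by (rule prob_space_PiM[OF \<mu>])
  note Q_integrable = finite_measure.integrable_const_bound[OF prob_space.axioms(1)[OF Q]]
  (* Integrating the i-th coordinate last, over a function that no longer depends on it. *)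
  define J where "J = I - {i}"
  have J: "I = insert i J" "finite J" "i \<notin> J" using I by (auto simp: J_def)
  have upd: "x(i := y) \<in> space ?Q" if "x \<in> space ?Q" "y \<in> space \<mu>" for x y
    using that I by (auto simp: space_PiM PiE_iff extensional_def)
  have ii: "insert i I = I" using I by auto
  have [measurable]: "(\<lambda>(x, y). x(i := y)) \<in> measurable (?Q \<Otimes>\<^sub>M \<mu>) ?Q"
    using measurable_add_dim[of i I "\<lambda>_. \<mu>"] unfolding ii .
  have hm: "(\<lambda>(x, y). h (x(i := y))) \<in> borel_measurable (?Q \<Otimes>\<^sub>M \<mu>)"
    using measurable_compose[OF \<open>(\<lambda>(x, y). x(i := y)) \<in> measurable (?Q \<Otimes>\<^sub>M \<mu>) ?Q\<close> h]
        by (simp add: case_prod_unfold)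
  have hx: "(\<lambda>y. h (x(i := y))) \<in> borel_measurable \<mu>" if "x \<in> space ?Q" for x
    using measurable_compose[OF measurable_Pair1'[OF that] hm] by (simp only: prod.case)
  have hi: "integrable ?Q h"
    by (rule Q_integrable[where B = B]) (use B in \<open>auto intro!: AE_I2\<close>)
  have kb: "\<bar>\<integral>y. h (x(i := y)) \<partial>\<mu>\<bar> \<le> B" if "x \<in> space ?Q" for x
  proof -
    have int: "integrable \<mu> (\<lambda>y. h (x(i := y)))"
      by (rule U.integrable_const_bound[of _ B]) (use B upd that hx in \<open>auto intro!: AE_I2\<close>)
    have "\<bar>\<integral>y. h (x(i := y)) \<partial>\<mu>\<bar> \<le> (\<integral>y. \<bar>h (x(i := y))\<bar> \<partial>\<mu>)" by (rule integral_abs_bound)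
    also have "\<dots> \<le> (\<integral>y. B \<partial>\<mu>)" using int B upd that by (intro integral_mono) auto
    finally show ?thesis by (simp add: U.prob_space)
  qed
  have km: "(\<lambda>x. \<integral>y. h (x(i := y)) \<partial>\<mu>) \<in> borel_measurable ?Q"
    using hm by (rule U.borel_measurable_lebesgue_integral)
  show ki: "integrable ?Q (\<lambda>x. \<integral>y. h (x(i := y)) \<partial>\<mu>)"
    by (rule Q_integrable[where B = B]) (use kb km in \<open>auto intro!: AE_I2\<close>)
  have "(\<integral>x. (\<integral>y. h (x(i := y)) \<partial>\<mu>) \<partial>?Q) = (\<integral>x. \<integral>z. (\<integral>y. h (x(i := z, i := y)) \<partial>\<mu>) \<partial>\<mu> \<partial>PiM J (\<lambda>_. \<mu>))"
    using PS.product_integral_insert[OF J(2,3), folded J(1), OF ki] .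
  also have "\<dots> = (\<integral>x. \<integral>y. h (x(i := y)) \<partial>\<mu> \<partial>PiM J (\<lambda>_. \<mu>))" by (simp add: U.prob_space)
  also have "\<dots> = (\<integral>x. h x \<partial>?Q)"
    using PS.product_integral_insert[OF J(2,3), folded J(1), OF hi] by simp
  finally show "(\<integral>x. (\<integral>y. h (x(i := y)) \<partial>\<mu>) \<partial>?Q) = (\<integral>x. h x \<partial>?Q)" .
qed

section \<open>The Herbst argument\<close>

lemma abs_exp_minus_linear_le:
  fixes u :: real
  assumes "\<bar>u\<bar> \<le> 1"
  shows "\<bar>exp u - 1 - u\<bar> \<le> u\<^sup>2"
proof (cases "0 \<le> u")
  case True
  have "0 \<le> exp u - 1 - u" using exp_ge_add_one_self[of u] by linarith
  moreover have "exp u - 1 - u \<le> u\<^sup>2" using exp_bound[of u] True assms by linarith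
  ultimately show ?thesis by (simp only: abs_of_nonneg)
next
  case False
  define v where "v = - u"
  have v: "0 < v" "v \<le> 1" using False assms by (auto simp: v_def)
  have "exp (- v) \<le> 1 / (1 + v)"
    using exp_ge_add_one_self[of v] v by (simp add: exp_minus field_simps)
  also have "\<dots> \<le> 1 - v + v\<^sup>2"
  proof -
    have "(1 - v + v\<^sup>2) * (1 + v) = 1 + v ^ 3" by (simp add: power2_eq_square power3_eq_cube algebra_simps)
    then show ?thesis using v by (simp add: pos_divide_le_eq)
  qed
  finally have "exp u - 1 - u \<le> u\<^sup>2" by (simp add: v_def)
  moreover have "0 \<le> exp u - 1 - u" using exp_ge_add_one_self[of u] by linarith
  ultimately show ?thesis by (simp only: abs_of_nonneg)
qed

lemma (in prob_space) exp_moment_DERIV: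
  fixes G :: "'a \<Rightarrow> real"
  assumes G[measurable]: "G \<in> borel_measurable M" and B: "\<And>x. x \<in> space M \<Longrightarrow> \<bar>G x\<bar> \<le> B"
  shows "((\<lambda>l. \<integral>x. exp (l * G x) \<partial>M) has_real_derivative (\<integral>x. G x * exp (l * G x) \<partial>M)) (at l)"
proof -
  let ?Z = "\<lambda>l. \<integral>x. exp (l * G x) \<partial>M" and ?Z' = "\<lambda>l. \<integral>x. G x * exp (l * G x) \<partial>M"
  define B' where "B' = max B 1"
  have B': "\<bar>G x\<bar> \<le> B'" if "x \<in> space M" for x using B[OF that] by (simp add: B'_def)
  have B'1: "1 \<le> B'" by (simp add: B'_def)
  have lG: "\<bar>l * G x\<bar> \<le> \<bar>l\<bar> * B'" if "x \<in> space M" for x l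
    using B'[OF that] by (simp add: abs_mult mult_left_mono)
  have i1: "integrable M (\<lambda>x. exp (l * G x))" for l
    by (rule integrable_const_bound[of _ "exp (\<bar>l\<bar> * B')"]) (use lG in \<open>auto intro!: AE_I2 simp: abs_le_iff\<close>)
  have i2: "integrable M (\<lambda>x. G x * exp (l * G x))" for l
  proof (rule integrable_const_bound[of _ "B' * exp (\<bar>l\<bar> * B')"])
    show "AE x in M. norm (G x * exp (l * G x)) \<le> B' * exp (\<bar>l\<bar> * B')"
    proof (rule AE_I2)
      fix x assume x: "x \<in> space M"
      have "exp (l * G x) \<le> exp (\<bar>l\<bar> * B')" using lG[OF x, of l] by simp
      then have "\<bar>G x\<bar> * exp (l * G x) \<le> B' * exp (\<bar>l\<bar> * B')"
        using B'[OF x] B'1 by (intro mult_mono) auto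
      then show "norm (G x * exp (l * G x)) \<le> B' * exp (\<bar>l\<bar> * B')" by (simp add: abs_mult)
    qed
  qed measurable
  define E where "E = exp (\<bar>l\<bar> * B')"
  have key: "norm ((?Z (l + h) - ?Z l) / h - ?Z' l)
      \<le> norm h * (B'\<^sup>2 * E)" if h: "h \<noteq> 0" "\<bar>h\<bar> < 1 / B'" for h
  proof -
    have hG: "\<bar>h * G x\<bar> \<le> 1" if "x \<in> space M" for x
    proof -
      have "\<bar>h * G x\<bar> \<le> \<bar>h\<bar> * B'" by (rule lG[OF that])
      also have "\<dots> \<le> 1 / B' * B'" using h B'1 by (intro mult_right_mono) auto
      finally show ?thesis using B'1 by simp
    qed
    have "\<bar>?Z (l + h) - ?Z l - h * ?Z' l\<bar>
        = \<bar>\<integral>x. exp ((l + h) * G x) - exp (l * G x) - h * (G x * exp (l * G x)) \<partial>M\<bar>"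
      using i1 i2 by simp
    also have "\<dots> \<le> (\<integral>x. \<bar>exp ((l + h) * G x) - exp (l * G x) - h * (G x * exp (l * G x))\<bar> \<partial>M)"
      by (rule integral_abs_bound)
    also have "\<dots> \<le> (\<integral>x. h\<^sup>2 * B'\<^sup>2 * E \<partial>M)"
    proof (rule integral_mono)
      fix x assume x: "x \<in> space M"
      have "exp ((l + h) * G x) - exp (l * G x) - h * (G x * exp (l * G x))
          = (exp (h * G x) - 1 - h * G x) * exp (l * G x)"
        by (simp add: exp_add distrib_right algebra_simps)
      also have "\<bar>\<dots>\<bar> \<le> (h * G x)\<^sup>2 * E"
        unfolding abs_mult using abs_exp_minus_linear_le[OF hG[OF x]] lG[OF x, of l]
        by (intro mult_mono) (auto simp: E_def abs_le_iff)
      also have "\<dots> \<le> h\<^sup>2 * B'\<^sup>2 * E"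
        unfolding power_mult_distrib using B'[OF x] B'1
        by (intro mult_right_mono mult_left_mono) (auto simp: E_def abs_le_square_iff[symmetric])
      finally show "\<bar>exp ((l + h) * G x) - exp (l * G x) - h * (G x * exp (l * G x))\<bar> \<le> h\<^sup>2 * B'\<^sup>2 * E" .
    qed (use i1 i2 in auto)
    finally have *: "\<bar>?Z (l + h) - ?Z l - h * ?Z' l\<bar>
       \<le> \<bar>h\<bar> * (\<bar>h\<bar> * (B'\<^sup>2 * E))" by (simp add: prob_space power2_eq_square mult.assoc)
    have "(?Z (l + h) - ?Z l) / h - ?Z' l
      = (?Z (l + h) - ?Z l - h * ?Z' l) / h"
      using h by (simp add: diff_divide_distrib)
    also have "\<bar>\<dots>\<bar> \<le> \<bar>h\<bar> * (B'\<^sup>2 * E)"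
      unfolding abs_divide using * h by (subst pos_divide_le_eq) (auto simp: mult.commute)
    finally show ?thesis by simp
  qed
  have "((\<lambda>h. (?Z (l + h) - ?Z l) / h - ?Z' l) \<longlongrightarrow> 0) (at 0)"
  proof (rule tendsto_0_le[of "\<lambda>h. h"])
    show "((\<lambda>h::real. h) \<longlongrightarrow> 0) (at 0)" by (rule tendsto_ident_at)
    show "\<forall>\<^sub>F h in at 0. norm ((?Z (l + h) - ?Z l) / h - ?Z' l)
        \<le> norm h * (B'\<^sup>2 * E)"
      unfolding eventually_at using key B'1 by (intro exI[of _ "1 / B'"]) (auto simp: dist_real_def)
  qed
  then show ?thesis unfolding DERIV_def by (rule LIM_zero_cancel)
qed

text \<open>
  With \<open>Z l = \<integral> exp (l G)\<close>, the entropy of \<open>exp (l G)\<close> is \<open>l Z' l - Z l ln (Z l)\<close>, that is, \<open>l\<^sup>2 Z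
  l\<close> times the derivative of \<open>ln (Z l) / l\<close>. So this quotient has slope at most \<open>K\<close>, and it tends
  to \<open>\<integral> G\<close> at \<open>0\<close>.
\<close>
lemma (in prob_space) Herbst_argument:
  fixes G :: "'a \<Rightarrow> real"
  assumes G[measurable]: "G \<in> borel_measurable M" and B: "\<And>x. x \<in> space M \<Longrightarrow> \<bar>G x\<bar> \<le> B"
    and l0: "0 < l0" and ent: "\<And>l. 0 < l \<Longrightarrow> l \<le> l0
        \<Longrightarrow> Ent M (\<lambda>x. exp (l * G x)) \<le> K * l\<^sup>2 * (\<integral>x. exp (l * G x) \<partial>M)"
  shows "(\<integral>x. exp (l0 * G x) \<partial>M) \<le> exp (l0 * (\<integral>x. G x \<partial>M) + K * l0\<^sup>2)"
proof -
  define Z where "Z l = (\<integral>x. exp (l * G x) \<partial>M)" for l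
  define Z' where "Z' l = (\<integral>x. G x * exp (l * G x) \<partial>M)" for l
  have der: "(Z has_real_derivative Z' l) (at l)" for l
    unfolding Z_def Z'_def by (rule exp_moment_DERIV[OF G B])
  have Zpos: "0 < Z l" for l
  proof -
    have "\<bar>l * G x\<bar> \<le> \<bar>l\<bar> * \<bar>B\<bar>" if "x \<in> space M" for x
      using B[OF that] by (simp add: abs_mult mult_left_mono)
    then have lb: "- (\<bar>l\<bar> * \<bar>B\<bar>) \<le> l * G x \<and> l * G x \<le> \<bar>l\<bar> * \<bar>B\<bar>" if "x \<in> space M" for x
      using that by (simp add: abs_le_iff) (meson minus_le_iff)
    have "bounded_positive M (exp (- (\<bar>l\<bar> * \<bar>B\<bar>))) (exp (\<bar>l\<bar> * \<bar>B\<bar>)) (\<lambda>x. exp (l * G x))"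
      using lb by (auto simp: bounded_positive_def)
    from bounded_positive_expectation(1)[OF this] show ?thesis unfolding Z_def
        by (rule less_le_trans[OF exp_gt_zero])
  qed
  have Z0: "Z 0 = 1" "Z' 0 = (\<integral>x. G x \<partial>M)" by (simp_all add: Z_def Z'_def prob_space)
  have lnder: "((\<lambda>l. ln (Z l)) has_real_derivative Z' l / Z l) (at l)" for l
    using DERIV_chain2[OF DERIV_ln[OF Zpos] der, of l] by (simp add: divide_inverse mult.commute)
  have ineq: "l * Z' l - Z l * ln (Z l) \<le> K * l\<^sup>2 * Z l" if "0 < l" "l \<le> l0" for l
  proof -
    have "Ent M (\<lambda>x. exp (l * G x)) = l * Z' l - Z l * ln (Z l)"
      by (simp add: Ent_def Z_def Z'_def algebra_simps flip: integral_mult_right_zero)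
    then show ?thesis using ent[OF that] by (simp add: Z_def)
  qed
  have mono: "ln (Z l0) / l0 - K * l0 \<le> ln (Z l) / l - K * l" if l: "0 < l" "l \<le> l0" for l
  proof (rule DERIV_nonpos_imp_nonincreasing[OF l(2)])
    fix u assume u: "l \<le> u" "u \<le> l0"
    have u0: "0 < u" using u l by simp
    have "((\<lambda>l. ln (Z l) / l - K * l) has_real_derivative (Z' u / Z u * u - ln (Z u) * 1) / (u * u)
        - K) (at u)"
      using DERIV_diff[OF DERIV_divide[OF lnder DERIV_ident] DERIV_cmult_Id] u0 by simp
    moreover have "(Z' u / Z u * u - ln (Z u) * 1) / (u * u) - K \<le> 0"
    proof -
      have "(u * Z' u - Z u * ln (Z u)) / Z u \<le> K * u\<^sup>2"
        using ineq[OF u0 u(2)] Zpos by (simp add: pos_divide_le_eq)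
      then have "Z' u / Z u * u - ln (Z u) \<le> K * u\<^sup>2" using Zpos[of u]
          by (simp add: diff_divide_distrib mult.commute)
      then show ?thesis using u0 by (simp add: pos_divide_le_eq power2_eq_square)
    qed
    ultimately show "\<exists>y. ((\<lambda>l. ln (Z l) / l - K * l) has_real_derivative y) (at u) \<and> y \<le> 0" by blast
  qed
  have "((\<lambda>h. ln (Z h) / h) \<longlongrightarrow> (\<integral>x. G x \<partial>M)) (at 0)"
    using lnder[of 0] unfolding has_field_derivative_iff by (simp add: Z0)
  then have "((\<lambda>h. ln (Z h) / h - K * h) \<longlongrightarrow> (\<integral>x. G x \<partial>M) - K * 0) (at_right 0)"
    by (intro tendsto_intros) (auto intro: tendsto_mono[OF at_le])
  moreover have "\<forall>\<^sub>F h in at_right 0. ln (Z l0) / l0 - K * l0 \<le> ln (Z h) / h - K * h"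
    using mono l0 by (auto simp: eventually_at_right_field intro!: exI[of _ l0])
  ultimately have "ln (Z l0) / l0 - K * l0 \<le> (\<integral>x. G x \<partial>M) - K * 0"
    by (intro tendsto_lowerbound) auto
  then have "ln (Z l0) / l0 \<le> (\<integral>x. G x \<partial>M) + K * l0" by simp
  then have "ln (Z l0) \<le> ((\<integral>x. G x \<partial>M) + K * l0) * l0"
    using l0 by (simp only: pos_divide_le_eq)
  then have "ln (Z l0) \<le> l0 * (\<integral>x. G x \<partial>M) + K * l0\<^sup>2"
    by (simp add: power2_eq_square algebra_simps)
  then have "exp (ln (Z l0)) \<le> exp (l0 * (\<integral>x. G x \<partial>M) + K * l0\<^sup>2)" by simp
  also have "exp (ln (Z l0)) = Z l0" using Zpos[of l0] by simp
  finally show ?thesis by (simp only: Z_def)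
qed

section \<open>A smooth cost adapted to the enlargement\<close>

text \<open>
  Jensen's inequality for \<open>t powr q\<close> and weights of total mass at most \<open>1\<close>; missing mass sits at
  \<open>0\<close>. The tangent line at \<open>m\<close> is Young's inequality, which also covers \<open>m = 0\<close>.
\<close>
lemma powr_weighted_sum_le:
  fixes v \<theta> :: "'a \<Rightarrow> real"
  assumes "finite D" "\<And>a. a \<in> D \<Longrightarrow> 0 \<le> v a" "(\<Sum>a\<in>D. v a) \<le> 1" "\<And>a. a \<in> D \<Longrightarrow> 0 \<le> \<theta> a" "1 < q"
  shows "(\<Sum>a\<in>D. v a * \<theta> a) powr q \<le> (\<Sum>a\<in>D. v a * \<theta> a powr q)"
proof -
  define m where "m = (\<Sum>a\<in>D. v a * \<theta> a)"
  have m: "0 \<le> m" unfolding m_def using assms by (intro sum_nonneg) auto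
  have young: "q * (m powr (q - 1) * t) - (q - 1) * m powr q \<le> t powr q" if "0 \<le> t" for t
  proof -
    have "t * m powr (q - 1) \<le> t powr q / q + (m powr (q - 1)) powr (q / (q - 1)) / (q / (q - 1))"
      using that assms(5) by (intro Youngs_inequality) (auto simp: field_simps)
    also have "(m powr (q - 1)) powr (q / (q - 1)) = m powr q" using assms(5) by (simp add: powr_powr)
    finally have "q * (t * m powr (q - 1)) \<le> q * (t powr q / q + m powr q / (q / (q - 1)))"
      using assms(5) by (intro mult_left_mono) auto
    also have "\<dots> = t powr q + (q - 1) * m powr q" using assms(5) by (simp add: field_simps)
    finally show ?thesis by (simp add: mult.commute)
  qed
  have mm: "m powr (q - 1) * m = m powr q"
    using m assms(5) by (cases "m = 0") (simp_all add: powr_diff)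
  have "m powr q \<le> q * m powr q - (q - 1) * ((\<Sum>a\<in>D. v a) * m powr q)"
  proof -
    have "(\<Sum>a\<in>D. v a) * m powr q \<le> m powr q" using assms(3)
        by (intro mult_left_le_one_le) (auto intro: sum_nonneg assms(2))
    then have "(q - 1) * ((\<Sum>a\<in>D. v a) * m powr q) \<le> (q - 1) * m powr q" using assms(5)
        by (intro mult_left_mono) auto
    then show ?thesis by (simp add: algebra_simps)
  qed
  also have "\<dots> = q * (m powr (q - 1) * (\<Sum>a\<in>D. v a * \<theta> a)) - (q - 1) * ((\<Sum>a\<in>D. v a) * m powr q)"
    unfolding m_def[symmetric] mm ..
  also have "\<dots> = (\<Sum>a\<in>D. v a * (q * (m powr (q - 1) * \<theta> a) - (q - 1) * m powr q))"
    by (simp add: sum_distrib_left sum_distrib_right sum_subtractf right_diff_distrib mult_ac)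
  also have "\<dots> \<le> (\<Sum>a\<in>D. v a * \<theta> a powr q)"
    using assms by (intro sum_mono mult_left_mono young) auto
  finally show ?thesis by (simp add: m_def)
qed

lemma H_weighted_sum_le:
  fixes v \<theta> :: "'a \<Rightarrow> real"
  assumes "finite D" "\<And>a. a \<in> D \<Longrightarrow> 0 \<le> v a" "(\<Sum>a\<in>D. v a) \<le> 1" "\<And>a. a \<in> D \<Longrightarrow> 0 \<le> \<theta> a" "1 < q"
  shows "H q (\<Sum>a\<in>D. v a * \<theta> a) \<le> (\<Sum>a\<in>D. v a * H q (\<theta> a))"
proof -
  let ?m = "\<Sum>a\<in>D. v a * \<theta> a"
  have m: "0 \<le> ?m" using assms by (intro sum_nonneg) auto
  have "?m\<^sup>2 = ?m powr 2" using m by (simp add: powr_numeral)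
  also have "\<dots> \<le> (\<Sum>a\<in>D. v a * \<theta> a powr 2)" by (rule powr_weighted_sum_le) (use assms in auto)
  also have "\<dots> \<le> (\<Sum>a\<in>D. v a * H q (\<theta> a))"
    using assms by (intro sum_mono mult_left_mono) (auto simp: H_def powr_numeral)
  finally have 1: "?m\<^sup>2 \<le> (\<Sum>a\<in>D. v a * H q (\<theta> a))" .
  have "?m powr q \<le> (\<Sum>a\<in>D. v a * \<theta> a powr q)" by (rule powr_weighted_sum_le) (use assms in auto)
  also have "\<dots> \<le> (\<Sum>a\<in>D. v a * H q (\<theta> a))"
    using assms by (intro sum_mono mult_left_mono) (auto simp: H_def)
  finally show ?thesis using 1 m by (simp add: H_def)
qed

lemma H_mono: "0 \<le> t \<Longrightarrow> t \<le> t' \<Longrightarrow> 0 < q \<Longrightarrow> H q t \<le> H q t'"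
  unfolding H_def by (intro max.mono power_mono powr_mono2) auto

lemma H_nonneg: "0 \<le> H q t"
  by (simp add: H_def le_max_iff_disj)

lemma H_scale:
  assumes "0 \<le> l" "0 \<le> t" "l\<^sup>2 \<le> \<Lambda>" "l powr q \<le> \<Lambda>"
  shows "H q (l * t) \<le> \<Lambda> * H q t"
proof -
  have "0 \<le> \<Lambda>" using assms(3) by (rule order_trans[OF zero_le_power2])
  moreover have "l\<^sup>2 * t\<^sup>2 \<le> \<Lambda> * max (t\<^sup>2) (t powr q)" "l powr q * t powr q \<le> \<Lambda> * max (t\<^sup>2) (t powr q)"
    using assms \<open>0 \<le> \<Lambda>\<close> by (auto intro!: mult_mono)
  ultimately show ?thesis using assms by (simp add: H_def power_mult_distrib powr_mult)
qed

text \<open>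
  The cost as a function of the squared distance. The shift by \<open>1\<close> makes it smooth at the origin;
  it behaves like \<open>(r / 2) s\<close> for small \<open>s\<close> and like \<open>s powr (r / 2)\<close> for large \<open>s\<close>.
\<close>
definition cost :: "real \<Rightarrow> real \<Rightarrow> real" where
  "cost r s = (1 + s) powr (r / 2) - 1"

text \<open>Half the length of the gradient of \<open>z \<mapsto> cost r |z|\<^sup>2\<close> at distance \<open>u\<close> from the origin.\<close>
definition cost_slope :: "real \<Rightarrow> real \<Rightarrow> real" where
  "cost_slope r u = r / 2 * u * (1 + u\<^sup>2) powr (r / 2 - 1)"

text \<open>
  Concavity of \<open>t powr (r / 2)\<close>: the increment from \<open>1\<close> to \<open>1 + s\<close> is at least \<open>s\<close> times the
  derivative at the right end. Both comparisons of the cost below start from this bound.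
\<close>
lemma cost_ge_tangent:
  assumes r: "1 < r" "r < 2" and s: "0 \<le> s"
  shows "r / 2 * (s * (1 + s) powr (r / 2 - 1)) \<le> cost r s"
proof -
  let ?p = "r / 2"
  have "1 powr (1 - ?p) * (1 / (1 + s)) powr ?p \<le> (1 - ?p) * 1 + ?p * (1 / (1 + s))"
    using r s by (intro Youngs_inequality_0) auto
  then have "1 / (1 + s) powr ?p \<le> 1 - ?p * (s / (1 + s))"
    using s by (simp add: powr_divide field_simps)
  then have "(1 + s) powr ?p * (1 / (1 + s) powr ?p) \<le> (1 + s) powr ?p * (1 - ?p * (s / (1 + s)))"
    by (intro mult_left_mono) auto
  then have "1 \<le> (1 + s) powr ?p - ?p * (s * ((1 + s) powr ?p / (1 + s)))"
    using s by (simp add: right_diff_distrib mult_ac)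
  then show ?thesis using s by (simp add: cost_def powr_diff)
qed

lemma cost_nonneg: "1 < r \<Longrightarrow> r < 2 \<Longrightarrow> 0 \<le> s \<Longrightarrow> 0 \<le> cost r s"
  by (rule order_trans[OF _ cost_ge_tangent]) auto

lemma cost_lower_bound:
  assumes r: "1 < r" "r < 2" and u: "0 \<le> u"
  shows "7 / 20 * r * min (u\<^sup>2) (u powr r) \<le> cost r (u\<^sup>2)"
proof -
  (* 1 + u\<^sup>2 is at most twice the larger of 1 and u\<^sup>2, which costs this factor. *)
  have c: "7 / 10 \<le> 2 powr (r / 2 - 1)"
  proof -
    have "(7 / 10)\<^sup>2 \<le> (1 / 2 :: real)" by (simp add: power2_eq_square)
    then have "7 / 10 \<le> sqrt (1 / 2)" by (rule real_le_rsqrt)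
    also have "\<dots> = 2 powr (- 1 / 2)" by (simp add: powr_minus_divide powr_half_sqrt real_sqrt_divide)
    also have "\<dots> \<le> 2 powr (r / 2 - 1)" using r by (intro powr_mono) auto
    finally show ?thesis .
  qed
  have "7 / 10 * min (u\<^sup>2) (u powr r) \<le> u\<^sup>2 * (1 + u\<^sup>2) powr (r / 2 - 1)"
  proof (cases "u \<le> 1")
    case True
    have "7 / 10 * min (u\<^sup>2) (u powr r) \<le> u\<^sup>2 * (7 / 10)" by simp
    also have "\<dots> \<le> u\<^sup>2 * 2 powr (r / 2 - 1)" using c by (intro mult_left_mono) auto
    also have "\<dots> \<le> u\<^sup>2 * (1 + u\<^sup>2) powr (r / 2 - 1)"
      using u True r by (intro mult_left_mono powr_mono2') (auto simp: power_le_one add_pos_nonneg)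
    finally show ?thesis .
  next
    case False
    have "7 / 10 * min (u\<^sup>2) (u powr r) \<le> (7 / 10) * u powr r" by simp
    also have "\<dots> \<le> 2 powr (r / 2 - 1) * u powr r" using c by (intro mult_right_mono) auto
    also have "2 powr (r / 2 - 1) * u powr r = 2 powr (r / 2 - 1) * (u\<^sup>2 * (u\<^sup>2) powr (r / 2 - 1))"
    proof -
      have "u\<^sup>2 * (u\<^sup>2) powr (r / 2 - 1) = u powr 2 * (u powr 2) powr (r / 2 - 1)" using False
          by (simp add: powr_numeral)
      also have "\<dots> = u powr (2 + 2 * (r / 2 - 1))" by (simp only: powr_powr powr_add)
      finally show ?thesis by simp
    qed
    also have "2 powr (r / 2 - 1) * (u\<^sup>2 * (u\<^sup>2) powr (r / 2 - 1)) = u\<^sup>2 * (2 * u\<^sup>2) powr (r / 2 - 1)"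
      by (simp add: powr_mult)
    also have "\<dots> \<le> u\<^sup>2 * (1 + u\<^sup>2) powr (r / 2 - 1)"
      using u False r by (intro mult_left_mono powr_mono2') (auto simp: one_le_power add_pos_nonneg)
    finally show ?thesis .
  qed
  then have "r / 2 * (7 / 10 * min (u\<^sup>2) (u powr r)) \<le> r / 2 * (u\<^sup>2 * (1 + u\<^sup>2) powr (r / 2 - 1))"
    using r by (intro mult_left_mono) auto
  also have "\<dots> \<le> cost r (u\<^sup>2)" by (rule cost_ge_tangent[OF r]) simp
  finally show ?thesis by simp
qed

text \<open>
  Put \<open>w = 1 + u\<^sup>2\<close>, \<open>p = r / 2\<close> and \<open>X = u\<^sup>2 w powr (p - 1)\<close>; by the tangent bound it is enough
  that both terms in the maximum are at most \<open>p\<^sup>2 X\<close>. The square is \<open>p\<^sup>2 X\<close> times a power of \<open>w\<close>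
  with negative exponent. For the power \<open>q\<close>, conjugacy gives \<open>(p - 1) q = (p - 1) - \<alpha>\<close> with \<open>\<alpha> = q
  / 2 - 1\<close>, so that the excess factor is \<open>(u\<^sup>2 / w) powr \<alpha> \<le> 1\<close>, and \<open>p powr q \<le> p\<^sup>2\<close>.
\<close>
lemma H_cost_slope:
  assumes r: "1 < r" "r < 2" and u: "0 \<le> u"
  shows "H (conj_exponent r) (cost_slope r u) \<le> r / 2 * cost r (u\<^sup>2)"
proof (cases "u = 0")
  case True
  then show ?thesis using r by (simp add: H_def cost_slope_def cost_def conj_exponent_def)
next
  case False
  define q where "q = conj_exponent r"
  define p where "p = r / 2"
  define w where "w = 1 + u\<^sup>2"
  have w: "1 < w" "u\<^sup>2 < w" using False by (auto simp: w_def)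
  have q: "2 < q" using r by (simp add: q_def conj_exponent_def field_simps)
  have p: "0 < p" "p < 1" using r by (auto simp: p_def)
  have u0: "0 < u" using u False by simp
  have X: "p\<^sup>2 * (u\<^sup>2 * w powr (p - 1)) \<le> p * cost r (u\<^sup>2)"
    using mult_left_mono[OF cost_ge_tangent[OF r, of "u\<^sup>2"], of p] p
    by (simp add: p_def w_def power2_eq_square mult.assoc)
  have sl: "cost_slope r u = p * u * w powr (p - 1)" by (simp add: cost_slope_def p_def w_def)
  have "(cost_slope r u)\<^sup>2 \<le> p\<^sup>2 * (u\<^sup>2 * w powr (p - 1))"
  proof -
    have "w powr (p - 1) \<le> w powr 0" using w p by (intro powr_mono) auto
    then have "p\<^sup>2 * (u\<^sup>2 * w powr (p - 1)) * w powr (p - 1) \<le> p\<^sup>2 * (u\<^sup>2 * w powr (p - 1)) * 1"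
      using w by (intro mult_left_mono) auto
    moreover have "(cost_slope r u)\<^sup>2 = p\<^sup>2 * (u\<^sup>2 * w powr (p - 1)) * w powr (p - 1)"
      by (simp add: sl power2_eq_square mult_ac)
    ultimately show ?thesis by simp
  qed
  moreover have "cost_slope r u powr q \<le> p\<^sup>2 * (u\<^sup>2 * w powr (p - 1))"
  proof -
    define \<alpha> where "\<alpha> = q / 2 - 1"
    have \<alpha>: "0 < \<alpha>" using q by (simp add: \<alpha>_def)
    have e: "(p - 1) * q = (p - 1) - \<alpha>"
      using r by (simp add: \<alpha>_def p_def q_def conj_exponent_def field_simps)
    have "cost_slope r u powr q = p powr q * (u powr q * w powr ((p - 1) * q))"
      using p u0 w by (simp add: sl powr_mult powr_powr mult.assoc)
    also have "\<dots> \<le> p powr 2 * (u powr q * w powr ((p - 1) * q))"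
      using p q by (intro mult_right_mono powr_mono') auto
    also have "u powr q = u\<^sup>2 * (u\<^sup>2) powr \<alpha>"
    proof -
      have "u\<^sup>2 * (u\<^sup>2) powr \<alpha> = u powr 2 * (u powr 2) powr \<alpha>" using u0 by (simp add: powr_numeral)
      also have "\<dots> = u powr (2 + 2 * \<alpha>)" by (simp only: powr_powr powr_add)
      finally show ?thesis by (simp add: \<alpha>_def)
    qed
    also have "u\<^sup>2 * (u\<^sup>2) powr \<alpha> * w powr ((p - 1) * q) = u\<^sup>2 * w powr (p - 1) * ((u\<^sup>2) powr \<alpha> / w powr \<alpha>)"
      using w by (simp add: e powr_diff)
    also have "\<dots> \<le> u\<^sup>2 * w powr (p - 1) * 1"
      using w \<alpha> by (intro mult_left_mono) (auto simp: divide_le_eq intro!: powr_mono2)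
    finally show ?thesis using p by (simp add: powr_numeral mult_left_mono)
  qed
  moreover have "0 \<le> cost_slope r u" using r u by (simp add: cost_slope_def)
  ultimately show ?thesis using X by (simp add: H_def q_def p_def)
qed

lemma smooth_Rd_cost:
  "smooth_Rd d (\<lambda>y. exp (- (\<beta> * cost r ((enorm d (\<lambda>j. y j - b j))\<^sup>2))))"
proof -
  have "smooth_Rd d (\<lambda>y. exp ((- \<beta>) * ((1 + (enorm d (\<lambda>j. y j - b j))\<^sup>2) powr (r / 2) + - 1)))"
    by (intro smooth_Rd_exp smooth_Rd_mult smooth_Rd_const smooth_Rd_add smooth_Rd_powr
        smooth_Rd_sq_dist) (simp add: add_pos_nonneg)
  then show ?thesis by (simp add: cost_def)
qed

lemma grad_norm_exp_cost:
  assumes r: "1 < r" "r < 2" and x: "x \<in> Rd d" and \<beta>: "0 \<le> \<beta>"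
  shows "grad_norm d (\<lambda>y. exp (- (\<beta> * cost r ((enorm d (\<lambda>j. y j - b j))\<^sup>2)))) x
    = 2 * \<beta> * cost_slope r (enorm d (\<lambda>j. x j - b j)) * exp (- (\<beta> * cost r ((enorm d (\<lambda>j. x j - b j))\<^sup>2)))"
proof -
  let ?u = "enorm d (\<lambda>j. x j - b j)"
  have "((\<lambda>s. exp (- (\<beta> * cost r s))) has_real_derivative
     exp (- (\<beta> * cost r (?u\<^sup>2))) * - (\<beta> * (r / 2 * (1 + ?u\<^sup>2) powr (r / 2 - 1)))) (at (?u\<^sup>2))"
    unfolding cost_def using add_pos_nonneg[of 1 "?u\<^sup>2"]
    by (auto intro!: derivative_eq_intros)
  from grad_norm_comp[OF smooth_Rd_sq_dist x this]
  show ?thesis using r \<beta> by (simp add: grad_norm_sq_dist[OF x] cost_slope_def abs_mult)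
qed

section \<open>The soft minimum of the cost over a finite set\<close>

text \<open>
  The set \<open>D\<close> is a finite net, \<open>s\<close> the level at which the cost is truncated, and \<open>\<beta>\<close> the inverse
  temperature. The truncation is the additional term \<open>exp (- \<beta> s)\<close> in the partition sum: it is a
  further competitor of constant cost \<open>s\<close>.
\<close>
locale soft_minimum =
  fixes d n :: nat and r \<beta> s :: real and D :: "(nat \<Rightarrow> nat \<Rightarrow> real) set" and \<mu> :: "(nat \<Rightarrow> real) measure"
  assumes r: "1 < r" "r < 2" and \<beta>: "0 < \<beta>" and s: "0 < s" and D: "finite D" and \<mu>: "prob_measure_on d \<mu>"
begin

abbreviation P :: "(nat \<Rightarrow> nat \<Rightarrow> real) measure" where "P \<equiv> power_measure \<mu> n"

definition euclid_dist :: "(nat \<Rightarrow> real) \<Rightarrow> (nat \<Rightarrow> real) \<Rightarrow> real" where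
  "euclid_dist y b = enorm d (\<lambda>j. y j - b j)"

definition total_cost :: "(nat \<Rightarrow> nat \<Rightarrow> real) \<Rightarrow> (nat \<Rightarrow> nat \<Rightarrow> real) \<Rightarrow> real" where
  "total_cost x a = (\<Sum>i<n. cost r ((euclid_dist (x i) (a i))\<^sup>2))"

definition partition_sum :: "(nat \<Rightarrow> nat \<Rightarrow> real) \<Rightarrow> real" where
  "partition_sum x = exp (- (\<beta> * s)) + (\<Sum>a\<in>D. exp (- (\<beta> * total_cost x a)))"

definition softmin :: "(nat \<Rightarrow> nat \<Rightarrow> real) \<Rightarrow> real" where
  "softmin x = - (ln (partition_sum x) / \<beta>)"

definition weight :: "(nat \<Rightarrow> nat \<Rightarrow> real) \<Rightarrow> (nat \<Rightarrow> nat \<Rightarrow> real) \<Rightarrow> real" where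
  "weight a x = exp (- (\<beta> * total_cost x a)) / partition_sum x"

lemma \<mu>_prob: "prob_space \<mu>" using \<mu> by (simp add: prob_measure_on_def)

lemma space_\<mu>: "space \<mu> = Rd d" by (rule prob_measure_on_space[OF \<mu>])

lemma P_prob: "prob_space P" unfolding power_measure_def by (rule prob_space_PiM[OF \<mu>_prob])

lemma euclid_dist_nonneg: "0 \<le> euclid_dist y b" by (simp add: euclid_dist_def enorm_nonneg)

lemma total_cost_nonneg: "0 \<le> total_cost x a"
  unfolding total_cost_def by (intro sum_nonneg cost_nonneg r) simp

lemma cost_le_total_cost: "i < n \<Longrightarrow> cost r ((euclid_dist (x i) (a i))\<^sup>2) \<le> total_cost x a"
  unfolding total_cost_def by (rule member_le_sum) (auto intro: cost_nonneg r)

lemma partition_sum_pos: "0 < partition_sum x"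
  unfolding partition_sum_def by (intro add_pos_nonneg sum_nonneg) auto

lemma partition_sum_ge: "exp (- (\<beta> * s)) \<le> partition_sum x" "a \<in> D
    \<Longrightarrow> exp (- (\<beta> * total_cost x a)) \<le> partition_sum x"
proof -
  show "exp (- (\<beta> * s)) \<le> partition_sum x" unfolding partition_sum_def by (simp add: sum_nonneg)
  assume "a \<in> D"
  then have "exp (- (\<beta> * total_cost x a)) \<le> (\<Sum>a\<in>D. exp (- (\<beta> * total_cost x a)))"
    using D by (intro member_le_sum) auto
  then show "exp (- (\<beta> * total_cost x a)) \<le> partition_sum x" unfolding partition_sum_def
      using exp_gt_zero[of "- (\<beta> * s)"] by linarith
qed

lemma partition_sum_le: "partition_sum x \<le> real (card D) + 1"
proof -
  have "(\<Sum>a\<in>D. exp (- (\<beta> * total_cost x a))) \<le> (\<Sum>a\<in>D. 1)"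
    using \<beta> total_cost_nonneg by (intro sum_mono) auto
  also have "\<dots> = real (card D)" by simp
  moreover have "exp (- (\<beta> * s)) \<le> 1" using \<beta> s by simp
  ultimately show ?thesis unfolding partition_sum_def by linarith
qed

lemma softmin_le: "softmin x \<le> s" "a \<in> D \<Longrightarrow> softmin x \<le> total_cost x a"
proof -
  have "softmin x \<le> t" if "exp (- (\<beta> * t)) \<le> partition_sum x" for t
  proof -
    have "- (\<beta> * t) \<le> ln (partition_sum x)" using that partition_sum_pos by (simp add: ln_ge_iff)
    then show ?thesis using \<beta> by (simp add: softmin_def field_simps)
  qed
  then show "softmin x \<le> s" "a \<in> D \<Longrightarrow> softmin x \<le> total_cost x a" using partition_sum_ge by auto
qed

definition softmin_bound :: real where "softmin_bound = max s (ln (real (card D) + 1) / \<beta>)"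

lemma abs_softmin_le: "\<bar>softmin x\<bar> \<le> softmin_bound"
proof -
  have "ln (partition_sum x) \<le> ln (real (card D) + 1)" using partition_sum_le partition_sum_pos by simp
  then have "- softmin x \<le> ln (real (card D) + 1) / \<beta>" using \<beta> by (simp add: softmin_def divide_right_mono)
  then show ?thesis using softmin_le(1)[of x] by (auto simp: softmin_bound_def abs_le_iff)
qed

lemma exp_softmin: "exp (l * softmin x) = partition_sum x powr (- (l / \<beta>))"
  using partition_sum_pos[of x] by (simp add: softmin_def powr_def)

lemma weight_nonneg: "0 \<le> weight a x"
  using partition_sum_pos[of x] by (simp add: weight_def)

lemma sum_weight_le: "(\<Sum>a\<in>D. weight a x) \<le> 1"
proof -
  have "(\<Sum>a\<in>D. exp (- (\<beta> * total_cost x a))) \<le> partition_sum x" by (simp add: partition_sum_def)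
  then show ?thesis using partition_sum_pos[of x] by (simp add: weight_def flip: sum_divide_distrib)
qed

text \<open>
  A net point whose cost exceeds \<open>s\<close> by \<open>t\<close> has weight at most \<open>exp (- \<beta> t)\<close>, and \<open>t exp (- \<beta> t) \<le>
  1 / \<beta>\<close>.
\<close>
lemma sum_weight_total_cost_le: "(\<Sum>a\<in>D. weight a x * total_cost x a) \<le> s + card D / \<beta>"
proof -
  have "weight a x * (total_cost x a - s) \<le> 1 / \<beta>" for a
  proof (cases "total_cost x a \<le> s")
    case True
    then have "weight a x * (total_cost x a - s) \<le> 0" by (intro mult_nonneg_nonpos weight_nonneg) simp
    also have "0 \<le> 1 / \<beta>" using \<beta> by simp
    finally show ?thesis .
  next
    case False
    define t where "t = total_cost x a - s"
    have t: "0 < t" using False by (simp add: t_def)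
    have "weight a x \<le> exp (- (\<beta> * total_cost x a)) / exp (- (\<beta> * s))"
      unfolding weight_def using partition_sum_ge(1) partition_sum_pos[of x] by (intro divide_left_mono) auto
    also have "\<dots> = exp (- (\<beta> * t))" by (simp add: t_def algebra_simps flip: exp_diff)
    finally have "weight a x * t \<le> exp (- (\<beta> * t)) * t" using t by (intro mult_right_mono) auto
    also have "\<dots> \<le> 1 / \<beta>"
    proof -
      have "\<beta> * t \<le> exp (\<beta> * t)" using exp_ge_add_one_self[of "\<beta> * t"] by linarith
      then show ?thesis using \<beta> by (simp add: exp_minus field_simps)
    qed
    finally show ?thesis by (simp add: t_def)
  qed
  then have "(\<Sum>a\<in>D. weight a x * (total_cost x a - s)) \<le> (\<Sum>a\<in>D. 1 / \<beta>)" by (intro sum_mono)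
  moreover have "(\<Sum>a\<in>D. weight a x) * s \<le> 1 * s" using sum_weight_le s by (intro mult_right_mono) auto
  ultimately show ?thesis by (simp add: right_diff_distrib sum_subtractf sum_distrib_right)
qed

lemma euclid_dist_measurable: "i < n \<Longrightarrow> (\<lambda>x. euclid_dist (x i) b) \<in> borel_measurable P"
proof -
  assume i: "i < n"
  have "(\<lambda>x. x j) \<in> borel_measurable \<mu>" if "j < d" for j
    using that by (intro borel_measurable_smooth_Rd[OF \<mu>] smooth_Rd_coord)
  moreover have "(\<lambda>x. x i) \<in> measurable P \<mu>"
    unfolding power_measure_def using i by (intro measurable_component_singleton) auto
  ultimately have c: "(\<lambda>x. x i j) \<in> borel_measurable P" if "j < d" for j
    using measurable_compose that by blast
  have [measurable]: "(\<lambda>x. \<Sum>j<d. (x i j - b j)\<^sup>2) \<in> borel_measurable P"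
    by (intro borel_measurable_sum borel_measurable_power borel_measurable_diff borel_measurable_const c) auto
  show ?thesis unfolding euclid_dist_def enorm_def L2_set_def by measurable
qed

lemma cost_measurable: "i < n \<Longrightarrow> (\<lambda>x. cost r ((euclid_dist (x i) b)\<^sup>2)) \<in> borel_measurable P"
  unfolding cost_def using euclid_dist_measurable[of i b] by measurable

lemma total_cost_measurable[measurable]: "(\<lambda>x. total_cost x a) \<in> borel_measurable P"
  unfolding total_cost_def by (intro borel_measurable_sum cost_measurable) auto

lemma partition_sum_measurable[measurable]: "partition_sum \<in> borel_measurable P"
  unfolding partition_sum_def by measurable

lemma softmin_measurable[measurable]: "softmin \<in> borel_measurable P"
  unfolding softmin_def by measurable

lemma weight_measurable[measurable]: "weight a \<in> borel_measurable P"
  unfolding weight_def by measurable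

text \<open>
  Up to a constant factor, this bounds \<open>H q (|\<nabla>\<^sub>i f| / f) f\<^sup>2\<close> for \<open>f = exp (l softmin / 2)\<close>; its
  sum over \<open>i\<close> involves the total cost only.
\<close>
definition local_energy :: "real \<Rightarrow> nat \<Rightarrow> (nat \<Rightarrow> nat \<Rightarrow> real) \<Rightarrow> real" where
  "local_energy l i x = (\<Sum>a\<in>D. weight a x * cost r ((euclid_dist (x i) (a i))\<^sup>2)) * exp (l * softmin x)"

lemma local_energy_measurable: "i < n \<Longrightarrow> local_energy l i \<in> borel_measurable P"
proof -
  assume i: "i < n"
  have "(\<lambda>x. \<Sum>a\<in>D. weight a x * cost r ((euclid_dist (x i) (a i))\<^sup>2)) \<in> borel_measurable P"
    using i by (intro borel_measurable_sum borel_measurable_times cost_measurable weight_measurable)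
  then show ?thesis unfolding local_energy_def by measurable
qed

lemma sum_weight_cost_le: "i < n \<Longrightarrow> (\<Sum>a\<in>D. weight a x * cost r ((euclid_dist (x i) (a i))\<^sup>2)) \<le> s + card D / \<beta>"
  by (rule order_trans[OF sum_mono sum_weight_total_cost_le[of x]]) (intro mult_left_mono
      cost_le_total_cost weight_nonneg)

lemma sum_weight_cost_nonneg: "0 \<le> (\<Sum>a\<in>D. weight a x * cost r ((euclid_dist (x i) (a i))\<^sup>2))"
  by (intro sum_nonneg mult_nonneg_nonneg weight_nonneg cost_nonneg r) simp

lemma local_energy_nonneg: "0 \<le> local_energy l i x"
  unfolding local_energy_def by (intro mult_nonneg_nonneg sum_weight_cost_nonneg) simp

lemma exp_softmin_bounds: "exp (- (\<bar>l\<bar> * softmin_bound)) \<le> exp (l * softmin x)" "exp (l * softmin x)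
    \<le> exp (\<bar>l\<bar> * softmin_bound)"
proof -
  have "\<bar>l * softmin x\<bar> \<le> \<bar>l\<bar> * softmin_bound" using abs_softmin_le[of x]
      by (simp add: abs_mult mult_left_mono)
  then show "exp (- (\<bar>l\<bar> * softmin_bound)) \<le> exp (l * softmin x)" "exp (l * softmin x)
      \<le> exp (\<bar>l\<bar> * softmin_bound)" by auto
qed

lemma local_energy_le: "i < n \<Longrightarrow> local_energy l i x \<le> (s + card D / \<beta>) * exp (\<bar>l\<bar> * softmin_bound)"
  unfolding local_energy_def using s \<beta> by (intro mult_mono sum_weight_cost_le exp_softmin_bounds) auto

lemma sum_local_energy_le: "(\<Sum>i<n. local_energy l i x) \<le> (s + card D / \<beta>) * exp (l * softmin x)"
proof -
  have "(\<Sum>i<n. local_energy l i x) = (\<Sum>a\<in>D. weight a x * total_cost x a) * exp (l * softmin x)"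
    unfolding local_energy_def total_cost_def sum_distrib_right[symmetric] sum_distrib_left
    by (subst sum.swap) simp
  also have "\<dots> \<le> (s + card D / \<beta>) * exp (l * softmin x)"
    by (intro mult_right_mono sum_weight_total_cost_le) simp
  finally show ?thesis .
qed

lemma upd_measurable: "x \<in> space P \<Longrightarrow> i < n \<Longrightarrow> (\<lambda>y. x(i := y)) \<in> measurable \<mu> P"
proof -
  assume x: "x \<in> space P" and i: "i < n"
  have "insert i {..<n} = {..<n}" using i by auto
  then show ?thesis
    using measurable_compose[OF measurable_Pair1'[OF x[unfolded power_measure_def]]
        measurable_add_dim[of i "{..<n}" "\<lambda>_. \<mu>"]]
    unfolding power_measure_def by (simp only: prod.case)
qed

text \<open>
  The modified log-Sobolev inequality in the \<open>i\<close>-th block, for \<open>f = exp (l softmin / 2)\<close>, which is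
  a power of the partition sum. By the triangle inequality \<open>|\<nabla>\<^sub>i f| / f\<close> is at most \<open>l\<close> times the
  weighted mean of the cost slopes; convexity of \<open>H q\<close> moves the mean outside, and \<open>H_cost_slope\<close>
  returns to the cost.
\<close>
lemma coordinate_entropy:
  assumes mLSI: "modified_log_Sobolev d r C \<mu>" and C: "0 < C"
    and x: "x \<in> space P" and i: "i < n" and l: "0 < l" "l\<^sup>2 \<le> \<Lambda>" "l powr conj_exponent r \<le> \<Lambda>"
  shows "Ent \<mu> (\<lambda>y. exp (l * softmin (x(i := y)))) \<le> C * \<Lambda> * (r / 2) * (\<integral>y. local_energy l i (x(i := y)) \<partial>\<mu>)"
proof -
  interpret prob_space \<mu> by (rule \<mu>_prob)
  define q where "q = conj_exponent r"
  have q: "2 < q" using r by (simp add: q_def conj_exponent_def field_simps)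
  have \<Lambda>: "0 \<le> \<Lambda>" using l(2) by (rule order_trans[OF zero_le_power2])
  (* In the i-th block, the partition sum is a constant plus a combination of the e a with
     constant coefficients c a, which collect the costs in the other blocks. *)
  define F where "F y = partition_sum (x(i := y))" for y
  define c where "c a = exp (- (\<beta> * (\<Sum>k\<in>{..<n} - {i}. cost r ((euclid_dist (x k) (a k))\<^sup>2))))" for a ::
      "nat \<Rightarrow> nat \<Rightarrow> real"
  define e where "e a y = exp (- (\<beta> * cost r ((enorm d (\<lambda>j. y j - a i j))\<^sup>2)))" for a ::
      "nat \<Rightarrow> nat \<Rightarrow> real" and y
  have ce: "exp (- (\<beta> * total_cost (x(i := y)) a)) = c a * e a y" for a y
  proof -
    have "total_cost (x(i := y)) a
        = cost r ((euclid_dist y (a i))\<^sup>2) + (\<Sum>k\<in>{..<n}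
        - {i}. cost r ((euclid_dist ((x(i := y)) k) (a k))\<^sup>2))"
      unfolding total_cost_def using i by (subst sum.remove[of _ i]) auto
    also have "(\<Sum>k\<in>{..<n} - {i}. cost r ((euclid_dist ((x(i := y)) k) (a k))\<^sup>2))
        = (\<Sum>k\<in>{..<n} - {i}. cost r ((euclid_dist (x k) (a k))\<^sup>2))"
      by (intro sum.cong) auto
    finally have "total_cost (x(i := y)) a
        = cost r ((euclid_dist y (a i))\<^sup>2) + (\<Sum>k\<in>{..<n} - {i}. cost r ((euclid_dist (x k) (a k))\<^sup>2))" .
    then show ?thesis by (simp only: c_def e_def euclid_dist_def) (simp add: distrib_left flip: exp_add)
  qed
  have F: "F y = exp (- (\<beta> * s)) + (\<Sum>a\<in>D. c a * e a y)" for y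
    by (simp add: F_def partition_sum_def ce)
  have es: "smooth_Rd d (e a)" for a unfolding e_def by (rule smooth_Rd_cost)
  have ces: "smooth_Rd d (\<lambda>y. c a * e a y)" for a by (intro smooth_Rd_mult smooth_Rd_const es)
  have Fs: "smooth_Rd d F"
    unfolding F[abs_def] by (intro smooth_Rd_add smooth_Rd_const smooth_Rd_sum ces D)
  have Fpos: "0 < F y" for y by (simp add: F_def partition_sum_pos)
  have gradF: "grad_norm d F y \<le> 2 * \<beta> * (\<Sum>a\<in>D. c a * e a y * cost_slope r (euclid_dist y (a i)))"
      if y: "y \<in> Rd d" for y
  proof -
    have "grad_norm d F y \<le> grad_norm d (\<lambda>_. exp (- (\<beta> * s))) y + grad_norm d (\<lambda>y. \<Sum>a\<in>D. c a * e a y) y"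
      unfolding F[abs_def] by (intro grad_norm_add_le smooth_Rd_const smooth_Rd_sum ces D y)
    also have "grad_norm d (\<lambda>_. exp (- (\<beta> * s))) y = 0" by (rule grad_norm_const)
    also have "grad_norm d (\<lambda>y. \<Sum>a\<in>D. c a * e a y) y \<le> (\<Sum>a\<in>D. grad_norm d (\<lambda>y. c a * e a y) y)"
      by (intro grad_norm_sum_le ces D y)
    also have "\<dots> = (\<Sum>a\<in>D. c a * (2 * \<beta> * cost_slope r (euclid_dist y (a i)) * e a y))"
    proof (intro sum.cong refl)
      fix a
      have "((\<lambda>t. c a * t) has_real_derivative c a) (at (e a y))" by (auto intro!: derivative_eq_intros)
      from grad_norm_comp[OF es y this] have "grad_norm d (\<lambda>y. c a * e a y) y = c a * grad_norm d (e a) y"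
        by (simp add: c_def)
      also have "grad_norm d (e a) y = 2 * \<beta> * cost_slope r (euclid_dist y (a i)) * e a y"
        unfolding e_def euclid_dist_def using \<beta> by (intro grad_norm_exp_cost r y) auto
      finally show "grad_norm d (\<lambda>y. c a * e a y) y
          = c a * (2 * \<beta> * cost_slope r (euclid_dist y (a i)) * e a y)" .
    qed
    also have "\<dots> = 2 * \<beta> * (\<Sum>a\<in>D. c a * e a y * cost_slope r (euclid_dist y (a i)))"
      by (simp add: sum_distrib_left mult_ac)
    finally show ?thesis by simp
  qed
  (* This makes f the exponential of l / 2 times the soft minimum. *)
  define \<kappa> where "\<kappa> = l / (2 * \<beta>)"
  have \<kappa>: "0 < \<kappa>" using l \<beta> by (simp add: \<kappa>_def)
  define f where "f y = F y powr (- \<kappa>)" for y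
  have fs: "smooth_Rd d f" unfolding f_def by (intro smooth_Rd_powr Fs Fpos)
  have fpos: "0 < f y" for y using Fpos[of y] by (simp add: f_def)
  have f2: "(f y)\<^sup>2 = exp (l * softmin (x(i := y)))" for y
  proof -
    have "(f y)\<^sup>2 = f y powr 2" using fpos[of y] by (simp add: powr_numeral)
    also have "\<dots> = F y powr (- (l / \<beta>))" by (simp add: f_def powr_powr \<kappa>_def)
    finally show ?thesis by (simp add: exp_softmin F_def)
  qed
  have slope0: "0 \<le> cost_slope r (euclid_dist y b)" for y b using r
      by (simp add: cost_slope_def euclid_dist_nonneg)
  have ratio: "grad_norm d f y / f y
      \<le> l * (\<Sum>a\<in>D. weight a (x(i := y)) * cost_slope r (euclid_dist y (a i)))" if y: "y \<in> Rd d" for y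
  proof -
    have "((\<lambda>t. t powr (- \<kappa>)) has_real_derivative - \<kappa> * F y powr (- \<kappa> - 1)) (at (F y))"
      by (rule has_real_derivative_powr[OF Fpos])
    from grad_norm_comp[OF Fs y this] have "grad_norm d f y = \<kappa> * F y powr (- \<kappa> - 1) * grad_norm d F y"
      using \<kappa> by (simp add: f_def[abs_def] abs_mult)
    then have "grad_norm d f y / f y = \<kappa> * (grad_norm d F y / F y)"
      using Fpos[of y] by (simp add: f_def powr_diff)
    also have "\<dots> \<le> \<kappa> * (2 * \<beta> * (\<Sum>a\<in>D. c a * e a y * cost_slope r (euclid_dist y (a i))) / F y)"
      using \<kappa> Fpos[of y] gradF[OF y] by (intro mult_left_mono divide_right_mono) auto
    also have "\<dots> = l * (\<Sum>a\<in>D. weight a (x(i := y)) * cost_slope r (euclid_dist y (a i)))"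
      using \<beta> by (simp add: \<kappa>_def weight_def ce F_def sum_divide_distrib sum_distrib_left mult.assoc)
    finally show ?thesis .
  qed
  have bound: "H q (grad_norm d f y / f y) * (f y)\<^sup>2 \<le> \<Lambda> * (r / 2) * local_energy l i (x(i := y))"
      if y: "y \<in> Rd d" for y
  proof -
    let ?m = "\<Sum>a\<in>D. weight a (x(i := y)) * cost_slope r (euclid_dist y (a i))"
    have m0: "0 \<le> ?m" by (intro sum_nonneg mult_nonneg_nonneg weight_nonneg slope0)
    have "H q (grad_norm d f y / f y) \<le> H q (l * ?m)"
      using ratio[OF y] q fpos[of y] grad_norm_nonneg[of d f y] by (intro H_mono) auto
    also have "\<dots> \<le> \<Lambda> * H q ?m" using l m0 by (intro H_scale) (auto simp: q_def)
    also have "\<dots> \<le> \<Lambda> * (\<Sum>a\<in>D. weight a (x(i := y)) * H q (cost_slope r (euclid_dist y (a i))))"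
      using q by (intro mult_left_mono H_weighted_sum_le D weight_nonneg sum_weight_le slope0 \<Lambda>) auto
    also have "\<dots> \<le> \<Lambda> * (\<Sum>a\<in>D. weight a (x(i := y)) * (r / 2 * cost r ((euclid_dist y (a i))\<^sup>2)))"
      unfolding q_def by (intro mult_left_mono sum_mono weight_nonneg H_cost_slope r euclid_dist_nonneg \<Lambda>)
    also have "\<dots> = \<Lambda> * (r / 2) * (\<Sum>a\<in>D. weight a (x(i := y)) * cost r ((euclid_dist y (a i))\<^sup>2))"
      by (simp add: sum_distrib_left mult_ac)
    finally have "H q (grad_norm d f y / f y) * (f y)\<^sup>2
        \<le> \<Lambda> * (r / 2) * (\<Sum>a\<in>D. weight a (x(i := y)) * cost r ((euclid_dist y (a i))\<^sup>2)) * (f y)\<^sup>2"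
      by (intro mult_right_mono) auto
    then show ?thesis by (simp add: local_energy_def f2 mult_ac)
  qed
  have Rm: "(\<lambda>y. local_energy l i (x(i := y))) \<in> borel_measurable \<mu>"
    by (rule measurable_compose[OF upd_measurable[OF x i] local_energy_measurable[OF i]])
  have Rint: "integrable \<mu> (\<lambda>y. local_energy l i (x(i := y)))"
    by (rule integrable_const_bound[of _ "(s + card D / \<beta>) * exp (\<bar>l\<bar> * softmin_bound)"])
      (use Rm local_energy_le[OF i] local_energy_nonneg in \<open>auto intro!: AE_I2\<close>)
  have [measurable]: "f \<in> borel_measurable \<mu>" "grad_norm d f \<in> borel_measurable \<mu>"
    by (auto intro: borel_measurable_smooth_Rd[OF \<mu> fs] borel_measurable_grad_norm[OF \<mu> fs])
  have fb: "(f y)\<^sup>2 \<le> exp (\<bar>l\<bar> * softmin_bound)" for y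
    unfolding f2 by (rule exp_softmin_bounds)
  have fint: "integrable \<mu> (\<lambda>y. (f y)\<^sup>2)"
    by (rule integrable_const_bound[of _ "exp (\<bar>l\<bar> * softmin_bound)"])
      (use fb in \<open>auto intro!: AE_I2\<close>)
  have bint: "integrable \<mu> (\<lambda>y. \<Lambda> * (r / 2) * local_energy l i (x(i := y)))" using Rint by simp
  have Hint: "integrable \<mu> (\<lambda>y. H q (grad_norm d f y / f y) * (f y)\<^sup>2)"
  proof (rule Bochner_Integration.integrable_bound[OF bint])
    show "(\<lambda>y. H q (grad_norm d f y / f y) * (f y)\<^sup>2) \<in> borel_measurable \<mu>" unfolding H_def by measurable
    show "AE y in \<mu>. norm (H q (grad_norm d f y / f y) * (f y)\<^sup>2)
        \<le> norm (\<Lambda> * (r / 2) * local_energy l i (x(i := y)))"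
    proof (rule AE_I2)
      fix y assume "y \<in> space \<mu>"
      then have "H q (grad_norm d f y / f y) * (f y)\<^sup>2 \<le> \<Lambda> * (r / 2) * local_energy l i (x(i := y))"
          using bound space_\<mu> by simp
      moreover have "0 \<le> H q (grad_norm d f y / f y) * (f y)\<^sup>2" by (simp add: H_nonneg)
      ultimately show "norm (H q (grad_norm d f y / f y) * (f y)\<^sup>2)
          \<le> norm (\<Lambda> * (r / 2) * local_energy l i (x(i := y)))"
        by (simp only: real_norm_def)
    qed
  qed
  have "Ent \<mu> (\<lambda>y. (f y)\<^sup>2) \<le> C * (\<integral>y. H q (grad_norm d f y / f y) * (f y)\<^sup>2 \<partial>\<mu>)"
    using mLSI fs fpos fint Hint unfolding modified_log_Sobolev_def q_def by blast
  also have "\<dots> \<le> C * (\<integral>y. \<Lambda> * (r / 2) * local_energy l i (x(i := y)) \<partial>\<mu>)"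
    using C bound space_\<mu> by (intro mult_left_mono integral_mono Hint bint) auto
  finally show ?thesis by (simp add: f2 mult_ac)
qed

text \<open>
  Subadditivity of entropy reduces to single blocks; resampling the \<open>i\<close>-th block turns the
  iterated integrals into integrals of \<open>local_energy\<close>, whose sum over the blocks is at most a
  constant multiple of \<open>exp (l softmin)\<close>.
\<close>
lemma soft_minimum_entropy:
  assumes mLSI: "modified_log_Sobolev d r C \<mu>" and C: "0 < C"
    and l: "0 < l" "l\<^sup>2 \<le> \<Lambda>" "l powr conj_exponent r \<le> \<Lambda>"
  shows "Ent P (\<lambda>x. exp (l * softmin x)) \<le> C * \<Lambda> * (r / 2) * (s + card D / \<beta>) * (\<integral>x. exp (l * softmin x) \<partial>P)"
proof -
  interpret PP: prob_space P by (rule P_prob)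
  have \<Lambda>: "0 \<le> \<Lambda>" using l(2) by (rule order_trans[OF zero_le_power2])
  have Rb: "\<bar>local_energy l i x\<bar> \<le> (s + card D / \<beta>) * exp (\<bar>l\<bar> * softmin_bound)" if "i < n" for i x
    using local_energy_le[OF that, of l x] local_energy_nonneg[of l i x] by simp
  note res = integral_PiM_resample[OF \<mu>_prob finite_lessThan, of _ n, folded power_measure_def]
  have ri: "integrable P (\<lambda>x. \<integral>y. local_energy l i (x(i := y)) \<partial>\<mu>)" if "i < n" for i
    by (rule res(1)[OF _ local_energy_measurable Rb]) (use that in auto)
  have re: "(\<integral>x. (\<integral>y. local_energy l i (x(i := y)) \<partial>\<mu>) \<partial>P) = (\<integral>x. local_energy l i x \<partial>P)" if "i < n" for i
    by (rule res(2)[OF _ local_energy_measurable Rb]) (use that in auto)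
  have Ri: "integrable P (local_energy l i)" if "i < n" for i
    by (rule PP.integrable_const_bound[of _ "(s + card D / \<beta>) * exp (\<bar>l\<bar> * softmin_bound)"])
      (use Rb that local_energy_measurable in \<open>auto intro!: AE_I2\<close>)
  have bp: "bounded_positive P (exp (- (\<bar>l\<bar> * softmin_bound))) (exp (\<bar>l\<bar> * softmin_bound)) (\<lambda>x. exp (l
      * softmin x))"
    unfolding bounded_positive_def using exp_softmin_bounds by (auto simp del: exp_le_cancel_iff)
  have "Ent P (\<lambda>x. exp (l * softmin x)) \<le> (\<integral>x. (\<Sum>i<n. Ent \<mu> (\<lambda>y. exp (l * softmin (x(i := y))))) \<partial>P)"
    using Ent_PiM_le[OF \<mu>_prob finite_lessThan bp[unfolded power_measure_def]] unfolding power_measure_def .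
  also have "\<dots> \<le> (\<integral>x. (\<Sum>i<n. C * \<Lambda> * (r / 2) * (\<integral>y. local_energy l i (x(i := y)) \<partial>\<mu>)) \<partial>P)"
  proof (rule integral_mono')
    show "integrable P (\<lambda>x. \<Sum>i<n. C * \<Lambda> * (r / 2) * (\<integral>y. local_energy l i (x(i := y)) \<partial>\<mu>))"
      using ri by (intro Bochner_Integration.integrable_sum integrable_mult_right) auto
    show "(\<Sum>i<n. Ent \<mu> (\<lambda>y. exp (l * softmin (x(i := y)))))
        \<le> (\<Sum>i<n. C * \<Lambda> * (r / 2) * (\<integral>y. local_energy l i (x(i := y)) \<partial>\<mu>))"
      if "x \<in> space P" for x
      using that by (intro sum_mono coordinate_entropy mLSI C l) auto
    show "0 \<le> (\<Sum>i<n. C * \<Lambda> * (r / 2) * (\<integral>y. local_energy l i (x(i := y)) \<partial>\<mu>))" for x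
      using C \<Lambda> r local_energy_nonneg by (intro sum_nonneg mult_nonneg_nonneg) auto
  qed
  also have "\<dots> = C * \<Lambda> * (r / 2) * (\<Sum>i<n. \<integral>x. local_energy l i x \<partial>P)"
    using ri re by (subst Bochner_Integration.integral_sum) (auto simp: sum_distrib_left)
  also have "(\<Sum>i<n. \<integral>x. local_energy l i x \<partial>P) = (\<integral>x. (\<Sum>i<n. local_energy l i x) \<partial>P)"
    using Ri by (subst Bochner_Integration.integral_sum) auto
  also have "C * \<Lambda> * (r / 2) * \<dots> \<le> C * \<Lambda> * (r / 2) * (\<integral>x. (s + card D / \<beta>) * exp (l * softmin x) \<partial>P)"
  proof (rule mult_left_mono)
    show "(\<integral>x. (\<Sum>i<n. local_energy l i x) \<partial>P) \<le> (\<integral>x. (s + card D / \<beta>) * exp (l * softmin x) \<partial>P)"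
      using Ri PP.bounded_positive_integrable[OF bp] sum_local_energy_le by (intro integral_mono) auto
  qed (use C \<Lambda> r in auto)
  finally show ?thesis by simp
qed

lemma soft_minimum_moment:
  assumes mLSI: "modified_log_Sobolev d r C \<mu>" and C: "0 < C" and l0: "0 < l0"
  defines "\<Lambda> \<equiv> max 1 (l0 powr (conj_exponent r - 2))"
  shows "(\<integral>x. exp (l0 * softmin x) \<partial>P)
      \<le> exp (l0 * (\<integral>x. softmin x \<partial>P) + C * \<Lambda> * (r / 2) * (s + card D / \<beta>) * l0\<^sup>2)"
proof -
  interpret PP: prob_space P by (rule P_prob)
  have q: "2 < conj_exponent r" using r by (simp add: conj_exponent_def field_simps)
  show ?thesis
  proof (rule PP.Herbst_argument[OF softmin_measurable abs_softmin_le l0])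
    fix l :: real assume l: "0 < l" "l \<le> l0"
    have "l powr conj_exponent r = l\<^sup>2 * l powr (conj_exponent r - 2)"
      using l by (simp add: powr_diff powr_numeral)
    also have "\<dots> \<le> l\<^sup>2 * l0 powr (conj_exponent r - 2)"
      using l q by (intro mult_left_mono powr_mono2) auto
    also have "\<dots> \<le> l\<^sup>2 * \<Lambda>" unfolding \<Lambda>_def by (intro mult_left_mono) auto
    finally have 1: "l powr conj_exponent r \<le> l\<^sup>2 * \<Lambda>" .
    have 2: "l\<^sup>2 \<le> l\<^sup>2 * \<Lambda>" unfolding \<Lambda>_def by (simp add: mult_le_cancel_left1)
    show "Ent P (\<lambda>x. exp (l * softmin x))
        \<le> C * \<Lambda> * (r / 2) * (s + card D / \<beta>) * l\<^sup>2 * (\<integral>x. exp (l * softmin x) \<partial>P)"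
      using soft_minimum_entropy[OF mLSI C l(1) 2 1] by (simp add: mult_ac)
  qed
qed

end

section \<open>Two-level concentration\<close>

lemma measure_le_inner_measure:
  assumes "finite_measure M" "T \<in> sets M" "T \<subseteq> A"
  shows "measure M T \<le> inner_measure M A"
  unfolding inner_measure_def
proof (rule cSup_upper)
  interpret finite_measure M by fact
  show "bdd_above (measure M ` {T \<in> sets M. T \<subseteq> A})"
    by (auto intro!: bdd_aboveI2[of _ _ "measure M (space M)"] bounded_measure)
qed (use assms in auto)

lemma inner_measure_mono:
  assumes "finite_measure M" "A \<subseteq> B"
  shows "inner_measure M A \<le> inner_measure M B"
proof -
  interpret finite_measure M by fact
  show ?thesis
    unfolding inner_measure_def
  proof (rule cSUP_subset_mono)
    show "bdd_above (measure M ` {T \<in> sets M. T \<subseteq> B})"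
      by (auto intro!: bdd_aboveI2[of _ _ "measure M (space M)"] bounded_measure)
  qed (use assms in auto)
qed

context soft_minimum
begin

lemma exists_near_measurable:
  "{x \<in> space P. \<exists>a\<in>D. total_cost x a < t} \<in> sets P"
  using D by measurable

text \<open>The soft minimum is below \<open>s\<close> everywhere, and below \<open>\<delta>\<close> near the net.\<close>
lemma expectation_softmin_le:
  assumes \<delta>: "\<delta> \<le> s" and half: "1 / 2 - \<eta> \<le> measure P {x \<in> space P. \<exists>a\<in>D. total_cost x a < \<delta>}"
  shows "(\<integral>x. softmin x \<partial>P) \<le> s - (s - \<delta>) * (1 / 2 - \<eta>)"
proof -
  interpret PP: prob_space P by (rule P_prob)
  let ?A = "{x \<in> space P. \<exists>a\<in>D. total_cost x a < \<delta>}"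
  have A: "?A \<in> sets P" by (rule exists_near_measurable)
  have ii: "integrable P (\<lambda>x. indicator ?A x :: real)" using A by (simp add: PP.emeasure_eq_measure)
  have "(\<integral>x. softmin x \<partial>P) \<le> (\<integral>x. s - (s - \<delta>) * indicator ?A x \<partial>P)"
  proof (rule integral_mono)
    show "integrable P softmin"
      by (rule PP.integrable_const_bound[of _ softmin_bound]) (use abs_softmin_le in \<open>auto intro!: AE_I2\<close>)
    show "softmin x \<le> s - (s - \<delta>) * indicator ?A x" if "x \<in> space P" for x
    proof (cases "x \<in> ?A")
      case True
      then obtain a where "a \<in> D" "total_cost x a < \<delta>" by auto
      then show ?thesis using softmin_le(2)[of a x] True by simp
    qed (use softmin_le(1) in simp)
  qed (use ii in auto)
  also have "\<dots> = s - (s - \<delta>) * measure P ?A"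
    using ii A by (simp add: PP.prob_space)
  also have "\<dots> \<le> s - (s - \<delta>) * (1 / 2 - \<eta>)"
    using \<delta> half by (intro diff_left_mono mult_left_mono) auto
  finally show ?thesis .
qed

text \<open>
  Where all costs are at least \<open>s\<close>, the partition sum is at most \<open>(1 + card D) exp (- \<beta> s)\<close>, so
  the soft minimum is at least \<open>s - card D / \<beta>\<close>. The rest is Markov's inequality for its
  exponential.
\<close>
lemma soft_minimum_deviation:
  assumes l: "0 < l" and m: "(\<integral>x. exp (l * softmin x) \<partial>P) \<le> exp m"
  shows "1 - exp (m - l * (s - card D / \<beta>)) \<le> measure P {x \<in> space P. \<exists>a\<in>D. total_cost x a < s}"
proof -
  interpret PP: prob_space P by (rule P_prob)
  let ?T = "{x \<in> space P. \<exists>a\<in>D. total_cost x a < s}"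
  have T: "?T \<in> sets P" by (rule exists_near_measurable)
  define b where "b = s - card D / \<beta>"
  have Gb: "b \<le> softmin x" if "x \<in> space P - ?T" for x
  proof -
    have "exp (- (\<beta> * total_cost x a)) \<le> exp (- (\<beta> * s))" if "a \<in> D" for a
      using that \<open>x \<in> space P - ?T\<close> \<beta> by auto
    then have "(\<Sum>a\<in>D. exp (- (\<beta> * total_cost x a))) \<le> card D * exp (- (\<beta> * s))"
      by (rule sum_bounded_above)
    then have "partition_sum x \<le> (1 + real (card D)) * exp (- (\<beta> * s))"
        by (simp add: partition_sum_def algebra_simps)
    also have "\<dots> \<le> exp (real (card D)) * exp (- (\<beta> * s))"
      using exp_ge_add_one_self[of "real (card D)"] by (intro mult_right_mono) auto
    also have "\<dots> = exp (real (card D) - \<beta> * s)" by (simp flip: exp_add)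
    finally have "ln (partition_sum x) \<le> ln (exp (real (card D) - \<beta> * s))" using partition_sum_pos
        by (subst ln_le_cancel_iff) auto
    then have "ln (partition_sum x) \<le> real (card D) - \<beta> * s" by simp
    then have "\<beta> * b \<le> - ln (partition_sum x)" using \<beta> by (simp add: b_def right_diff_distrib)
    then show ?thesis using \<beta> by (simp add: softmin_def field_simps)
  qed
  have ei: "integrable P (\<lambda>x. exp (l * softmin x))"
    by (rule PP.integrable_const_bound[of _ "exp (\<bar>l\<bar> * softmin_bound)"])
      (use exp_softmin_bounds(2) in \<open>auto intro!: AE_I2 simp del: exp_le_cancel_iff\<close>)
  have ci: "integrable P (\<lambda>x. indicator (space P - ?T) x :: real)" using T
      by (simp add: PP.emeasure_eq_measure)
  have "exp (l * b) * measure P (space P - ?T) = (\<integral>x. exp (l * b) * indicator (space P - ?T) x \<partial>P)"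
    using T by simp
  also have "\<dots> \<le> (\<integral>x. exp (l * softmin x) \<partial>P)"
  proof (rule integral_mono[OF _ ei])
    show "exp (l * b) * indicator (space P - ?T) x \<le> exp (l * softmin x)" for x
      using Gb[of x] l by (cases "x \<in> space P - ?T") auto
  qed (use ci in auto)
  also note m
  finally have "measure P (space P - ?T) \<le> exp m / exp (l * b)" by (simp add: pos_le_divide_eq mult.commute)
  then show ?thesis using PP.prob_compl[OF T] by (simp add: exp_diff b_def)
qed

end

text \<open>
  The choice of the exponential parameter. It solves the equation \<open>C (r / 2) \<Lambda> l = 1 / 4\<close>, where
  \<open>\<Lambda>\<close> is the maximum: for \<open>2 C r \<ge> 1\<close> the solution is at most \<open>1\<close> and the quadratic part of \<open>H\<close>
  matters, giving \<open>1 / C\<close>; otherwise the power \<open>q\<close> matters, and \<open>(r - 1) (q - 1) = 1\<close> gives \<open>1 / C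
  powr (r - 1)\<close>.
\<close>
lemma Herbst_parameter:
  fixes C r :: real
  assumes r: "1 < r" "r < 2" and C: "0 < C"
  obtains l where "0 < l" "C * (r / 2) * max 1 (l powr (conj_exponent r - 2)) * l \<le> 1 / 4"
    "1 / 4 * min (1 / C) (1 / C powr (r - 1)) \<le> r / 2 * l"
proof (cases "1 \<le> 2 * C * r")
  case True
  define l where "l = 1 / (2 * C * r)"
  have q: "2 < conj_exponent r" using r by (simp add: conj_exponent_def field_simps)
  have l: "0 < l" "l \<le> 1" using True by (auto simp: l_def)
  have "l powr (conj_exponent r - 2) \<le> 1" using l q by (intro powr_le1) auto
  then have "max 1 (l powr (conj_exponent r - 2)) = 1" by simp
  moreover have "C * (r / 2) * 1 * l = 1 / 4" using C r by (simp add: l_def)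
  moreover have "r / 2 * l = 1 / 4 * (1 / C)" using C r by (simp add: l_def)
  ultimately show ?thesis using l(1) by (intro that[of l]) auto
next
  case False
  define w where "w = 2 * C * r"
  define q where "q = conj_exponent r"
  have w: "0 < w" "w < 1" using False C r by (auto simp: w_def)
  define l where "l = w powr (- (r - 1))"
  have q: "2 < q" using r by (simp add: q_def conj_exponent_def field_simps)
  have l: "0 < l" using w by (simp add: l_def)
  have l1: "1 \<le> l" unfolding l_def using powr_mono'[of "- (r - 1)" 0 w] w r by simp
  have "1 \<le> l powr (q - 2)" using l1 q by (simp add: ge_one_powr_ge_zero)
  then have "max 1 (l powr (q - 2)) * l = l powr (q - 2) * l powr 1" using l by (simp add: max_absorb2)
  also have "\<dots> = l powr (q - 2 + 1)" by (rule powr_add[symmetric])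
  also have "q - 2 + 1 = q - 1" by simp
  also have "l powr (q - 1) = w powr (- ((r - 1) * (q - 1)))" by (simp only: l_def powr_powr minus_mult_left)
  also have "(r - 1) * (q - 1) = 1" using r by (simp add: q_def conj_exponent_def field_simps)
  finally have e: "max 1 (l powr (q - 2)) * l = 1 / w" using w by (simp add: powr_minus_divide)
  have "C * (r / 2) * max 1 (l powr (q - 2)) * l = C * (r / 2) * (max 1 (l powr (q - 2)) * l)"
      by (simp only: mult.assoc)
  also have "\<dots> = 1 / 4" unfolding e using C r by (simp add: w_def)
  finally have 1: "C * (r / 2) * max 1 (l powr (q - 2)) * l = 1 / 4" .
  have "1 / 4 * (1 / C powr (r - 1)) \<le> r / 2 * l"
  proof -
    have "(2 * r) powr (r - 1) \<le> (2 * r) powr 1" using r by (intro powr_mono) auto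
    then have "1 / (2 * r) \<le> 1 / (2 * r) powr (r - 1)" using r by (intro divide_left_mono) auto
    then have "r / 2 * (1 / (2 * r)) \<le> r / 2 * (1 / (2 * r) powr (r - 1))" using r
        by (intro mult_left_mono) auto
    then have "1 / 4 * (1 / C powr (r - 1)) \<le> r / 2 * (1 / (2 * r) powr (r - 1)) * (1 / C powr (r - 1))"
      using r by (intro mult_right_mono) auto
    also have "\<dots> = r / 2 * (1 / (2 * C * r) powr (r - 1))" using C r by (simp add: powr_mult mult_ac)
    also have "\<dots> = r / 2 * l" by (simp only: l_def w_def powr_minus_divide)
    finally show ?thesis .
  qed
  then show ?thesis using that[OF l] 1 by (simp add: q_def min_le_iff_disj)
qed

text \<open>
  \<open>A\<close> is separable and the cost is continuous and vanishes on the diagonal, so the neighbourhoods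
  of a dense sequence in \<open>A\<close> cover \<open>A\<close>; finitely many of them already carry almost all of its
  measure.
\<close>
lemma finite_net:
  assumes \<mu>: "prob_measure_on d \<mu>" and r: "1 < r" "r < 2" and A: "A \<in> sets (power_measure \<mu> n)"
    and c: "c < measure (power_measure \<mu> n) A" and \<delta>: "0 < \<delta>"
  obtains D where "finite D" "D \<subseteq> A"
    "c \<le> measure (power_measure \<mu> n) {x \<in> space (power_measure \<mu> n). \<exists>a\<in>D. soft_minimum.total_cost d n
        r x a < \<delta>}"
proof -
  let ?P = "power_measure \<mu> n"
  interpret e: soft_minimum d n r 1 1 "{}" \<mu> using \<mu> r by unfold_locales auto
  interpret PP: prob_space ?P by (rule e.P_prob)
  show ?thesis
  proof (cases "A = {}")
    case True
    then show ?thesis using c by (intro that[of "{}"]) auto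
  next
    case False
    obtain T where T: "countable T" "T \<subseteq> A" "A \<subseteq> closure T" using separable by metis
    have Tn: "T \<noteq> {}" using False T by auto
    define a where "a = from_nat_into T"
    have aT: "range a = T" unfolding a_def using T Tn by (rule_tac range_from_nat_into) auto
    define U where "U k = {x \<in> space ?P. \<exists>b\<in>a ` {..<k}. e.total_cost x b < \<delta>}" for k
    have Us: "U k \<in> sets ?P" for k unfolding U_def by measurable
    have AU: "A \<subseteq> (\<Union>k. U k)"
    proof
      fix x assume x: "x \<in> A"
      have xs: "x \<in> space ?P" using A x sets.sets_into_space by blast
      have coord: "continuous_on UNIV (\<lambda>y::nat \<Rightarrow> nat \<Rightarrow> real. y i j)" for i j
        by (rule continuous_on_product_then_coordinatewise[OF
            continuous_on_product_then_coordinatewise[OF continuous_on_id]])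
      have pos: "1 + (\<Sum>j<d. (x i j - y i j)\<^sup>2) \<noteq> 0" for i and y :: "nat \<Rightarrow> nat \<Rightarrow> real"
        using add_pos_nonneg[of 1 "\<Sum>j<d. (x i j - y i j)\<^sup>2"] by (simp add: sum_nonneg)
      have "continuous_on UNIV (\<lambda>y. e.total_cost x y)"
        unfolding e.total_cost_def e.euclid_dist_def enorm_sq cost_def
        by (intro continuous_on_sum continuous_on_diff continuous_on_powr continuous_on_add
            continuous_on_power continuous_on_const coord ballI pos)
      then have "open {y. e.total_cost x y < \<delta>}"
        by (intro open_Collect_less continuous_intros)
      moreover have "x \<in> {y. e.total_cost x y < \<delta>}"
        using \<delta> by (simp add: e.total_cost_def e.euclid_dist_def cost_def enorm_def L2_set_def)
      moreover have "x \<in> closure T" using x T by auto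
      ultimately have "{y. e.total_cost x y < \<delta>} \<inter> T \<noteq> {}"
        using open_Int_closure_eq_empty[of "{y. e.total_cost x y < \<delta>}" T] by blast
      then obtain y where "y \<in> T" "e.total_cost x y < \<delta>" by blast
      then obtain k where "e.total_cost x (a k) < \<delta>" using aT by auto
      then have "x \<in> U (Suc k)" using xs by (auto simp: U_def)
      then show "x \<in> (\<Union>k. U k)" by blast
    qed
    have "incseq U" unfolding incseq_def U_def by fastforce
    then have lim: "(\<lambda>k. measure ?P (U k)) \<longlonglongrightarrow> measure ?P (\<Union>k. U k)"
      using Us by (intro PP.finite_Lim_measure_incseq) auto
    have "c < measure ?P (\<Union>k. U k)"
      using c PP.finite_measure_mono[OF AU] Us by (intro less_le_trans[OF c]) auto
    then obtain k where "c < measure ?P (U k)"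
      using order_tendstoD(1)[OF lim] by (auto simp: eventually_sequentially)
    then show ?thesis
      using T aT by (intro that[of "a ` {..<k}"]) (auto simp: U_def)
  qed
qed

lemma enorm_cong: "(\<And>j. j < d \<Longrightarrow> x j = y j) \<Longrightarrow> enorm d x = enorm d y"
  unfolding enorm_def by (rule L2_set_cong) auto

lemma enorm_divide: "0 < c \<Longrightarrow> enorm d (\<lambda>j. x j / c) = enorm d x / c"
  using enorm_cmult[of d "1 / c" x] by simp

lemma min_square_powr:
  fixes u r :: real
  assumes "1 < r" "r < 2" "0 \<le> u"
  shows "min (u\<^sup>2) (u powr r) = (if u \<le> 1 then u\<^sup>2 else u powr r)"
proof -
  have e: "u\<^sup>2 = u powr 2" using assms by simp
  show ?thesis
  proof (cases "u \<le> 1")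
    case True
    then have "u powr 2 \<le> u powr r" using assms by (intro powr_mono') auto
    then show ?thesis unfolding e using True by (simp only: min_absorb1 if_True)
  next
    case False
    then have "u powr r \<le> u powr 2" using assms by (intro powr_mono) auto
    then show ?thesis unfolding e using False by (simp only: min_absorb2 if_False)
  qed
qed

text \<open>
  Split a vector of the enlargement into its blocks of length at most \<open>1\<close>, where the minimum is
  the square, and the longer ones, where it is the power \<open>r\<close>.
\<close>
lemma enlargement_subset_sum_of_balls:
  assumes t: "0 < t" and r: "1 < r" "r < 2"
  shows "minkowski_sum d n A (enlargement_set d n r t) \<subseteq>
    minkowski_sum d n (minkowski_sum d n A (scale_Rdn d n (sqrt t) ` euclidean_unit_ball d n))
            (scale_Rdn d n (t powr (1 / r)) ` mixed_unit_ball d n r)"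
proof
  fix w assume "w \<in> minkowski_sum d n A (enlargement_set d n r t)"
  then obtain x z where w: "w = add_Rdn d n x z" "x \<in> A" and z: "z \<in> Rdn d n"
    "(\<Sum>i<n. min ((enorm d (z i))\<^sup>2) (enorm d (z i) powr r)) \<le> t"
    by (auto simp: minkowski_sum_def enlargement_set_def)
  define small where "small i \<longleftrightarrow> enorm d (z i) \<le> 1" for i
  define m where "m i = min ((enorm d (z i))\<^sup>2) (enorm d (z i) powr r)" for i
  have m: "m i = (if small i then (enorm d (z i))\<^sup>2 else enorm d (z i) powr r)" for i
    unfolding m_def small_def by (rule min_square_powr[OF r enorm_nonneg])
  have m0: "0 \<le> m i" for i by (simp add: m)
  have sm: "(\<Sum>i<n. m i / t) \<le> 1"
    using z(2) t by (simp add: m_def flip: sum_divide_distrib)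
  define u where "u = (\<lambda>i\<in>{..<n}. \<lambda>j\<in>{..<d}. if small i then z i j / sqrt t else 0)"
  define v where "v = (\<lambda>i\<in>{..<n}. \<lambda>j\<in>{..<d}. if small i then 0 else z i j / t powr (1 / r))"
  have tp: "0 < sqrt t" "0 < t powr (1 / r)" using t by auto
  have enu: "enorm d (u i) = (if small i then enorm d (z i) / sqrt t else 0)" if "i < n" for i
  proof (cases "small i")
    case True
    then have "enorm d (u i) = enorm d (\<lambda>j. z i j / sqrt t)" using that
        by (intro enorm_cong) (simp add: u_def)
    then show ?thesis using True enorm_divide[OF tp(1)] by simp
  next
    case False
    then have "enorm d (u i) = enorm d (\<lambda>j. 0)" using that by (intro enorm_cong) (simp add: u_def)
    then show ?thesis using False by (simp add: enorm_def L2_set_def)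
  qed
  have env: "enorm d (v i) = (if small i then 0 else enorm d (z i) / t powr (1 / r))" if "i < n" for i
  proof (cases "small i")
    case False
    then have "enorm d (v i) = enorm d (\<lambda>j. z i j / t powr (1 / r))" using that
        by (intro enorm_cong) (simp add: v_def)
    then show ?thesis using False enorm_divide[OF tp(2)] by simp
  next
    case True
    then have "enorm d (v i) = enorm d (\<lambda>j. 0)" using that by (intro enorm_cong) (simp add: v_def)
    then show ?thesis using True by (simp add: enorm_def L2_set_def)
  qed
  have "u \<in> euclidean_unit_ball d n"
  proof -
    have "(\<Sum>i<n. \<Sum>j<d. (u i j)\<^sup>2) = (\<Sum>i<n. (enorm d (u i))\<^sup>2)" by (simp add: enorm_sq)
    also have "\<dots> \<le> (\<Sum>i<n. m i / t)"
      using t by (intro sum_mono) (auto simp: enu m power_divide)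
    finally have "(\<Sum>i<n. \<Sum>j<d. (u i j)\<^sup>2) \<le> 1" using sm by simp
    then have "L2_set (\<lambda>(i, j). u i j) ({..<n} \<times> {..<d}) \<le> 1"
      by (simp add: L2_set_def sum.cartesian_product case_prod_unfold)
    moreover have "u \<in> Rdn d n" by (auto simp: u_def Rdn_def Rd_def)
    ultimately show ?thesis by (simp add: euclidean_unit_ball_def)
  qed
  moreover have "v \<in> mixed_unit_ball d n r"
  proof -
    have "enorm d (v i) powr r \<le> m i / t" if "i < n" for i
      using r t by (auto simp: env[OF that] m powr_divide powr_powr enorm_nonneg)
    then have "(\<Sum>i<n. enorm d (v i) powr r) \<le> (\<Sum>i<n. m i / t)" by (intro sum_mono) auto
    then have "(\<Sum>i<n. enorm d (v i) powr r) \<le> 1" using sm by simp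
    moreover have "0 \<le> (\<Sum>i<n. enorm d (v i) powr r)" by (intro sum_nonneg) auto
    ultimately have "(\<Sum>i<n. enorm d (v i) powr r) powr (1 / r) \<le> 1"
      using r by (intro powr_le1) auto
    moreover have "v \<in> Rdn d n" by (auto simp: v_def Rdn_def Rd_def)
    ultimately show ?thesis by (simp add: mixed_unit_ball_def)
  qed
  moreover have "w = add_Rdn d n (add_Rdn d n x (scale_Rdn d n (sqrt t) u)) (scale_Rdn d n (t powr (1 /
      r)) v)"
    unfolding w(1) add_Rdn_def scale_Rdn_def
    by (intro restrict_ext) (use tp in \<open>auto simp: u_def v_def\<close>)
  ultimately show "w \<in> minkowski_sum d n (minkowski_sum d n A (scale_Rdn d n (sqrt t) `
      euclidean_unit_ball d n))
            (scale_Rdn d n (t powr (1 / r)) ` mixed_unit_ball d n r)"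
    using w(2) unfolding minkowski_sum_def by blast
qed

lemma cost_near_subset_enlargement:
  assumes \<mu>: "prob_measure_on d \<mu>" and r: "1 < r" "r < 2" and DA: "D \<subseteq> A" "A \<subseteq> space (power_measure \<mu> n)"
  shows "{x \<in> space (power_measure \<mu> n). \<exists>a\<in>D. soft_minimum.total_cost d n r x a < 7 / 20 * r * t}
    \<subseteq> minkowski_sum d n A (enlargement_set d n r t)"
proof safe
  interpret e: soft_minimum d n r 1 1 "{}" \<mu> using \<mu> r by unfold_locales auto
  fix x a assume x: "x \<in> space (power_measure \<mu> n)" and a: "a \<in> D" and c: "e.total_cost x a < 7 / 20 * r * t"
  have sp: "space (power_measure \<mu> n) = Rdn d n"
    unfolding power_measure_def Rdn_def using e.space_\<mu> by (simp add: space_PiM)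
  define z where "z = (\<lambda>i\<in>{..<n}. \<lambda>j\<in>{..<d}. x i j - a i j)"
  have zR: "z \<in> Rdn d n" by (auto simp: z_def Rdn_def Rd_def)
  have ez: "enorm d (z i) = e.euclid_dist (x i) (a i)" if "i < n" for i
    unfolding e.euclid_dist_def using that by (intro enorm_cong) (simp add: z_def)
  have "7 / 20 * r * (\<Sum>i<n. min ((enorm d (z i))\<^sup>2) (enorm d (z i) powr r)) \<le> e.total_cost x a"
    unfolding e.total_cost_def sum_distrib_left
    by (intro sum_mono) (use ez cost_lower_bound[OF r e.euclid_dist_nonneg] in simp)
  with c have "7 / 20 * r * (\<Sum>i<n. min ((enorm d (z i))\<^sup>2) (enorm d (z i) powr r)) < 7 / 20 * r * t" by simp
  then have "(\<Sum>i<n. min ((enorm d (z i))\<^sup>2) (enorm d (z i) powr r)) \<le> t" using r by simp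
  with zR have "z \<in> enlargement_set d n r t" by (simp add: enlargement_set_def)
  moreover have "x = add_Rdn d n a z"
  proof -
    have "x \<in> Rdn d n" using x sp by simp
    then have "x = (\<lambda>i\<in>{..<n}. \<lambda>j\<in>{..<d}. x i j)"
      by (auto simp: Rdn_def Rd_def PiE_iff extensional_def fun_eq_iff)
    also have "\<dots> = add_Rdn d n a z"
      unfolding add_Rdn_def by (intro restrict_ext) (auto simp: z_def)
    finally show ?thesis .
  qed
  ultimately show "x \<in> minkowski_sum d n A (enlargement_set d n r t)"
    using a DA unfolding minkowski_sum_def by blast
qed

text \<open>
  The cost level \<open>s\<close> is such that total cost below \<open>s\<close> implies membership in the enlargement. The
  net is chosen with loss \<open>1 / 40\<close> of the measure and radius \<open>s / 40\<close>, and \<open>\<beta>\<close> with \<open>card D / \<beta> \<le>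
  s / 40\<close>. In units of \<open>l s\<close>, the exponent in the bound on the complement is then at most \<open>859 /
  1600\<close> (mean) plus \<open>41 / 160\<close> (Herbst) minus \<open>39 / 40\<close> (level), which is less than \<open>- 9 / 50\<close>;
  since \<open>s = (7 / 20) r t\<close> and \<open>r l \<ge> 16 K\<close>, this is enough for \<open>exp (- K t)\<close>.
\<close>
theorem mLSI_imp_two_level_concentration:
  assumes r: "1 < r" "r < 2" and \<mu>: "prob_measure_on d \<mu>" and C: "0 < C" and mLSI:
      "modified_log_Sobolev d r C \<mu>"
  shows "two_level_concentration d r (1 / 32 * min (1 / C) (1 / C powr (r - 1))) \<mu>"
proof -
  define K where "K = 1 / 32 * min (1 / C) (1 / C powr (r - 1))"
  obtain l where l: "0 < l" "C * (r / 2) * max 1 (l powr (conj_exponent r - 2)) * l \<le> 1 / 4"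
    "1 / 4 * min (1 / C) (1 / C powr (r - 1)) \<le> r / 2 * l"
    by (rule Herbst_parameter[OF r C])
  have lK: "16 * K \<le> r * l" using l(3) by (simp add: K_def)
  have main: "1 - exp (- (K * t))
      \<le> inner_measure (power_measure \<mu> n) (minkowski_sum d n A (enlargement_set d n r t))"
    if A: "A \<in> sets (power_measure \<mu> n)" "1 / 2 \<le> measure (power_measure \<mu> n) A" and t: "0 < t" for n A t
  proof -
    let ?P = "power_measure \<mu> n"
    define s where "s = 7 / 20 * r * t"
    have s: "0 < s" using r t by (simp add: s_def)
    obtain D where net: "finite D" "D \<subseteq> A"
      "19 / 40 \<le> measure ?P {x \<in> space ?P. \<exists>a\<in>D. soft_minimum.total_cost d n r x a < s / 40}"
      by (rule finite_net[OF \<mu> r A(1), of "19 / 40" "s / 40"]) (use A(2) s in auto)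
    define \<beta> where "\<beta> = 40 * (real (card D) + 1) / s"
    have \<beta>: "0 < \<beta>" using s by (simp add: \<beta>_def)
    have N: "card D / \<beta> \<le> s / 40" using s by (simp add: \<beta>_def field_simps)
    interpret soft_minimum d n r \<beta> s D \<mu> using r \<beta> s net(1) \<mu> by unfold_locales auto
    define m where "m = (\<integral>x. softmin x \<partial>?P)"
    have m: "m \<le> s - (s - s / 40) * (1 / 2 - 1 / 40)"
      unfolding m_def using net(3) s by (intro expectation_softmin_le) auto
    define Q where "Q = C * max 1 (l powr (conj_exponent r - 2)) * (r / 2) * (s + card D / \<beta>) * l\<^sup>2"
    have Q: "Q \<le> 41 / 160 * (l * s)"
    proof -
      have "Q = (C * (r / 2) * max 1 (l powr (conj_exponent r - 2)) * l) * (l * (s + card D / \<beta>))"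
        by (simp add: Q_def power2_eq_square mult_ac)
      also have "\<dots> \<le> 1 / 4 * (l * (s + s / 40))"
        using l s N \<beta> by (intro mult_mono mult_left_mono add_left_mono) auto
      finally show ?thesis by simp
    qed
    have "1 - exp (l * m + Q - l * (s - card D / \<beta>)) \<le> measure ?P {x \<in> space ?P. \<exists>a\<in>D. total_cost x a < s}"
      unfolding m_def Q_def by (rule soft_minimum_deviation[OF l(1) soft_minimum_moment[OF mLSI C l(1)]])
    also have "\<dots> \<le> inner_measure ?P (minkowski_sum d n A (enlargement_set d n r t))"
    proof (rule measure_le_inner_measure)
      show "finite_measure ?P" using P_prob by (rule prob_space.axioms(1))
      show "{x \<in> space ?P. \<exists>a\<in>D. total_cost x a < s} \<in> sets ?P" by (rule exists_near_measurable)
      show "{x \<in> space ?P. \<exists>a\<in>D. total_cost x a < s} \<subseteq> minkowski_sum d n A (enlargement_set d n r t)"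
        unfolding s_def by (rule cost_near_subset_enlargement[OF \<mu> r net(2) sets.sets_into_space[OF A(1)]])
    qed
    also have "1 - exp (- (K * t)) \<le> 1 - exp (l * m + Q - l * (s - card D / \<beta>))"
    proof -
      have "l * m \<le> l * (s - (s - s / 40) * (1 / 2 - 1 / 40))" "l * (card D / \<beta>) \<le> l * (s / 40)"
        by (rule mult_left_mono[OF m less_imp_le[OF l(1)]], rule mult_left_mono[OF N less_imp_le[OF l(1)]])
      then have "l * m + Q - l * (s - card D / \<beta>)
          \<le> l * (s - (s - s / 40) * (1 / 2 - 1 / 40)) + 41 / 160 * (l * s) - l * s + l * (s / 40)"
        using Q by (simp add: right_diff_distrib)
      also have "\<dots> = - (291 / 1600) * (l * s)" by (simp add: field_simps)
      also have "\<dots> \<le> - (9 / 50) * (l * s)" using l s by simp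
      also have "\<dots> = - (63 / 1000) * (r * l) * t" by (simp add: s_def)
      also have "\<dots> \<le> - (K * t)"
      proof -
        have "16 * K * t \<le> r * l * t" using lK t by (intro mult_right_mono) auto
        moreover have "0 \<le> r * l * t" using r l t by simp
        ultimately show ?thesis by simp
      qed
      finally show ?thesis by simp
    qed
    finally show ?thesis .
  qed
  show ?thesis
    unfolding two_level_concentration_def K_def[symmetric]
  proof (intro allI impI conjI)
    fix n A and t :: real
    let ?P = "power_measure \<mu> n" and ?A = "minkowski_sum d n A (enlargement_set d n r t)"
    let ?B = "minkowski_sum d n
            (minkowski_sum d n A (scale_Rdn d n (sqrt t) ` euclidean_unit_ball d n))
            (scale_Rdn d n (t powr (1 / r)) ` mixed_unit_ball d n r)"
    assume n: "0 < n" and A: "A \<in> sets ?P" "1 / 2 \<le> measure ?P A" and t: "0 < t"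
    show *: "1 - exp (- (K * t)) \<le> inner_measure ?P ?A"
      by (rule main[OF A t])
    also have "\<dots> \<le> inner_measure ?P ?B"
    proof (rule inner_measure_mono)
      interpret soft_minimum d n r 1 1 "{}" \<mu> using \<mu> r by unfold_locales auto
      show "finite_measure ?P" using P_prob by (rule prob_space.axioms(1))
    qed (rule enlargement_subset_sum_of_balls[OF t r])
    finally show "1 - exp (- (K * t)) \<le> inner_measure ?P ?B" .
  qed
qed

theorem corollary2p4:
  fixes r C_LO :: real
  assumes "1 < r" and "r < 2"
  shows
    "(\<exists>K>0. \<forall>d>0. \<forall>\<mu>. prob_measure_on d \<mu> \<longrightarrow> Latala_Oleszkiewicz d r C_LO \<mu> \<longrightarrow>
         two_level_concentration d r K \<mu>)
     \<and> (\<exists>C>0. \<forall>d>0. \<forall>\<mu>. prob_measure_on d \<mu> \<longrightarrow> Latala_Oleszkiewicz d r C_LO \<mu> \<longrightarrow>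
         modified_log_Sobolev d r C \<mu>)
     \<and> (\<forall>C>0. \<forall>d>0. \<forall>\<mu>. prob_measure_on d \<mu> \<longrightarrow> Latala_Oleszkiewicz d r C_LO \<mu> \<longrightarrow>
         modified_log_Sobolev d r C \<mu> \<longrightarrow>
         two_level_concentration d r (1 / 32 * min (1 / C) (1 / C powr (r - 1))) \<mu>)"
proof -
  obtain C where C: "0 < C" and mLSI: "\<And>d \<mu>. prob_measure_on d \<mu> \<Longrightarrow> Latala_Oleszkiewicz d r C_LO \<mu> \<Longrightarrow>
      modified_log_Sobolev d r C \<mu>"
    using Latala_Oleszkiewicz_imp_mLSI[OF assms] by blast
  note conc = mLSI_imp_two_level_concentration[OF assms]
  have "0 < 1 / 32 * min (1 / C) (1 / C powr (r - 1))" using C by simp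
  then show ?thesis using C mLSI conc by blast
qed

end
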